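(* For each $n \geq 1$, let $M_n$ be an $n \times n$ random matrix distributed according to Haar measure on one of the groups $\mathrm{O}(n)$, $\mathrm{SO}(n)$, $\mathrm{U}(n)$, or $\mathrm{Sp}(n)$ (the latter being defined only for even $n$). Let $\mu_{M_n}'$ be the empirical measure constructed from the roots of the derivative $p_{M_n}'$ of the characteristic polynomial $p_{M_n}(z) := \det(zI - M_n)$. Then $\mu_{M_n}'$ converges weakly in probability as $n \to \infty$ to the uniform probability distribution on the unit circle centered at the origin in $\mathbb{C}$.
   Context: For a polynomial $f$ of degree $d\ge 1$, the empirical measure of its roots is $\mu_f := \frac1d \sum_{z \in \mathbb{C}: f(z)=0} \mathcal{N}_f(z)\,\delta_z$, where $\mathcal{N}_f(z)$ is the multiplicity of the zero $z$ and $\delta_z$ is the unit point mass at $z$. For a square matrix $M$ with characteristic polynomial $p_M$, $\mu_M' := \mu_{p_M'}$ (for $n\times n$ matrices this is defined once $n \geq 2$, which is all that matters for the limit). Random probability measures $\mu_n$ on $\mathbb{C}$ converge weakly in probability to a probability measure $\mu$ on $\mathbb{C}$ if for every bounded continuous $f:\mathbb{C}\to\mathbb{R}$ and every $\varepsilon>0$, $\lim_{n\to\infty}\mathbb{P}\left(\left|\int f\,d\mu_n-\int f\,d\mu\right|>\varepsilon\right)=0$. $\mathrm{O}(n)$ is the group of real $n\times n$ matrices $M$ with $MM^{\mathrm T}=M^{\mathrm T}M=I_n$; $\mathrm{SO}(n)=\{M\in \mathrm{O}(n):\det M=1\}$; $\mathrm{U}(n)$ is the group of complex $n\times n$ matrices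 with $MM^*=M^*M=I_n$; for $n$ even, $\mathrm{Sp}(n)$ is the group of $M\in \mathrm{U}(n)$ with $MJM^{\mathrm T}=M^{\mathrm T}JM=J$, where $J=\begin{bmatrix}0&I_{n/2}\\-I_{n/2}&0\end{bmatrix}$. Haar measure on a compact group is its unique translation-invariant probability measure. *)

theory Defs
  imports
    "HOL-Probability.Probability"
    "Jordan_Normal_Form.Char_Poly"
    "Jordan_Normal_Form.Schur_Decomposition"
begin

(* Matrix groups.  The real groups are embedded into the complex matrices, so that all
   groups of size n live in one type. *)

definition real_orthogonal :: "nat \<Rightarrow> real mat set" where
  "real_orthogonal n = {A \<in> carrier_mat n n. A * A\<^sup>T = 1\<^sub>m n \<and> A\<^sup>T * A = 1\<^sub>m n}"

definition orthogonal_group :: "nat \<Rightarrow> complex mat set" where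
  "orthogonal_group n = map_mat complex_of_real ` real_orthogonal n"

(* The unqualified name det would be ambiguous with the determinant of HOL-Analysis. *)
definition special_orthogonal_group :: "nat \<Rightarrow> complex mat set" where
  "special_orthogonal_group n =
     map_mat complex_of_real ` {A \<in> real_orthogonal n. Determinant.det A = 1}"

definition unitary_group :: "nat \<Rightarrow> complex mat set" where
  "unitary_group n =
     {A \<in> carrier_mat n n. A * mat_adjoint A = 1\<^sub>m n \<and> mat_adjoint A * A = 1\<^sub>m n}"

definition symplectic_form :: "nat \<Rightarrow> complex mat" where
  "symplectic_form n =
     (let k = n div 2 in four_block_mat (0\<^sub>m k k) (1\<^sub>m k) (- 1\<^sub>m k) (0\<^sub>m k k))"

(* Only meaningful for even n. *)
definition symplectic_group :: "nat \<Rightarrow> complex mat set" where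
  "symplectic_group n =
     {A \<in> unitary_group n. A * symplectic_form n * A\<^sup>T = symplectic_form n \<and>
                            A\<^sup>T * symplectic_form n * A = symplectic_form n}"

definition classical_groups :: "nat \<Rightarrow> complex mat set set" where
  "classical_groups n =
     {orthogonal_group n, special_orthogonal_group n, unitary_group n} \<union>
     (if even n then {symplectic_group n} else {})"

(* The Borel sigma-algebra of a set G of n x n matrices.  It is pulled back from the finite
   product of copies of the Borel sigma-algebra of the complex numbers along the map sending
   a matrix to the family of its entries; since the complex numbers are second countable,
   this is generated by the relatively open subsets of G. *)
definition mat_borel :: "nat \<Rightarrow> complex mat set \<Rightarrow> complex mat measure" where
  "mat_borel n G =
     vimage_algebra G (\<lambda>A. \<lambda>ij\<in>{..<n} \<times> {..<n}. A $$ ij)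
       (\<Pi>\<^sub>M ij\<in>{..<n} \<times> {..<n}. (borel :: complex measure))"

definition haar_prob_measure :: "nat \<Rightarrow> complex mat set \<Rightarrow> complex mat measure \<Rightarrow> bool" where
  "haar_prob_measure n G \<nu> \<longleftrightarrow>
     prob_space \<nu> \<and> space \<nu> = G \<and> sets \<nu> = sets (mat_borel n G) \<and>
     (\<forall>A\<in>G. distr \<nu> \<nu> (\<lambda>X. A * X) = \<nu> \<and> distr \<nu> \<nu> (\<lambda>X. X * A) = \<nu>)"

definition haar_distributed ::
    "nat \<Rightarrow> complex mat set \<Rightarrow> 'w measure \<Rightarrow> ('w \<Rightarrow> complex mat) \<Rightarrow> bool" where
  "haar_distributed n G P X \<longleftrightarrow>
     X \<in> P \<rightarrow>\<^sub>M mat_borel n G \<and> haar_prob_measure n G (distr P (mat_borel n G) X)"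

(* Meaningful for degree f \<ge> 1 only. *)
definition root_measure :: "complex poly \<Rightarrow> complex measure" where
  "root_measure f =
     distr (point_measure {z. poly f z = 0} (\<lambda>z. ennreal (real (Polynomial.order z f) / real (degree f))))
       borel (\<lambda>z. z)"

lemma emeasure_root_measure:
  assumes "f \<noteq> 0" and "B \<in> sets borel"
  shows "emeasure (root_measure f) B =
           (\<Sum>z | poly f z = 0. ennreal (real (Polynomial.order z f) / real (degree f)) * indicator B z)"
proof -
  let ?w = "\<lambda>z. ennreal (real (Polynomial.order z f) / real (degree f))"
  let ?R = "{z. poly f z = 0}"
  have fin: "finite ?R"
    using assms(1) by (rule poly_roots_finite)
  have "emeasure (root_measure f) B = emeasure (point_measure ?R ?w) (?R \<inter> B)"
    unfolding root_measure_def using assms(2)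
    by (subst emeasure_distr)
       (auto simp: space_point_measure measurable_point_measure_eq1 intro!: arg_cong2[where f=emeasure])
  also have "\<dots> = (\<Sum>z\<in>?R \<inter> B. ?w z)"
    using fin by (intro emeasure_point_measure_finite) auto
  also have "\<dots> = (\<Sum>z\<in>?R. ?w z * indicator B z)"
    using fin by (intro sum.mono_neutral_cong_left) (auto simp: indicator_def)
  finally show ?thesis .
qed

definition derivative_root_measure :: "complex mat \<Rightarrow> complex measure" where
  "derivative_root_measure A = root_measure (pderiv (char_poly A))"

definition uniform_circle :: "complex measure" where
  "uniform_circle = distr (uniform_measure lborel {0..2 * pi}) borel cis"

(* Each \<open>\<mu> n\<close> is a random measure on its own probability space \<open>P n\<close>; this
   suffices because the limit is deterministic. *)
definition converges_weakly_in_prob ::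
    "(nat \<Rightarrow> 'w measure) \<Rightarrow> (nat \<Rightarrow> 'w \<Rightarrow> complex measure) \<Rightarrow> complex measure \<Rightarrow> bool" where
  "converges_weakly_in_prob P \<mu> \<mu>\<^sub>0 \<longleftrightarrow>
     (\<forall>f :: complex \<Rightarrow> real. continuous_on UNIV f \<longrightarrow> bounded (range f) \<longrightarrow>
       (\<forall>\<epsilon>>0. (\<lambda>n. measure (P n)
            {\<omega> \<in> space (P n). \<bar>integral\<^sup>L (\<mu> n \<omega>) f - integral\<^sup>L \<mu>\<^sub>0 f\<bar> > \<epsilon>})
          \<longlonglongrightarrow> 0))"

end

theory Submission
  imports Defs "HOL-Real_Asymp.Real_Asymp"
begin

text \<open>Let \<open>\<lambda>\<^sub>j\<close> be the eigenvalues of a unitary \<open>n \<times> n\<close> matrix \<open>M\<close> with characteristic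
  polynomial \<open>p\<close>, let \<open>T\<^sub>k = \<Sum> \<lambda>\<^sub>j\<^sup>k = tr M\<^sup>k\<close>, and let \<open>\<zeta>\<^sub>j\<close> be the zeros of \<open>p'\<close>. Two properties of
  the traces force the \<open>\<zeta>\<^sub>j\<close> to be equidistributed on the unit circle, and both hold with high
  probability because of the invariance of Haar measure under explicit group elements.

  Moments. Comparing \<open>p\<close> and \<open>p'\<close> as power series at infinity yields a recursion from which
  \<open>\<bar>\<Sum> \<zeta>\<^sub>j\<^sup>k - T\<^sub>k\<bar> \<le> 2\<^sup>k - 1\<close>, whatever \<open>n\<close> is (\<open>power_sum_critical_points_close\<close>). So the power
  sums of the critical points are \<open>o(n)\<close> as soon as \<open>T\<^sub>k = o(n)\<close>.

  Modulus. By Gauss-Lucas \<open>\<bar>\<zeta>\<^sub>j\<bar> \<le> 1\<close>. Since \<open>p'(0) / p(0) = - cnj T\<^sub>1\<close>, one has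
  \<open>\<bar>T\<^sub>1\<bar> = \<bar>p'(0)\<bar> = n \<Prod> \<bar>\<zeta>\<^sub>j\<bar>\<close>, whence \<open>\<Sum> (1 - \<bar>\<zeta>\<^sub>j\<bar>) \<le> ln (n / \<bar>T\<^sub>1\<bar>)\<close>
  (\<open>critical_points_near_circle\<close>). Unless the trace is exponentially small, almost all critical
  points are close to the circle, where \<open>z\<^sup>a (cnj z)\<^sup>b\<close> is close to a power of \<open>z\<close> or of its
  conjugate. The Stone-Weierstrass theorem then gives weak convergence
  (\<open>critical_points_equidistribute\<close>).

  Traces of powers are not large. All the classical groups contain the matrices of the permutations
  acting in the same way on two blocks of \<open>\<lfloor>n/2\<rfloor>\<close> indices. For each fixed unitary \<open>M\<close> the mean of
  \<open>\<bar>tr (M h)\<^sup>k\<bar>\<^sup>2\<close> over these \<open>h\<close> is at most the mean of the \<open>2k\<close>-th power of the number of fixed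
  points (\<open>sum_norm_traces_le_sum_fixed_points\<close>), which is bounded in \<open>n\<close>. By invariance the second
  moment of \<open>T\<^sub>k\<close> is bounded as well.

  The trace is not exponentially small. Along a one-parameter group \<open>h(\<phi>)\<close> of rotations the trace of
  \<open>M h(\<phi>)\<close>, or a single entry of that matrix, has the form \<open>C + A cos \<phi> + B sin \<phi>\<close>. If it is at most
  \<open>\<epsilon>\<close> at three of \<open>q\<close> given angles, then \<open>A\<close>, \<open>B\<close> and \<open>C + A\<close> are at most \<open>100 q\<^sup>2 \<epsilon>\<close>. So by
  invariance, apart from an event of probability \<open>2 / q\<close>, smallness is inherited by the coefficients
  (\<open>prob_small_rotation\<close>). In one or two such steps one passes from the trace to the entry \<open>M\<^sub>0\<^sub>0\<close>,
  and then doubles the number of small entries in the top row in each further step. After about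
  \<open>log n\<close> steps the whole row would be small, but it has norm 1. With \<open>q = n\<close> the factors lost amount
  only to \<open>exp (O(log\<^sup>2 n))\<close>, so the trace is exponentially small with probability tending to 0
  (\<open>eventually_small_trace_unlikely\<close>).\<close>

section \<open>Power sums of the roots and of the critical points\<close>

definition power_sum :: "complex multiset \<Rightarrow> nat \<Rightarrow> complex" where
  "power_sum M k = (\<Sum>x\<in>#M. x ^ k)"

text \<open>The reversed polynomial of the monic polynomial with root multiset \<open>M\<close>; its
  expansion at 0 is the expansion of that polynomial at infinity.\<close>
definition root_fps :: "complex multiset \<Rightarrow> complex fps" where
  "root_fps M = (\<Prod>x\<in>#M. 1 - fps_const x * fps_X)"

lemma root_fps_nonzero: "root_fps M \<noteq> 0"
proof -
  have "fps_nth (root_fps M) 0 = 1"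
    unfolding root_fps_def by (induction M) simp_all
  thus ?thesis by auto
qed

lemma geometric_fps: "(1 - fps_const x * fps_X) * Abs_fps (\<lambda>k. x ^ Suc k) = fps_const (x :: complex)"
proof (rule fps_ext)
  fix n
  have eq: "(1 - fps_const x * fps_X) * Abs_fps (\<lambda>k. x ^ Suc k) =
      Abs_fps (\<lambda>k. x ^ Suc k) - fps_const x * (fps_X * Abs_fps (\<lambda>k. x ^ Suc k))"
    by (simp add: algebra_simps)
  show "fps_nth ((1 - fps_const x * fps_X) * Abs_fps (\<lambda>k. x ^ Suc k)) n = fps_nth (fps_const x) n"
    unfolding eq by (cases n) (simp_all add: fps_X_mult_nth)
qed

text \<open>The logarithmic derivative of the reversed polynomial generates the power sums.\<close>
lemma fps_deriv_root_fps:
  "fps_deriv (root_fps M) = - (root_fps M * Abs_fps (\<lambda>k. power_sum M (Suc k)))"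
proof (induction M)
  case empty
  show ?case by (simp add: root_fps_def power_sum_def fps_zero_def[symmetric])
next
  case (add x M)
  let ?l = "1 - fps_const x * fps_X"
  let ?P = "\<lambda>M. Abs_fps (\<lambda>k. power_sum M (Suc k))"
  have 1: "root_fps (add_mset x M) = ?l * root_fps M" by (simp add: root_fps_def)
  have 2: "?P (add_mset x M) = Abs_fps (\<lambda>k. x ^ Suc k) + ?P M"
    by (rule fps_ext) (simp add: power_sum_def)
  have "fps_deriv (root_fps (add_mset x M)) = - fps_const x * root_fps M + ?l * - (root_fps M * ?P M)"
    unfolding 1 by (simp add: add.IH)
  also have "\<dots> = - ((?l * Abs_fps (\<lambda>k. x ^ Suc k)) * root_fps M + ?l * root_fps M * ?P M)"
    by (subst geometric_fps) (simp add: algebra_simps flip: fps_const_neg)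
  also have "\<dots> = - (root_fps (add_mset x M) * ?P (add_mset x M))"
    unfolding 1 2 by (simp add: algebra_simps)
  finally show ?case .
qed

lemma reflect_poly_prod_mset:
  "reflect_poly (\<Prod>x\<in>#M. f x) = (\<Prod>x\<in>#M. reflect_poly (f x :: complex poly))"
  by (induction M) (simp_all add: reflect_poly_mult)

lemma reflect_linear: "reflect_poly [:- x, 1:] = [:1, - x :: complex:]"
  by (rule poly_eqI) (auto simp: coeff_reflect_poly coeff_pCons split: nat.splits)

lemma fps_reflect_poly:
  "fps_of_poly (reflect_poly p) = fps_const (lead_coeff p) * root_fps (proots (p :: complex poly))"
proof -
  have lin: "fps_of_poly [:1, - x:] = 1 - fps_const x * fps_X" for x :: complex
    by (rule fps_ext) (auto simp: coeff_pCons fps_X_def split: nat.splits)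
  have "fps_of_poly (\<Prod>x\<in>#M. [:1, - x:]) = root_fps M" for M
    unfolding root_fps_def by (induction M) (simp_all add: fps_of_poly_mult lin del: mult_pCons_left)
  moreover have "reflect_poly p = Polynomial.smult (lead_coeff p) (\<Prod>x\<in>#proots p. [:1, - x:])"
    by (subst (1) complex_poly_decompose_multiset [symmetric])
      (simp add: reflect_poly_smult reflect_poly_prod_mset reflect_linear)
  ultimately show ?thesis by (simp add: fps_of_poly_smult)
qed

text \<open>Euler's relation: with \<open>p\<^sup>*(w) = w\<^sup>n p(1/w)\<close> one has \<open>w
  (p\<^sup>*)'(w) = n p\<^sup>*(w) - w\<^bsup>n-1\<^esup> p'(1/w)\<close>, so reversing the
  derivative needs nothing but the reversed polynomial.\<close>
lemma reflect_poly_pderiv: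
  fixes p :: "complex poly"
  assumes "degree p \<ge> 1"
  shows "reflect_poly (pderiv p) =
           Polynomial.smult (of_nat (degree p)) (reflect_poly p) - pCons 0 (pderiv (reflect_poly p))"
proof (rule poly_eqI)
  fix j
  show "coeff (reflect_poly (pderiv p)) j =
     coeff (Polynomial.smult (of_nat (degree p)) (reflect_poly p) - pCons 0 (pderiv (reflect_poly p))) j"
  proof (cases j)
    case 0
    with assms show ?thesis
      by (simp add: coeff_pderiv degree_pderiv flip: of_nat_Suc)
  next
    case (Suc i)
    consider "j < degree p" | "j = degree p" | "j > degree p" by linarith
    thus ?thesis
    proof cases
      case 1
      hence "Suc (degree p - 1 - j) = degree p - j" by simp
      hence "coeff (reflect_poly (pderiv p)) j = of_nat (degree p - j) * coeff p (degree p - j)"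
        using 1 by (simp add: coeff_reflect_poly degree_pderiv coeff_pderiv del: of_nat_Suc)
      also have "\<dots> = (of_nat (degree p) - of_nat j) * coeff p (degree p - j)"
        using 1 by (simp add: of_nat_diff)
      finally have "coeff (reflect_poly (pderiv p)) j = (of_nat (degree p) - of_nat j) * coeff p (degree p - j)" .
      thus ?thesis using 1
        by (simp add: Suc coeff_pderiv coeff_reflect_poly ring_distribs)
    next
      case 2
      hence "degree (pderiv p) < j" using Suc by (simp add: degree_pderiv)
      moreover have "degree p = Suc i" using 2 Suc by simp
      ultimately show ?thesis
        by (simp add: 2 coeff_pderiv coeff_reflect_poly del: of_nat_Suc)
    next
      case 3
      hence "degree (pderiv p) < j" using Suc by (simp add: degree_pderiv)
      thus ?thesis using 3
        by (simp add: Suc coeff_pderiv coeff_reflect_poly)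
    qed
  qed
qed

text \<open>A Newton-type recursion. If \<open>F\<close>, \<open>G\<close> are the reversed polynomials of
  \<open>p\<close>, \<open>p'\<close> and \<open>N\<close> generates the power sums of the
  roots, Euler's relation says \<open>n G = F N\<close>; taking the logarithmic derivative of
  both sides turns this into \<open>N' = N (P - S)\<close> with \<open>P\<close>,
  \<open>S\<close> the shifted generating functions of the two families of power sums.\<close>
lemma power_sum_critical_points:
  fixes p :: "complex poly"
  assumes "degree p \<ge> 1"
  defines "M \<equiv> proots p" and "Z \<equiv> proots (pderiv p)"
  shows "of_nat (Suc k) * power_sum M (Suc k) =
           (\<Sum>j\<le>k. power_sum M j * (power_sum M (Suc k - j) - power_sum Z (Suc k - j)))"
proof -
  define P where "P = (\<lambda>M. Abs_fps (\<lambda>k. power_sum M (Suc k)))"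
  define N where "N = Abs_fps (power_sum M)"
  let ?F = "root_fps M" and ?G = "root_fps Z" and ?n = "fps_const (of_nat (degree p) :: complex)"
  let ?c = "fps_const (lead_coeff p)"
  have c: "?c \<noteq> 0" using assms(1) by auto
  have N: "N = ?n + fps_X * P M"
  proof (rule fps_ext)
    fix i show "fps_nth N i = fps_nth (?n + fps_X * P M) i"
      by (cases i)
        (simp_all add: N_def P_def power_sum_def M_def size_proots_complex)
  qed
  have lc: "lead_coeff (pderiv p) = of_nat (degree p) * lead_coeff p"
    using assms(1) by (simp add: degree_pderiv coeff_pderiv flip: of_nat_Suc)
  have "fps_of_poly (reflect_poly (pderiv p)) =
      ?n * fps_of_poly (reflect_poly p) - fps_X * fps_deriv (fps_of_poly (reflect_poly p))"
    unfolding reflect_poly_pderiv[OF assms(1)]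
    by (simp add: fps_of_poly_diff fps_of_poly_smult fps_of_poly_pCons fps_of_poly_pderiv mult.commute)
  also have "\<dots> = ?n * (?c * ?F) - fps_X * fps_deriv (?c * ?F)"
    by (simp only: fps_reflect_poly M_def)
  also have "\<dots> = ?c * (?F * N)"
    by (simp add: fps_deriv_root_fps N algebra_simps P_def)
  finally have "?c * (?n * ?G) = ?c * (?F * N)"
    unfolding fps_reflect_poly lc Z_def by (simp add: algebra_simps flip: fps_const_mult)
  hence GN: "?n * ?G = ?F * N" using c by simp
  (* Both sides below are the derivative of n G = F N; F is cancelled afterwards. *)
  have "- (?n * ?G) * P Z = fps_deriv (?n * ?G)"
    by (simp add: fps_deriv_root_fps P_def algebra_simps)
  also have "\<dots> = fps_deriv ?F * N + ?F * fps_deriv N"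
    unfolding GN by (simp add: algebra_simps)
  also have "\<dots> = ?F * (fps_deriv N - N * P M)"
    by (simp add: fps_deriv_root_fps P_def algebra_simps)
  finally have "?F * (fps_deriv N - N * P M) = ?F * (- (N * P Z))"
    unfolding GN by (simp add: algebra_simps)
  hence "fps_deriv N - N * P M = - (N * P Z)"
    using mult_left_cancel[OF root_fps_nonzero[of M]] by blast
  hence "fps_deriv N = N * (P M - P Z)" by (simp add: algebra_simps)
  hence "fps_nth (fps_deriv N) k = fps_nth (N * (P M - P Z)) k" by simp
  thus ?thesis
    by (simp add: N_def P_def fps_mult_nth atLeast0AtMost Suc_diff_le)
qed

lemma norm_power_sum_le:
  assumes "\<And>x. x \<in># M \<Longrightarrow> norm x \<le> 1"
  shows "norm (power_sum M k) \<le> size M"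
  using assms
proof (induction M)
  case (add x M)
  have "norm (x ^ k) \<le> 1" using add.prems by (simp add: norm_power power_le_one)
  moreover have "norm (power_sum M k) \<le> size M" using add by simp
  ultimately show ?case
    using norm_triangle_ineq[of "x ^ k" "power_sum M k"] by (simp add: power_sum_def)
qed (simp add: power_sum_def)

text \<open>The term \<open>j = 0\<close> of the recursion carries the factor \<open>n\<close>, and the
  other power sums of the roots are at most \<open>n\<close>. Dividing by \<open>n\<close> gives
  \<open>b\<^sub>k \<le> k + b\<^sub>1 + \<dots> + b\<^bsub>k-1\<^esub>\<close> for the
  differences, which is solved by \<open>2\<^sup>k - 1\<close> whatever the degree is.\<close>
lemma power_sum_critical_points_close:
  fixes p :: "complex poly"
  assumes "degree p \<ge> 1" and disc: "\<And>x. x \<in># proots p \<Longrightarrow> norm x \<le> 1"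
  shows "k \<ge> 1 \<Longrightarrow> norm (power_sum (proots (pderiv p)) k - power_sum (proots p) k) \<le> 2 ^ k - 1"
proof (induction k rule: less_induct)
  case (less k)
  let ?n = "real (degree p)"
  let ?M = "proots p" and ?Z = "proots (pderiv p)"
  define d where "d = (\<lambda>j. power_sum ?M j - power_sum ?Z j)"
  obtain i where i: "k = Suc i" using less.prems by (cases k) auto
  have n: "?n > 0" using assms(1) by simp
  have bd: "norm (power_sum ?M j) \<le> ?n" for j
    using norm_power_sum_le[of ?M j] disc by (simp add: size_proots_complex)
  have P0: "power_sum ?M 0 = of_nat (degree p)" by (simp add: power_sum_def size_proots_complex)
  have "of_nat k * power_sum ?M k = (\<Sum>j\<le>i. power_sum ?M j * d (k - j))"
    unfolding i d_def by (rule power_sum_critical_points[OF assms(1)])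
  also have "{..i} = insert 0 {1..i}" by auto
  also have "(\<Sum>j\<in>insert 0 {1..i}. power_sum ?M j * d (k - j)) =
      of_nat (degree p) * d k + (\<Sum>j=1..i. power_sum ?M j * d (k - j))"
    by (simp add: P0)
  finally have "of_nat (degree p) * d k = of_nat k * power_sum ?M k - (\<Sum>j=1..i. power_sum ?M j * d (k - j))"
    by (simp add: algebra_simps)
  hence "norm (of_nat (degree p) * d k) \<le> norm (of_nat k * power_sum ?M k) + norm (\<Sum>j=1..i. power_sum ?M j * d (k - j))"
    by (metis norm_triangle_ineq4)
  also have "norm (of_nat k * power_sum ?M k) \<le> k * ?n"
    using bd by (simp add: norm_mult mult_left_mono)
  also have "norm (\<Sum>j=1..i. power_sum ?M j * d (k - j)) \<le> (\<Sum>j=1..i. ?n * (2 ^ (k - j) - 1))"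
  proof (rule sum_norm_le)
    fix j assume j: "j \<in> {1..i}"
    hence "k - j < k" "k - j \<ge> 1" using i by auto
    hence "norm (d (k - j)) \<le> 2 ^ (k - j) - 1"
      unfolding d_def using less.IH[of "k - j"] by (metis norm_minus_commute)
    thus "norm (power_sum ?M j * d (k - j)) \<le> ?n * (2 ^ (k - j) - 1)"
      unfolding norm_mult using bd[of j] by (intro mult_mono) auto
  qed
  also have "(\<Sum>j=1..i. ?n * (2 ^ (k - j) - 1)) = ?n * (2 ^ k - 1 - real k)"
  proof -
    have "(\<Sum>j=1..i. (2::real) ^ (Suc i - j) - 1) = 2 ^ Suc i - 1 - real (Suc i)"
    proof (induction i)
      case (Suc i)
      have "(\<Sum>j=1..Suc i. (2::real) ^ (Suc (Suc i) - j) - 1) = 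
        (2 ^ Suc i - 1) + (\<Sum>j=Suc 1..Suc i. (2::real) ^ (Suc (Suc i) - j) - 1)"
        by (subst sum.atLeast_Suc_atMost) auto
      also have "(\<Sum>j=Suc 1..Suc i. (2::real) ^ (Suc (Suc i) - j) - 1) = (\<Sum>j=1..i. (2::real) ^ (Suc i - j) - 1)"
        by (subst sum.shift_bounds_cl_Suc_ivl) simp
      finally show ?case using Suc by simp
    qed simp
    thus ?thesis unfolding i by (simp add: sum_distrib_left[symmetric])
  qed
  finally have "?n * norm (d k) \<le> ?n * (2 ^ k - 1)" by (simp add: norm_mult algebra_simps)
  hence "norm (d k) \<le> 2 ^ k - 1" using n by simp
  thus ?case by (simp add: d_def norm_minus_commute)
qed

section \<open>Critical points of polynomials with roots on the unit circle\<close>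

lemma poly_pderiv_prod_mset:
  assumes "z \<notin># M"
  shows "poly (pderiv (\<Prod>x\<in>#M. [:- x, 1:])) z =
           poly (\<Prod>x\<in>#M. [:- x, 1:]) z * (\<Sum>x\<in>#M. 1 / (z - x :: complex))"
  using assms
proof (induction M)
  case (add x M)
  hence zx: "z - x \<noteq> 0" and z: "z \<notin># M" by auto
  define Q S where "Q = (\<Prod>x\<in>#M. [:- x, 1:])" and "S = (\<Sum>x\<in>#M. 1 / (z - x))"
  have "poly (pderiv ([:- x, 1:] * Q)) z = (z - x) * (poly Q z * S) + poly Q z"
    using add.IH[OF z] by (simp add: pderiv_mult pderiv_pCons Q_def S_def del: mult_pCons_left)
  also have "\<dots> = poly ([:- x, 1:] * Q) z * (1 / (z - x) + S)"
    using zx by (simp add: field_simps del: mult_pCons_left)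
  finally show ?case by (simp add: Q_def S_def del: mult_pCons_left)
qed simp

lemma poly_pderiv_eq:
  assumes "z \<notin># proots p" "p \<noteq> 0"
  shows "poly (pderiv p) z = poly p z * (\<Sum>x\<in>#proots p. 1 / (z - x :: complex))"
proof -
  define c M where "c = lead_coeff p" and "M = proots p"
  have p: "p = Polynomial.smult c (\<Prod>x\<in>#M. [:- x, 1:])"
    unfolding c_def M_def by (rule complex_poly_decompose_multiset[symmetric])
  have "poly (pderiv p) z = c * poly (pderiv (\<Prod>x\<in>#M. [:- x, 1:])) z"
    by (subst p) (simp add: pderiv_smult)
  also have "\<dots> = c * (poly (\<Prod>x\<in>#M. [:- x, 1:]) z * (\<Sum>x\<in>#M. 1 / (z - x)))"
    using assms(1) by (subst poly_pderiv_prod_mset) (simp_all only: M_def not_False_eq_True)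
  also have "\<dots> = poly p z * (\<Sum>x\<in>#M. 1 / (z - x))"
    unfolding p[THEN arg_cong, of "\<lambda>p. poly p z"] by (simp only: poly_smult mult.assoc)
  finally show ?thesis unfolding M_def .
qed

text \<open>For \<open>\<bar>z\<bar> > 1\<close> every \<open>z / (z - x)\<close> with \<open>\<bar>x\<bar>
  \<le> 1\<close> has positive real part, so the logarithmic derivative of \<open>p\<close>
  cannot vanish at \<open>z\<close>.\<close>
lemma Gauss_Lucas_disc:
  fixes p :: "complex poly"
  assumes deg: "degree p \<ge> 1" and disc: "\<And>x. x \<in># proots p \<Longrightarrow> norm x \<le> 1"
    and z: "z \<in># proots (pderiv p)"
  shows "norm z \<le> 1"
proof (rule ccontr)
  assume "\<not> norm z \<le> 1"
  hence z1: "norm z > 1" by simp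
  have p0: "p \<noteq> 0" and dp0: "pderiv p \<noteq> 0" using deg by (auto simp: pderiv_eq_0_iff)
  have zM: "z \<notin># proots p" using disc z1 by force
  have "poly p z * (\<Sum>x\<in>#proots p. 1 / (z - x)) = 0"
    using z dp0 by (subst poly_pderiv_eq[OF zM p0, symmetric]) simp
  moreover have "poly p z \<noteq> 0" using zM p0 by simp
  ultimately have s0: "(\<Sum>x\<in>#proots p. 1 / (z - x)) = 0"
    using mult_eq_0_iff by blast
  have pos: "Re (z / (z - x)) > 0" if "norm x \<le> 1" for x
  proof -
    have "Re (z * cnj (z - x)) > 0"
    proof -
      have "Re (z * cnj x) \<le> norm z * norm x"
        using complex_Re_le_cmod[of "z * cnj x"] by (simp add: norm_mult)
      also have "\<dots> \<le> norm z * 1" using that by (intro mult_left_mono) auto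
      also have "\<dots> < norm z * norm z" using z1 by (intro mult_strict_left_mono) auto
      also have "\<dots> = Re (z * cnj z)" by (simp add: complex_mult_cnj cmod_def flip: power2_eq_square)
      finally show ?thesis by (simp add: algebra_simps)
    qed
    moreover have "z - x \<noteq> 0" using that z1 by auto
    ultimately show ?thesis by (simp add: Re_complex_div_gt_0)
  qed
  have "Re (\<Sum>x\<in>#M. z / (z - x)) > 0" if "M \<noteq> {#}" "\<And>x. x \<in># M \<Longrightarrow> norm x \<le> 1" for M
    using that
  proof (induction M)
    case (add x M)
    thus ?case using pos[of x] by (cases "M = {#}") (auto intro!: add_pos_pos)
  qed simp
  moreover have "proots p \<noteq> {#}" using deg size_proots_complex[of p] by auto
  ultimately have "Re (\<Sum>x\<in>#proots p. z / (z - x)) > 0" using disc by blast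
  moreover have "(\<Sum>x\<in>#proots p. z / (z - x)) = z * (\<Sum>x\<in>#proots p. 1 / (z - x))"
    by (subst sum_mset_distrib_left) simp
  ultimately show False by (simp only: s0) simp
qed

lemma sum_one_minus_le_ln_prod:
  assumes "\<And>z. z \<in># Z \<Longrightarrow> 0 < norm z"
  shows "(\<Sum>z\<in>#Z. 1 - norm z) \<le> - ln (\<Prod>z\<in>#Z. norm (z :: complex))"
  using assms
proof (induction Z)
  case (add z Z)
  have "(\<Prod>z\<in>#Z. norm z) > 0" if "\<And>z. z \<in># Z \<Longrightarrow> 0 < norm z" for Z :: "complex multiset"
    using that by (induction Z) auto
  hence "ln (norm z * (\<Prod>z\<in>#Z. norm z)) = ln (norm z) + ln (\<Prod>z\<in>#Z. norm z)"
    using add.prems by (intro ln_mult_pos) auto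
  moreover have "ln (norm z) \<le> norm z - 1" using add.prems by (intro ln_le_minus_one) auto
  ultimately show ?case using add by simp
qed simp

text \<open>The value \<open>p'(0)\<close> can be read off in two ways: from the critical points it has
  modulus \<open>n \<Prod> \<bar>z\<bar>\<close>, and from the logarithmic derivative at 0,
  where \<open>1 / x = cnj x\<close> on the circle, it has the modulus of the first power sum.
  Then \<open>1 - r \<le> - ln r\<close>.\<close>
lemma critical_points_near_circle:
  fixes p :: "complex poly"
  assumes deg: "degree p \<ge> 1" and monic: "lead_coeff p = 1"
    and circ: "\<And>x. x \<in># proots p \<Longrightarrow> norm x = 1"
    and nz: "power_sum (proots p) 1 \<noteq> 0"
  shows "(\<Sum>z\<in>#proots (pderiv p). 1 - norm z) \<le> ln (degree p / norm (power_sum (proots p) 1))"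
proof -
  let ?M = "proots p" and ?Z = "proots (pderiv p)"
  have p0: "p \<noteq> 0" and dp0: "pderiv p \<noteq> 0" using deg by (auto simp: pderiv_eq_0_iff)
  have prod: "norm (poly (\<Prod>x\<in>#M. [:- x, 1:]) 0) = (\<Prod>x\<in>#M. norm x)" for M :: "complex multiset"
    by (induction M) (simp_all add: norm_mult)
  have "(\<Prod>x\<in>#M. norm x) = 1" if "\<And>x. x \<in># M \<Longrightarrow> norm x = 1" for M :: "complex multiset"
    using that by (induction M) auto
  hence "norm (poly p 0) = 1"
    using prod[of ?M] circ by (metis complex_poly_decompose_multiset monic smult_1_left)
  moreover have "0 \<notin># ?M" using circ by force
  moreover have "(\<Sum>x\<in>#M. 1 / (0 - x)) = - cnj (power_sum M 1)" if "\<And>x. x \<in># M \<Longrightarrow> norm x = 1" for M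
    using that
  proof (induction M)
    case (add x M)
    have "1 / x = cnj x" using add.prems divide_conv_cnj[of x 1] by simp
    thus ?case using add by (simp add: power_sum_def)
  qed (simp add: power_sum_def)
  ultimately have 1: "norm (poly (pderiv p) 0) = norm (power_sum ?M 1)"
    using poly_pderiv_eq[of 0 p] p0 circ by (simp only: norm_mult) (simp add: norm_mult)
  have lc: "lead_coeff (pderiv p) = of_nat (degree p)"
    using deg monic by (simp add: degree_pderiv coeff_pderiv flip: of_nat_Suc)
  have "norm (poly (pderiv p) 0) = degree p * (\<Prod>z\<in>#?Z. norm z)"
    by (subst complex_poly_decompose_multiset[symmetric, of "pderiv p"])
      (simp add: lc norm_mult prod)
  with 1 have 2: "(\<Prod>z\<in>#?Z. norm z) = norm (power_sum ?M 1) / degree p"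
    using deg by (simp add: field_simps)
  have "poly (pderiv p) 0 \<noteq> 0" using 1 nz by auto
  hence "0 < norm z" if "z \<in># ?Z" for z using that dp0 by auto
  hence "(\<Sum>z\<in>#?Z. 1 - norm z) \<le> - ln (\<Prod>z\<in>#?Z. norm z)" by (rule sum_one_minus_le_ln_prod)
  also have "\<dots> = ln (degree p / norm (power_sum ?M 1))"
    unfolding 2 using nz deg by (simp add: ln_div)
  finally show ?thesis .
qed

section \<open>Test functions and the uniform distribution on the circle\<close>

text \<open>Polynomials in \<open>z\<close> and \<open>cnj z\<close>, one list entry \<open>(c, a,
  b)\<close> for each term \<open>c z\<^sup>a (cnj z)\<^sup>b\<close>. Lists rather than
  coefficient functions make products a concatenation.\<close>
definition zbar_poly :: "(complex \<times> nat \<times> nat) list \<Rightarrow> complex \<Rightarrow> complex" where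
  "zbar_poly xs z = (\<Sum>(c, a, b)\<leftarrow>xs. c * z ^ a * cnj z ^ b)"

lemma zbar_poly_simps [simp]:
  "zbar_poly [] z = 0"
  "zbar_poly ((c, a, b) # xs) z = c * z ^ a * cnj z ^ b + zbar_poly xs z"
  "zbar_poly (xs @ ys) z = zbar_poly xs z + zbar_poly ys z"
  by (simp_all add: zbar_poly_def)

lemma continuous_on_zbar_poly: "continuous_on A (zbar_poly xs)"
proof (induction xs)
  case (Cons x xs)
  obtain c a b where x: "x = (c, a, b)" by (cases x)
  have "zbar_poly (x # xs) = (\<lambda>z. c * z ^ a * cnj z ^ b + zbar_poly xs z)" by (simp add: x fun_eq_iff)
  thus ?case using Cons by (auto intro!: continuous_intros)
qed (simp add: zbar_poly_def[abs_def])

lemma zbar_poly_mult: "\<exists>zs. \<forall>z. zbar_poly xs z * zbar_poly ys z = zbar_poly zs z"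
proof (induction xs)
  case Nil
  show ?case by (rule exI[of _ "[]"]) simp
next
  case (Cons x xs)
  then obtain zs where zs: "\<And>z. zbar_poly xs z * zbar_poly ys z = zbar_poly zs z" by auto
  obtain c a b where x: "x = (c, a, b)" by (cases x)
  have "c * z ^ a * cnj z ^ b * zbar_poly ys z =
      zbar_poly (map (\<lambda>(c', a', b'). (c * c', a + a', b + b')) ys) z" for z
    by (induction ys) (auto simp: algebra_simps power_add)
  hence "zbar_poly (x # xs) z * zbar_poly ys z =
      zbar_poly (map (\<lambda>(c', a', b'). (c * c', a + a', b + b')) ys @ zs) z" for z
    unfolding x by (simp add: distrib_right zs)
  thus ?case by blast
qed

lemma zbar_poly_dense_on_disc:
  fixes f :: "complex \<Rightarrow> real"
  assumes "continuous_on UNIV f" "e > 0"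
  obtains g xs where "\<And>z. complex_of_real (g z) = zbar_poly xs z"
    "\<And>z. norm z \<le> 1 \<Longrightarrow> \<bar>f z - g z\<bar> < e"
proof -
  define R where "R = (\<lambda>g. \<exists>xs. \<forall>z. complex_of_real (g z) = zbar_poly xs z)"
  have "\<exists>g. R g \<and> (\<forall>z\<in>cball 0 1. \<bar>f z - g z\<bar> < e)"
  proof (rule Stone_Weierstrass_HOL)
    show "R (\<lambda>z. c)" for c
      unfolding R_def by (rule exI[of _ "[(of_real c, 0, 0)]"]) simp
    show "continuous_on (cball 0 1) g" if R: "R g" for g
    proof -
      obtain xs where xs: "\<And>z. complex_of_real (g z) = zbar_poly xs z" using R unfolding R_def by blast
      have "g = (\<lambda>z. Re (zbar_poly xs z))" by (metis Re_complex_of_real xs)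
      thus ?thesis by (auto intro!: continuous_intros continuous_on_zbar_poly)
    qed
    show "R (\<lambda>x. g x + h x)" if gh: "R g \<and> R h" for g h
    proof -
      obtain xs ys where "\<forall>z. complex_of_real (g z) = zbar_poly xs z" "\<forall>z. complex_of_real (h z) = zbar_poly ys z"
        using gh unfolding R_def by blast
      thus ?thesis unfolding R_def by (intro exI[of _ "xs @ ys"]) simp
    qed
    show "R (\<lambda>x. g x * h x)" if gh: "R g \<and> R h" for g h
    proof -
      obtain xs ys where "\<forall>z. complex_of_real (g z) = zbar_poly xs z" "\<forall>z. complex_of_real (h z) = zbar_poly ys z"
        using gh unfolding R_def by blast
      moreover obtain zs where "\<forall>z. zbar_poly xs z * zbar_poly ys z = zbar_poly zs z" using zbar_poly_mult by blast
      ultimately show ?thesis unfolding R_def by (intro exI[of _ zs]) simp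
    qed
    show "\<exists>g. R g \<and> g x \<noteq> g y" if "x \<in> cball 0 1 \<and> y \<in> cball 0 1 \<and> x \<noteq> y" for x y :: complex
    proof -
      have "R Re" unfolding R_def
        by (rule exI[of _ "[(1/2, 1, 0), (1/2, 0, 1)]"]) (auto simp: complex_eq_iff)
      moreover have "R Im" unfolding R_def
        by (rule exI[of _ "[(- \<i> / 2, 1, 0), (\<i> / 2, 0, 1)]"]) (auto simp: complex_eq_iff)
      ultimately show ?thesis using that by (metis complex_eqI)
    qed
  qed (use assms in \<open>auto intro: continuous_on_subset\<close>)
  then obtain g xs where "\<forall>z. complex_of_real (g z) = zbar_poly xs z" "\<forall>z\<in>cball 0 1. \<bar>f z - g z\<bar> < e"
    unfolding R_def by blast
  thus ?thesis by (intro that[of g xs]) auto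
qed

lemma sum_mset_image_eq_sum_count:
  "(\<Sum>x\<in>#M. f x) = (\<Sum>x\<in>set_mset M. real (count M x) * f x)"
proof (induction M)
  case (add y M)
  have "(\<Sum>x\<in>set_mset (add_mset y M). real (count (add_mset y M) x) * f x) =
      (\<Sum>x\<in>set_mset (add_mset y M). real (count M x) * f x + (if x = y then f y else 0))"
    by (intro sum.cong) (auto simp: algebra_simps)
  also have "\<dots> = (\<Sum>x\<in>insert y (set_mset M). real (count M x) * f x) + f y"
    by (simp add: sum.distrib)
  also have "(\<Sum>x\<in>insert y (set_mset M). real (count M x) * f x) = (\<Sum>x\<in>set_mset M. real (count M x) * f x)"
    by (intro sum.mono_neutral_right) (auto simp: count_eq_zero_iff)
  finally show ?case using add by simp
qed simp

lemma borel_measurable_cis [measurable]: "cis \<in> borel_measurable borel"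
  by (intro borel_measurable_continuous_onI continuous_intros)

lemma borel_measurable_cnj [measurable]: "cnj \<in> borel_measurable borel"
  by (intro borel_measurable_continuous_onI continuous_intros)

lemma integral_root_measure:
  fixes f :: "complex \<Rightarrow> real"
  assumes "q \<noteq> 0" "f \<in> borel_measurable borel"
  shows "integral\<^sup>L (root_measure q) f = (\<Sum>z\<in>#proots q. f z) / degree q"
proof -
  let ?R = "{z. poly q z = 0}"
  have fin: "finite ?R" using assms(1) by (rule poly_roots_finite)
  have "integral\<^sup>L (root_measure q) f =
      integral\<^sup>L (point_measure ?R (\<lambda>z. ennreal (real (Polynomial.order z q) / real (degree q)))) f"
    unfolding root_measure_def using assms(2)
    by (subst integral_distr) (auto simp: measurable_point_measure_eq1)
  also have "\<dots> = (\<Sum>z\<in>?R. real (Polynomial.order z q) / real (degree q) * f z)"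
    by (subst lebesgue_integral_point_measure_finite[OF fin]) auto
  also have "\<dots> = (\<Sum>z\<in>?R. real (Polynomial.order z q) * f z) / degree q"
    by (simp add: sum_divide_distrib)
  also have "(\<Sum>z\<in>?R. real (Polynomial.order z q) * f z) = (\<Sum>z\<in>#proots q. f z)"
    using assms(1) by (subst sum_mset_image_eq_sum_count) simp_all
  finally show ?thesis .
qed

lemma prob_space_uniform_circle: "prob_space uniform_circle"
proof -
  interpret prob_space "uniform_measure lborel {0..2 * pi}"
    by (rule prob_space_uniform_measure) (auto simp: emeasure_lborel_Icc_eq)
  show ?thesis unfolding uniform_circle_def by (rule prob_space_distr) simp
qed

lemma uniform_circle_sets [simp, measurable_cong]: "sets uniform_circle = sets borel"
  by (simp add: uniform_circle_def)

lemma uniform_circle_space [simp]: "space uniform_circle = UNIV"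
  by (simp add: uniform_circle_def)

lemma AE_uniform_circle: "AE z in uniform_circle. norm z = 1"
  unfolding uniform_circle_def by (subst AE_distr_iff) auto

lemma integral_uniform_circle:
  fixes f :: "complex \<Rightarrow> complex"
  assumes [measurable]: "f \<in> borel_measurable borel"
  shows "integral\<^sup>L uniform_circle f = (LBINT t:{0..2*pi}. f (cis t)) / (2 * pi)"
proof -
  have m: "uniform_measure lborel {0..2 * pi} = 
    density lborel (\<lambda>t. ennreal (indicator {0..2*pi} t / (2 * pi)))"
    unfolding uniform_measure_def
    by (intro arg_cong2[where f=density] refl ext)
      (auto simp: emeasure_lborel_Icc_eq indicator_def divide_ennreal[symmetric] ennreal_1[symmetric] simp del: ennreal_1)
  have "integral\<^sup>L uniform_circle f = integral\<^sup>L (uniform_measure lborel {0..2 * pi}) (\<lambda>t. f (cis t))"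
    unfolding uniform_circle_def by (subst integral_distr) auto
  also have "\<dots> = (LBINT t. (indicator {0..2*pi} t / (2 * pi)) *\<^sub>R f (cis t))"
    unfolding m by (subst integral_density) auto
  also have "\<dots> = (LBINT t. (indicator {0..2*pi} t *\<^sub>R f (cis t)) / (2 * pi))"
    by (intro Bochner_Integration.integral_cong refl) (simp add: scaleR_conv_of_real)
  also have "\<dots> = (LBINT t:{0..2*pi}. f (cis t)) / (2 * pi)"
    unfolding set_lebesgue_integral_def by simp
  finally show ?thesis .
qed

lemma cis_integral_zero:
  assumes "m \<noteq> 0"
  shows "(LBINT t:{0..2*pi}. cis (of_int m * t)) = 0"
proof -
  let ?F = "\<lambda>t. cis (of_int m * t) / (\<i> * of_int m)"
  have "(LBINT t. indicator {0..2*pi} t *\<^sub>R cis (of_int m * t)) = ?F (2 * pi) - ?F 0"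
  proof (rule integral_FTC_Icc)
    show "(?F has_vector_derivative cis (of_int m * x)) (at x within {0..2*pi})" for x
      using assms unfolding cis_conv_exp
      by (auto intro!: derivative_eq_intros has_vector_derivative_real_field simp: field_simps)
    show "continuous_on {0..2*pi} (\<lambda>x. cis (of_int m * x))" by (intro continuous_intros)
  qed auto
  also have "cis (of_int m * (2 * pi)) = 1"
    using cis_multiple_2pi[of "of_int m"] by (simp add: mult_ac)
  finally show ?thesis by (simp add: set_lebesgue_integral_def)
qed

lemma integral_uniform_circle_monomial:
  "integral\<^sup>L uniform_circle (\<lambda>z. z ^ a * cnj z ^ b) = (if a = b then 1 else 0)"
proof -
  have eq: "cis t ^ a * cnj (cis t) ^ b = cis (of_int (int a - int b) * t)" for t
    by (simp add: cis_cnj Complex.DeMoivre cis_mult algebra_simps)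
  have "integral\<^sup>L uniform_circle (\<lambda>z. z ^ a * cnj z ^ b) =
      (LBINT t:{0..2*pi}. cis (of_int (int a - int b) * t)) / (2 * pi)"
    by (subst integral_uniform_circle) (simp_all only: eq, measurable)
  also have "\<dots> = (if a = b then 1 else 0)"
  proof (cases "a = b")
    case True
    thus ?thesis by (simp add: set_lebesgue_integral_def scaleR_conv_of_real)
  next
    case False
    thus ?thesis using cis_integral_zero[of "int a - int b"] by simp
  qed
  finally show ?thesis .
qed

lemma integrable_uniform_circle:
  fixes f :: "complex \<Rightarrow> 'b :: {second_countable_topology, banach}"
  assumes "continuous_on UNIV f"
  shows "integrable uniform_circle f"
proof -
  interpret prob_space uniform_circle by (rule prob_space_uniform_circle)
  have "compact (f ` sphere 0 1)"
    by (intro compact_continuous_image continuous_on_subset[OF assms]) auto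
  hence "bounded (f ` sphere 0 1)" by (rule compact_imp_bounded)
  then obtain B where "\<forall>y\<in>f ` sphere 0 1. norm y \<le> B" unfolding bounded_iff by blast
  hence B: "norm (f z) \<le> B" if "norm z = 1" for z using that by simp
  show ?thesis
  proof (rule integrable_const_bound)
    show "AE z in uniform_circle. norm (f z) \<le> B" using AE_uniform_circle by eventually_elim (rule B)
    show "f \<in> borel_measurable uniform_circle" using borel_measurable_continuous_onI[OF assms] by simp
  qed
qed

lemma integral_uniform_circle_zbar_poly:
  "integral\<^sup>L uniform_circle (zbar_poly xs) = (\<Sum>(c, a, b)\<leftarrow>xs. if a = b then c else 0)"
  and integrable_uniform_circle_zbar_poly: "integrable uniform_circle (zbar_poly xs)"
proof (induction xs)
  case Nil
  show "integral\<^sup>L uniform_circle (zbar_poly []) = (\<Sum>(c, a, b)\<leftarrow>[]. if a = b then c else 0)"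
    "integrable uniform_circle (zbar_poly [])" by (simp_all add: zbar_poly_def[abs_def])
next
  case (Cons x xs)
  obtain c a b where x: "x = (c, a, b)" by (cases x)
  have eq: "zbar_poly (x # xs) = (\<lambda>z. c * (z ^ a * cnj z ^ b) + zbar_poly xs z)" by (simp add: x fun_eq_iff)
  have int: "integrable uniform_circle (\<lambda>z. c * (z ^ a * cnj z ^ b))"
    by (intro integrable_uniform_circle continuous_intros)
  show "integral\<^sup>L uniform_circle (zbar_poly (x # xs)) = (\<Sum>(c, a, b)\<leftarrow>x # xs. if a = b then c else 0)"
    unfolding eq using Cons int
    by (subst Bochner_Integration.integral_add) (auto simp: x integral_uniform_circle_monomial)
  show "integrable uniform_circle (zbar_poly (x # xs))"
    unfolding eq using Cons int by (intro Bochner_Integration.integrable_add)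
qed

section \<open>Equidistribution of critical points\<close>

lemma norm_sum_mset_le:
  fixes f :: "'a \<Rightarrow> 'b :: real_normed_vector"
  assumes "\<And>x. x \<in># M \<Longrightarrow> norm (f x) \<le> g x"
  shows "norm (\<Sum>x\<in>#M. f x) \<le> (\<Sum>x\<in>#M. g x)"
  using assms
proof (induction M)
  case (add x M)
  thus ?case by (auto intro!: norm_triangle_le add_mono)
qed simp

lemma sum_mset_subtractf:
  fixes f :: "'a \<Rightarrow> 'b :: ab_group_add"
  shows "(\<Sum>x\<in>#M. f x - g x) = (\<Sum>x\<in>#M. f x) - (\<Sum>x\<in>#M. g x)"
  by (induction M) simp_all

lemma one_minus_power_le:
  assumes "0 \<le> r" "r \<le> (1::real)"
  shows "1 - r ^ m \<le> m * (1 - r)"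
  using Bernoulli_inequality[of "r - 1" m] assms by (simp add: algebra_simps)

text \<open>Near the circle \<open>z\<^sup>a (cnj z)\<^sup>b\<close> is almost
  \<open>z\<^bsup>a-b\<^esup>\<close>: the two differ by a factor
  \<open>\<bar>z\<bar>\<^bsup>2b\<^esup>\<close>. Hence the mixed moments of a multiset in the
  disc are controlled by its power sums and its total distance from the circle.\<close>
lemma monomial_sum_le:
  fixes K :: nat and s t :: real
  assumes disc: "\<And>z. z \<in># Z \<Longrightarrow> norm z \<le> 1"
    and near: "(\<Sum>z\<in>#Z. 1 - norm z) \<le> s"
    and mom: "\<And>k. 1 \<le> k \<Longrightarrow> k \<le> K \<Longrightarrow> norm (power_sum Z k) \<le> t"
    and ab: "a \<le> K" "b \<le> K" and t: "t \<ge> 0"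
  shows "norm ((\<Sum>z\<in>#Z. z ^ a * cnj z ^ b) - (if a = b then of_nat (size Z) else 0)) \<le> 2 * K * s + t"
proof -
  define E where "E = (\<lambda>a b. (\<Sum>z\<in>#Z. z ^ a * cnj z ^ b) - (if a = b then of_nat (size Z) else 0))"
  have sym: "norm (E a b) = norm (E b a)" for a b
  proof -
    have "(\<Sum>z\<in>#M. z ^ a * cnj z ^ b) = cnj (\<Sum>z\<in>#M. z ^ b * cnj z ^ a)" for M
      by (induction M) simp_all
    hence "E a b = cnj (E b a)" by (simp add: E_def)
    thus ?thesis by simp
  qed
  have "norm (E a b) \<le> 2 * K * s + t" if le: "b \<le> a" "a \<le> K" "b \<le> K" for a b
  proof -
    let ?m = "a - b"
    have s: "s \<ge> 0"
    proof -
      have "0 \<le> (\<Sum>z\<in>#Z. 1 - norm z)" using norm_sum_mset_le[of Z "\<lambda>_. 0 :: real" "\<lambda>z. 1 - norm z"] disc by simp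
      with near show ?thesis by simp
    qed
    have "norm ((\<Sum>z\<in>#Z. z ^ a * cnj z ^ b) - power_sum Z ?m) =
        norm (\<Sum>z\<in>#Z. z ^ a * cnj z ^ b - z ^ ?m)"
      by (simp add: power_sum_def sum_mset_subtractf)
    also have "\<dots> \<le> (\<Sum>z\<in>#Z. (2 * K) * (1 - norm z))"
    proof (rule norm_sum_mset_le)
      fix z assume "z \<in># Z"
      hence z: "norm z \<le> 1" by (rule disc)
      have "z ^ a * cnj z ^ b = z ^ ?m * (z * cnj z) ^ b"
        using le(1) by (simp add: power_mult_distrib flip: power_add)
      also have "(z * cnj z) ^ b = of_real (norm z ^ (2 * b))"
        by (simp only: complex_norm_square[symmetric] power_mult of_real_power)
      finally have eq: "z ^ a * cnj z ^ b - z ^ ?m = z ^ ?m * complex_of_real (norm z ^ (2 * b) - 1)"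
        by (simp add: algebra_simps)
      have "norm (z ^ a * cnj z ^ b - z ^ ?m) = norm z ^ ?m * \<bar>norm z ^ (2 * b) - 1\<bar>"
        unfolding eq norm_mult norm_power norm_of_real ..
      also have "\<dots> \<le> 1 * (1 - norm z ^ (2 * b))"
        using z by (intro mult_mono) (auto simp: power_le_one)
      also have "\<dots> \<le> real (2 * b) * (1 - norm z)" using z one_minus_power_le[of "norm z" "2 * b"] by simp
      also have "\<dots> \<le> (2 * K) * (1 - norm z)" using le z by (intro mult_right_mono) auto
      finally show "norm (z ^ a * cnj z ^ b - z ^ ?m) \<le> (2 * K) * (1 - norm z)" by simp
    qed
    also have "\<dots> = (2 * K) * (\<Sum>z\<in>#Z. (1 - norm z))" by (subst sum_mset_distrib_left) simp
    also have "\<dots> \<le> (2 * K) * s" using near by (intro mult_left_mono) auto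
    finally have 1: "norm ((\<Sum>z\<in>#Z. z ^ a * cnj z ^ b) - power_sum Z ?m) \<le> 2 * K * s" .
    show ?thesis
    proof (cases "a = b")
      case True
      thus ?thesis using 1 t by (simp add: power_sum_def E_def)
    next
      case False
      hence "norm (power_sum Z ?m) \<le> t" using le by (intro mom) auto
      thus ?thesis using 1 False norm_triangle_sub[of "\<Sum>z\<in>#Z. z ^ a * cnj z ^ b" "power_sum Z ?m"]
        by (simp add: E_def)
    qed
  qed
  hence "norm (E a b) \<le> 2 * K * s + t"
    using ab sym[of a b] by (metis nat_le_linear)
  thus ?thesis by (simp only: E_def)
qed

lemma zbar_poly_sum_le:
  fixes K :: nat and s t :: real
  assumes disc: "\<And>z. z \<in># Z \<Longrightarrow> norm z \<le> 1"
    and near: "(\<Sum>z\<in>#Z. 1 - norm z) \<le> s"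
    and mom: "\<And>k. 1 \<le> k \<Longrightarrow> k \<le> K \<Longrightarrow> norm (power_sum Z k) \<le> t"
    and t: "t \<ge> 0"
    and K: "\<And>c a b. (c, a, b) \<in> set xs \<Longrightarrow> a \<le> K \<and> b \<le> K"
  shows "norm ((\<Sum>z\<in>#Z. zbar_poly xs z) - of_nat (size Z) * (\<Sum>(c, a, b)\<leftarrow>xs. if a = b then c else 0))
           \<le> (\<Sum>x\<leftarrow>xs. norm (fst x)) * (2 * K * s + t)"
  using K
proof (induction xs)
  case Nil
  show ?case by (simp add: zbar_poly_def)
next
  case (Cons x xs)
  obtain c a b where x: "x = (c, a, b)" by (cases x)
  define D where "D = (\<Sum>z\<in>#Z. z ^ a * cnj z ^ b) - (if a = b then of_nat (size Z) else 0)"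
  define E where "E = (\<Sum>z\<in>#Z. zbar_poly xs z) - of_nat (size Z) * (\<Sum>(c, a, b)\<leftarrow>xs. if a = b then c else 0)"
  have "a \<le> K" "b \<le> K" using Cons.prems[of c a b] x by auto
  hence "norm D \<le> real (2 * K) * s + t"
    unfolding D_def by (intro monomial_sum_le[OF disc near mom _ _ t])
  hence 1: "norm (c * D) \<le> norm c * (2 * K * s + t)" by (simp add: norm_mult mult_left_mono)
  have 2: "norm E \<le> (\<Sum>x\<leftarrow>xs. norm (fst x)) * (2 * K * s + t)"
    unfolding E_def by (rule Cons.IH) (use Cons.prems in \<open>auto simp: x\<close>)
  have "(\<Sum>z\<in>#Z. zbar_poly (x # xs) z) = (\<Sum>z\<in>#Z. c * (z ^ a * cnj z ^ b) + zbar_poly xs z)"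
    by (intro arg_cong[where f = sum_mset] image_mset_cong) (simp add: x mult.assoc)
  also have "\<dots> = c * (\<Sum>z\<in>#Z. z ^ a * cnj z ^ b) + (\<Sum>z\<in>#Z. zbar_poly xs z)"
    by (subst sum_mset_distrib_left) (simp add: sum_mset.distrib)
  finally have eq: "(\<Sum>z\<in>#Z. zbar_poly (x # xs) z) - of_nat (size Z) * (\<Sum>(c, a, b)\<leftarrow>x # xs. if a = b then c else 0) = c * D + E"
    unfolding D_def E_def by (simp add: x algebra_simps)
  have "norm (c * D + E) \<le> norm c * (2 * K * s + t) + (\<Sum>x\<leftarrow>xs. norm (fst x)) * (2 * K * s + t)"
    using norm_triangle_ineq[of "c * D" E] 1 2 by linarith
  thus ?case unfolding eq by (simp add: x distrib_right)
qed

text \<open>The deterministic half of the argument. Approximating \<open>f\<close> on the closed disc by a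
  polynomial in \<open>z\<close> and \<open>cnj z\<close> reduces the claim to finitely many
  mixed moments of the critical points, and these are small once the first \<open>K\<close>
  power sums of the roots are \<open>o(n)\<close> and the first one is not exponentially small.\<close>
lemma critical_points_equidistribute:
  fixes f :: "complex \<Rightarrow> real"
  assumes cont: "continuous_on UNIV f" and e: "e > 0"
  shows "\<exists>(K :: nat) (\<delta> :: real). \<delta> > 0 \<and>
    (\<forall>p. degree p \<ge> 2 \<longrightarrow> lead_coeff p = 1 \<longrightarrow> (\<forall>x\<in>#proots p. norm x = 1) \<longrightarrow>
       power_sum (proots p) 1 \<noteq> 0 \<longrightarrow>
       ln (degree p / norm (power_sum (proots p) 1)) \<le> \<delta> * degree p \<longrightarrow>
       (\<forall>k\<in>{1..K}. norm (power_sum (proots p) k) \<le> \<delta> * degree p) \<longrightarrow>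
       2 ^ K \<le> \<delta> * degree p \<longrightarrow>
       \<bar>integral\<^sup>L (root_measure (pderiv p)) f - integral\<^sup>L uniform_circle f\<bar> \<le> e)"
proof -
  have e3: "e / 3 > 0" using e by simp
  obtain g xs where gxs: "\<And>z. complex_of_real (g z) = zbar_poly xs z"
    and close: "\<And>z. norm z \<le> 1 \<Longrightarrow> \<bar>f z - g z\<bar> < e / 3"
    using zbar_poly_dense_on_disc[OF cont e3] by metis
  define C where "C = (\<Sum>x\<leftarrow>xs. norm (fst x))"
  have C0: "C \<ge> 0" unfolding C_def by (intro sum_list_nonneg) auto
  obtain K where K: "\<And>c a b. (c, a, b) \<in> set xs \<Longrightarrow> a \<le> K \<and> b \<le> K"
  proof
    fix c a b assume "(c, a, b) \<in> set xs"
    thus "a \<le> Max (insert 0 ((\<lambda>(c, a, b). max a b) ` set xs)) \<and> b \<le> Max (insert 0 ((\<lambda>(c, a, b). max a b) ` set xs))"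
      by (force simp: Max_ge_iff)
  qed
  (* Each monomial of degree at most K in both variables contributes an error of at most (2 K +
     2) \<delta> n, where n \<le> 2 (n - 1) accounts for the n - 1 critical points. *)
  define \<delta> where "\<delta> = e / (3 * (4 * K + 4) * (C + 1))"
  have \<delta>: "\<delta> > 0" unfolding \<delta>_def using e C0 by simp
  have contg: "continuous_on UNIV g"
  proof -
    have "g = (\<lambda>z. Re (zbar_poly xs z))" by (metis Re_complex_of_real gxs)
    moreover have "continuous_on UNIV (zbar_poly xs)" by (rule continuous_on_zbar_poly)
    ultimately show ?thesis by (auto intro!: continuous_intros)
  qed
  have intfg: "integrable uniform_circle f" "integrable uniform_circle g"
    using cont contg by (auto intro: integrable_uniform_circle)
  interpret U: prob_space uniform_circle by (rule prob_space_uniform_circle)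
  have U: "\<bar>integral\<^sup>L uniform_circle f - integral\<^sup>L uniform_circle g\<bar> \<le> e / 3"
  proof -
    have "\<bar>integral\<^sup>L uniform_circle f - integral\<^sup>L uniform_circle g\<bar> = \<bar>integral\<^sup>L uniform_circle (\<lambda>z. f z - g z)\<bar>"
      using intfg by simp
    also have "\<dots> \<le> integral\<^sup>L uniform_circle (\<lambda>z. \<bar>f z - g z\<bar>)" by (rule integral_abs_bound)
    also have "\<dots> \<le> integral\<^sup>L uniform_circle (\<lambda>z. e / 3)"
    proof (rule integral_mono_AE)
      show "AE z in uniform_circle. \<bar>f z - g z\<bar> \<le> e / 3"
        using AE_uniform_circle by eventually_elim (use close in \<open>simp add: less_imp_le\<close>)
    qed (use intfg in auto)
    also have "\<dots> = e / 3" using U.prob_space by simp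
    finally show ?thesis .
  qed
  define m where "m = (\<Sum>(c, a, b)\<leftarrow>xs. if a = b then c else 0)"
  have m: "m = complex_of_real (integral\<^sup>L uniform_circle g)"
    unfolding m_def integral_uniform_circle_zbar_poly[symmetric] integral_complex_of_real[symmetric]
    by (simp add: gxs)
  show ?thesis
  proof (rule exI[of _ K], rule exI[of _ \<delta>], intro conjI allI impI)
    show "\<delta> > 0" by (rule \<delta>)
    fix p :: "complex poly"
    assume deg: "degree p \<ge> 2" and monic: "lead_coeff p = 1"
      and circ': "\<forall>x\<in>#proots p. norm x = 1" and nz: "power_sum (proots p) 1 \<noteq> 0"
      and ln: "ln (degree p / norm (power_sum (proots p) 1)) \<le> \<delta> * degree p"
      and mom': "\<forall>k\<in>{1..K}. norm (power_sum (proots p) k) \<le> \<delta> * degree p"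
      and big: "2 ^ K \<le> \<delta> * degree p"
    have circ: "norm x = 1" if "x \<in># proots p" for x using circ' that by blast
    have mom: "norm (power_sum (proots p) k) \<le> \<delta> * degree p" if "1 \<le> k" "k \<le> K" for k
      using mom' that by simp
    let ?Z = "proots (pderiv p)" and ?n = "real (degree p)"
    have deg1: "degree p \<ge> 1" using deg by simp
    have disc: "norm x \<le> 1" if "x \<in># proots p" for x using circ that by simp
    have Z1: "norm z \<le> 1" if "z \<in># ?Z" for z by (rule Gauss_Lucas_disc[OF deg1 disc that])
    have near: "(\<Sum>z\<in>#?Z. 1 - norm z) \<le> \<delta> * ?n"
      using critical_points_near_circle[OF deg1 monic circ nz] ln by linarith
    have momZ: "norm (power_sum ?Z k) \<le> 2 * \<delta> * ?n" if k: "1 \<le> k" "k \<le> K" for k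
    proof -
      have "norm (power_sum ?Z k - power_sum (proots p) k) \<le> 2 ^ k - 1"
        by (rule power_sum_critical_points_close[OF deg1 disc k(1)])
      moreover have "(2::real) ^ k \<le> 2 ^ K" using k by (intro power_increasing) auto
      ultimately show ?thesis
        using mom[OF k] big norm_triangle_sub[of "power_sum ?Z k" "power_sum (proots p) k"] by linarith
    qed
    define N where "N = size ?Z"
    have N: "N = degree p - 1" unfolding N_def by (simp add: size_proots_complex degree_pderiv)
    have N0: "real N > 0" and nN: "?n \<le> 2 * N" using deg N by auto
    have "norm ((\<Sum>z\<in>#?Z. zbar_poly xs z) - of_nat N * m) \<le> C * (2 * K * (\<delta> * ?n) + 2 * \<delta> * ?n)"
      unfolding m_def C_def N_def
      by (rule zbar_poly_sum_le[OF Z1 near momZ _ K]) (use \<delta> in auto)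
    also have "\<dots> = (C * (2 * K + 2) * \<delta>) * ?n" by (simp add: algebra_simps)
    also have "\<dots> \<le> (C * (2 * K + 2) * \<delta>) * (2 * N)"
      using nN C0 \<delta> by (intro mult_left_mono) auto
    also have "\<dots> = N * (C / (C + 1)) * (e / 3)"
      unfolding \<delta>_def using C0 by (simp add: divide_simps) (simp add: algebra_simps)
    also have "\<dots> \<le> real N * 1 * (e / 3)"
    proof -
      have "C / (C + 1) \<le> 1" using C0 by (simp add: divide_le_eq_1)
      thus ?thesis using e N0 by (intro mult_right_mono[OF mult_left_mono]) auto
    qed
    finally have le: "norm ((\<Sum>z\<in>#?Z. zbar_poly xs z) - of_nat N * m) \<le> N * (e / 3)" by simp
    have "real N * e = 3 * (N * (e / 3))" by simp
    hence tri: "\<bar>F - I\<bar> \<le> N * e"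
      if "\<bar>G - J\<bar> \<le> N * (e / 3)" "\<bar>F - G\<bar> \<le> N * (e / 3)" "\<bar>I - J\<bar> \<le> N * (e / 3)"
      for F G I J using that by linarith
    have "(\<Sum>z\<in>#M. zbar_poly xs z) = complex_of_real (\<Sum>z\<in>#M. g z)" for M
      by (induction M) (simp_all add: gxs)
    hence "(\<Sum>z\<in>#?Z. zbar_poly xs z) - of_nat N * m =
        complex_of_real ((\<Sum>z\<in>#?Z. g z) - N * integral\<^sup>L uniform_circle g)"
      unfolding m by simp
    hence "\<bar>(\<Sum>z\<in>#?Z. g z) - N * integral\<^sup>L uniform_circle g\<bar> \<le> N * (e / 3)"
      using le by (simp only: norm_of_real)
    moreover have "\<bar>(\<Sum>z\<in>#?Z. f z) - (\<Sum>z\<in>#?Z. g z)\<bar> \<le> N * (e / 3)"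
    proof -
      have "norm (\<Sum>z\<in>#?Z. f z - g z) \<le> (\<Sum>z\<in>#?Z. e / 3)"
        by (rule norm_sum_mset_le) (use Z1 close in force)
      thus ?thesis by (simp add: sum_mset_subtractf N_def)
    qed
    moreover have "\<bar>N * integral\<^sup>L uniform_circle f - N * integral\<^sup>L uniform_circle g\<bar> \<le> N * (e / 3)"
      using mult_left_mono[OF U, of "real N"] by (simp add: abs_mult flip: right_diff_distrib)
    ultimately have "\<bar>(\<Sum>z\<in>#?Z. f z) - N * integral\<^sup>L uniform_circle f\<bar> \<le> N * e"
      by (rule tri)
    hence "\<bar>((\<Sum>z\<in>#?Z. f z) - N * integral\<^sup>L uniform_circle f) / N\<bar> \<le> e"
      using N0 by (simp add: abs_divide pos_divide_le_eq mult.commute)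
    hence "\<bar>(\<Sum>z\<in>#?Z. f z) / N - integral\<^sup>L uniform_circle f\<bar> \<le> e"
      using N0 by (simp add: diff_divide_distrib)
    moreover have "integral\<^sup>L (root_measure (pderiv p)) f = (\<Sum>z\<in>#?Z. f z) / N"
      using deg cont by (subst integral_root_measure)
        (auto simp: pderiv_eq_0_iff N degree_pderiv intro: borel_measurable_continuous_onI)
    ultimately show "\<bar>integral\<^sup>L (root_measure (pderiv p)) f - integral\<^sup>L uniform_circle f\<bar> \<le> e"
      by simp
  qed
qed

section \<open>Traces of powers and eigenvalues of unitary matrices\<close>

definition mat_trace :: "complex mat \<Rightarrow> complex" where
  "mat_trace A = (\<Sum>i<dim_row A. A $$ (i, i))"

lemma mat_trace_mult:
  assumes "A \<in> carrier_mat n m" "B \<in> carrier_mat m n"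
  shows "mat_trace (A * B) = (\<Sum>i<n. \<Sum>j<m. A $$ (i, j) * B $$ (j, i))"
  using assms by (auto simp: mat_trace_def scalar_prod_def atLeast0LessThan intro!: sum.cong)

lemma mat_trace_mult_commute:
  assumes "A \<in> carrier_mat n m" "B \<in> carrier_mat m n"
  shows "mat_trace (A * B) = mat_trace (B * A)"
  unfolding mat_trace_mult[OF assms] mat_trace_mult[OF assms(2,1)]
  by (subst sum.swap) (simp add: mult.commute)

lemma upper_triangular_pow:
  fixes B :: "complex mat"
  assumes "B \<in> carrier_mat n n" "upper_triangular B"
  shows "upper_triangular (B ^\<^sub>m k) \<and> (\<forall>i<n. (B ^\<^sub>m k) $$ (i, i) = B $$ (i, i) ^ k)"
proof (induction k)
  case 0
  show ?case using assms by auto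
next
  case (Suc k)
  let ?C = "B ^\<^sub>m k"
  have C: "?C \<in> carrier_mat n n" using assms(1) by simp
  have entry: "(?C * B) $$ (i, j) = (\<Sum>l<n. ?C $$ (i, l) * B $$ (l, j))" if "i < n" "j < n" for i j
    using that C assms(1) by (auto simp: scalar_prod_def atLeast0LessThan intro!: sum.cong)
  have C0: "?C $$ (i, l) = 0" if "l < i" "i < n" for i l using Suc C that by auto
  have B0: "B $$ (l, j) = 0" if "j < l" "l < n" for l j using assms that by auto
  have "(?C * B) $$ (i, j) = 0" if "j < i" "i < n" for i j
    unfolding entry[OF that(2) less_trans[OF that]]
  proof (rule sum.neutral, intro ballI)
    fix l assume "l \<in> {..<n}"
    thus "?C $$ (i, l) * B $$ (l, j) = 0" using C0[of l i] B0[of j l] that by (cases "l < i") auto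
  qed
  moreover have "(?C * B) $$ (i, i) = B $$ (i, i) ^ Suc k" if i: "i < n" for i
  proof -
    have "(?C * B) $$ (i, i) = (\<Sum>l<n. if l = i then ?C $$ (i, i) * B $$ (i, i) else 0)"
      unfolding entry[OF i i]
    proof (intro sum.cong refl)
      fix l assume "l \<in> {..<n}"
      thus "?C $$ (i, l) * B $$ (l, i) = (if l = i then ?C $$ (i, i) * B $$ (i, i) else 0)"
        using C0[of l i] B0[of i l] i by (cases l i rule: linorder_cases) auto
    qed
    thus ?thesis using Suc i by (simp add: mult.commute)
  qed
  ultimately show ?case using C assms(1) by (auto intro!: upper_triangularI)
qed

lemma proots_prod_list_linear: "proots (\<Prod>a\<leftarrow>es. [:- a, 1:]) = mset (es :: complex list)"
proof (induction es)
  case (Cons a es)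
  have "(\<Prod>a\<leftarrow>es. [:- a, 1:]) \<noteq> 0" by (auto simp: prod_list_zero_iff)
  hence "proots ([:- a, 1:] * (\<Prod>a\<leftarrow>es. [:- a, 1:])) = {#a#} + mset es"
    by (subst proots_mult) (simp_all add: Cons del: mult_pCons_left)
  thus ?case by (simp del: mult_pCons_left)
qed simp

lemma trace_pow_eq_power_sum:
  assumes A: "A \<in> carrier_mat n n"
  shows "mat_trace (A ^\<^sub>m k) = power_sum (proots (char_poly A)) k"
proof -
  obtain es where es: "char_poly A = (\<Prod>a\<leftarrow>es. [:- a, 1:])" "length es = n"
    using char_poly_factorized[OF A] by blast
  obtain B P Q where BPQ: "schur_decomposition A es = (B, P, Q)" by (metis prod_cases3)
  have wit: "similar_mat_wit A B P Q" and ut: "upper_triangular B" and diag: "diag_mat B = es"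
    using schur_decomposition[OF A es(1) BPQ] by auto
  have c: "B \<in> carrier_mat n n" "P \<in> carrier_mat n n" "Q \<in> carrier_mat n n" "Q * P = 1\<^sub>m n"
    using similar_mat_witD2[OF A wit] by auto
  have Bk: "B ^\<^sub>m k \<in> carrier_mat n n" using c by simp
  have "mat_trace (A ^\<^sub>m k) = mat_trace (P * (B ^\<^sub>m k * Q))"
    using similar_mat_wit_pow_id[OF wit, of k] assoc_mult_mat[OF c(2) Bk c(3)] by simp
  also have "\<dots> = mat_trace (B ^\<^sub>m k * Q * P)"
    using c Bk by (intro mat_trace_mult_commute) auto
  also have "B ^\<^sub>m k * Q * P = B ^\<^sub>m k"
    using assoc_mult_mat[OF Bk c(3,2)] c(4) right_mult_one_mat[OF Bk] by simp
  also have "mat_trace (B ^\<^sub>m k) = (\<Sum>i<n. B $$ (i, i) ^ k)"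
    using upper_triangular_pow[OF c(1) ut, of k] Bk c(1) by (auto simp: mat_trace_def intro!: sum.cong)
  also have "\<dots> = (\<Sum>x\<leftarrow>es. x ^ k)"
    using c(1) by (simp add: diag[symmetric] diag_mat_def sum_list_sum_nth atLeast0LessThan)
  also have "\<dots> = power_sum (mset es) k"
    by (simp add: power_sum_def flip: sum_mset_sum_list)
  also have "mset es = proots (char_poly A)"
    unfolding es(1) by (rule proots_prod_list_linear[symmetric])
  finally show ?thesis .
qed

lemma unitary_groupD:
  assumes "A \<in> unitary_group n"
  shows "A \<in> carrier_mat n n"
    "i < n \<Longrightarrow> j < n \<Longrightarrow> (\<Sum>k<n. A $$ (i, k) * cnj (A $$ (j, k))) = (if i = j then 1 else 0)"
    "i < n \<Longrightarrow> j < n \<Longrightarrow> (\<Sum>k<n. A $$ (k, i) * cnj (A $$ (k, j))) = (if i = j then 1 else 0)"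
proof -
  show A: "A \<in> carrier_mat n n" using assms by (simp add: unitary_group_def)
  have adj: "mat_adjoint A \<in> carrier_mat n n"
    "i < n \<Longrightarrow> j < n \<Longrightarrow> mat_adjoint A $$ (i, j) = cnj (A $$ (j, i))" for i j
    using A by (auto simp: mat_adjoint_def mat_of_rows_def conjugate_complex_def)
  have 1: "A * mat_adjoint A = 1\<^sub>m n" and 2: "mat_adjoint A * A = 1\<^sub>m n"
    using assms by (auto simp: unitary_group_def)
  show "(\<Sum>k<n. A $$ (i, k) * cnj (A $$ (j, k))) = (if i = j then 1 else 0)" if "i < n" "j < n"
  proof -
    have "(A * mat_adjoint A) $$ (i, j) = (\<Sum>k<n. A $$ (i, k) * cnj (A $$ (j, k)))"
      using that A adj by (auto simp: scalar_prod_def atLeast0LessThan intro!: sum.cong)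
    thus ?thesis unfolding 1 using that by simp
  qed
  show "(\<Sum>k<n. A $$ (k, i) * cnj (A $$ (k, j))) = (if i = j then 1 else 0)" if "i < n" "j < n"
  proof -
    have "(mat_adjoint A * A) $$ (j, i) = (\<Sum>k<n. A $$ (k, i) * cnj (A $$ (k, j)))"
      using that A adj by (auto simp: scalar_prod_def atLeast0LessThan intro!: sum.cong)
    thus ?thesis unfolding 2 using that by auto
  qed
qed

text \<open>A unitary matrix preserves \<open>\<Sum> \<bar>v\<^sub>k\<bar>\<^sup>2\<close>, in particular
  for an eigenvector.\<close>
lemma unitary_eigenvalue_norm:
  assumes U: "A \<in> unitary_group n" and x: "x \<in># proots (char_poly A)"
  shows "norm x = 1"
proof -
  have A: "A \<in> carrier_mat n n" by (rule unitary_groupD(1)[OF U])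
  have "char_poly A \<noteq> 0" using degree_monic_char_poly[OF A] by auto
  hence "eigenvalue A x" using x eigenvalue_root_char_poly[OF A] by simp
  then obtain v where v: "v \<in> carrier_vec n" "v \<noteq> 0\<^sub>v n" "A *\<^sub>v v = x \<cdot>\<^sub>v v"
    using A unfolding eigenvalue_def eigenvector_def by auto
  have Av: "x * v $ i = (\<Sum>k<n. A $$ (i, k) * v $ k)" if "i < n" for i
  proof -
    have "(A *\<^sub>v v) $ i = (\<Sum>k<n. A $$ (i, k) * v $ k)"
      using that A v(1) by (auto simp: scalar_prod_def atLeast0LessThan intro!: sum.cong)
    thus ?thesis using v that by simp
  qed
  let ?s = "\<Sum>k<n. v $ k * cnj (v $ k)"
  have "(x * cnj x) * ?s = (\<Sum>i<n. (x * v $ i) * cnj (x * v $ i))"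
    by (simp add: sum_distrib_left mult_ac)
  also have "\<dots> = (\<Sum>i<n. \<Sum>k<n. \<Sum>l<n. (v $ k * cnj (v $ l)) * (A $$ (i, k) * cnj (A $$ (i, l))))"
    by (intro sum.cong refl) (simp add: Av sum_product mult_ac)
  also have "\<dots> = (\<Sum>k<n. \<Sum>l<n. (v $ k * cnj (v $ l)) * (\<Sum>i<n. A $$ (i, k) * cnj (A $$ (i, l))))"
    by (subst sum.swap, rule sum.cong[OF refl], subst sum.swap) (simp add: sum_distrib_left)
  also have "\<dots> = (\<Sum>k<n. \<Sum>l<n. if k = l then v $ k * cnj (v $ k) else 0)"
    by (intro sum.cong refl) (simp add: unitary_groupD(3)[OF U])
  also have "\<dots> = ?s" by simp
  finally have eq: "(x * cnj x) * ?s = ?s" .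
  have "?s \<noteq> 0"
  proof
    assume "?s = 0"
    moreover have "?s = complex_of_real (\<Sum>k<n. (norm (v $ k))\<^sup>2)"
      by (simp only: complex_norm_square[symmetric] of_real_sum)
    ultimately have "(\<Sum>k<n. (norm (v $ k))\<^sup>2) = 0" by (simp only: of_real_eq_0_iff)
    hence "\<forall>k<n. v $ k = 0" by (simp add: sum_nonneg_eq_0_iff)
    hence "v = 0\<^sub>v n" using v(1) by auto
    with v(2) show False by simp
  qed
  hence "x * cnj x = 1" using eq by simp
  hence "complex_of_real ((norm x)\<^sup>2) = 1" by (simp only: complex_norm_square)
  hence "(norm x)\<^sup>2 = 1" by (metis of_real_eq_1_iff)
  hence "norm x = 1 \<or> norm x = - 1" by (simp only: power2_eq_1_iff)
  thus ?thesis using norm_ge_zero[of x] by linarith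
qed

section \<open>Averaging traces over a group of permutations\<close>

text \<open>Replacing \<open>p\<close> by \<open>g p\<close> does not change a sum over all
  \<open>p\<close>, so averaging over pairs of group elements is the same as averaging over one.\<close>
lemma sum_over_orbit_pairs:
  fixes F :: "'p \<Rightarrow> 'p \<Rightarrow> 'c :: comm_semiring_1"
  assumes bij: "\<And>g. g \<in> H \<Longrightarrow> bij_betw (act g) J J"
    and mult: "\<And>g. g \<in> H \<Longrightarrow> bij_betw (\<lambda>h. mul h g) H H"
    and act: "\<And>g h p. g \<in> H \<Longrightarrow> h \<in> H \<Longrightarrow> p \<in> J \<Longrightarrow> act (mul h g) p = act h (act g p)"
  shows "(\<Sum>p\<in>J. \<Sum>g\<in>H. \<Sum>h\<in>H. F (act g p) (act h p)) =
           of_nat (card H) * (\<Sum>h\<in>H. \<Sum>p\<in>J. F p (act h p))"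
proof -
  have "(\<Sum>p\<in>J. \<Sum>g\<in>H. \<Sum>h\<in>H. F (act g p) (act h p)) = (\<Sum>g\<in>H. \<Sum>p\<in>J. \<Sum>h\<in>H. F (act g p) (act h p))"
    by (rule sum.swap)
  also have "\<dots> = (\<Sum>g\<in>H. \<Sum>p\<in>J. \<Sum>h\<in>H. F p (act h p))"
  proof (rule sum.cong[OF refl])
    fix g assume g: "g \<in> H"
    have "(\<Sum>p\<in>J. \<Sum>h\<in>H. F (act g p) (act h p)) = (\<Sum>p\<in>J. \<Sum>h\<in>H. F (act g p) (act (mul h g) p))"
      by (intro sum.cong refl sum.reindex_bij_betw[OF mult[OF g], symmetric])
    also have "\<dots> = (\<Sum>p\<in>J. \<Sum>h\<in>H. F (act g p) (act h (act g p)))"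
      by (intro sum.cong refl) (simp add: act g)
    also have "\<dots> = (\<Sum>p\<in>J. \<Sum>h\<in>H. F p (act h p))"
      by (rule sum.reindex_bij_betw[OF bij[OF g]])
    finally show "(\<Sum>p\<in>J. \<Sum>h\<in>H. F (act g p) (act h p)) = (\<Sum>p\<in>J. \<Sum>h\<in>H. F p (act h p))" .
  qed
  also have "\<dots> = of_nat (card H) * (\<Sum>h\<in>H. \<Sum>p\<in>J. F p (act h p))"
    by (simp, subst sum.swap, rule refl)
  finally show ?thesis .
qed

text \<open>If the columns of \<open>Y\<close> are orthonormal then \<open>\<parallel>Y w\<parallel> =
  \<parallel>w\<parallel>\<close>; the claim is the Cauchy-Schwarz inequality for
  \<open>w\<close> and \<open>Y w\<close>.\<close>
lemma isometric_kernel_quadratic_form_le: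
  fixes Y :: "'p \<Rightarrow> 'p \<Rightarrow> complex" and w :: "'p \<Rightarrow> real"
  assumes fin: "finite J"
    and orth: "\<And>q r. q \<in> J \<Longrightarrow> r \<in> J \<Longrightarrow> (\<Sum>p\<in>J. Y p q * cnj (Y p r)) = (if q = r then 1 else 0)"
  shows "norm (\<Sum>p\<in>J. \<Sum>q\<in>J. w p * w q * Y p q) \<le> (\<Sum>p\<in>J. (w p)\<^sup>2)"
proof -
  define v where "v = (\<lambda>p. \<Sum>q\<in>J. w q * Y p q)"
  have "complex_of_real (\<Sum>p\<in>J. (norm (v p))\<^sup>2) = (\<Sum>p\<in>J. v p * cnj (v p))"
    by (simp only: complex_norm_square of_real_sum)
  also have "\<dots> = (\<Sum>p\<in>J. \<Sum>q\<in>J. \<Sum>r\<in>J. w q * w r * (Y p q * cnj (Y p r)))"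
    unfolding v_def by (intro sum.cong refl) (simp add: sum_product mult_ac)
  also have "\<dots> = (\<Sum>q\<in>J. \<Sum>r\<in>J. w q * w r * (\<Sum>p\<in>J. Y p q * cnj (Y p r)))"
    by (subst sum.swap, rule sum.cong[OF refl], subst sum.swap) (simp add: sum_distrib_left)
  also have "\<dots> = (\<Sum>q\<in>J. \<Sum>r\<in>J. if q = r then complex_of_real ((w q)\<^sup>2) else 0)"
    by (intro sum.cong refl) (simp add: orth power2_eq_square)
  also have "\<dots> = complex_of_real (\<Sum>q\<in>J. (w q)\<^sup>2)" using fin by simp
  finally have vw: "(\<Sum>p\<in>J. (norm (v p))\<^sup>2) = (\<Sum>q\<in>J. (w q)\<^sup>2)" by (simp only: of_real_eq_iff)
  have "(\<Sum>p\<in>J. \<Sum>q\<in>J. w p * w q * Y p q) = (\<Sum>p\<in>J. w p * v p)"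
    unfolding v_def by (simp add: sum_distrib_left mult.assoc)
  also have "norm \<dots> \<le> (\<Sum>p\<in>J. ((w p)\<^sup>2 + (norm (v p))\<^sup>2) / 2)"
  proof (rule sum_norm_le)
    fix p
    have "0 \<le> (\<bar>w p\<bar> - norm (v p))\<^sup>2" by simp
    thus "norm (w p * v p) \<le> ((w p)\<^sup>2 + (norm (v p))\<^sup>2) / 2"
      by (simp add: norm_mult power2_eq_square algebra_simps)
  qed
  also have "\<dots> = (\<Sum>p\<in>J. (w p)\<^sup>2)"
    by (simp add: sum_divide_distrib[symmetric] sum.distrib vw)
  finally show ?thesis .
qed

text \<open>Let \<open>\<rho>\<close> be the permutation representation of \<open>H\<close> on
  \<open>I\<close>. The mean of \<open>\<rho>(h) \<otimes> \<rho>(h)\<close> is an orthogonal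
  projection \<open>Q\<close>, and the mean of \<open>\<bar>tr (X
  \<rho>(h))\<bar>\<^sup>2\<close> is the trace of \<open>X \<otimes> cnj X\<close> times
  \<open>Q\<close>. For unitary \<open>X\<close> this is at most the trace of \<open>Q\<close>
  itself, which is the mean of the squared number of fixed points. The proof avoids operators:
  \<open>Q\<close> is spread over pairs of group elements and each orbit contributes a quadratic
  form with nonnegative weights.\<close>
lemma sum_norm_traces_le_sum_fixed_points:
  fixes X :: "'i \<Rightarrow> 'i \<Rightarrow> complex"
  assumes fin: "finite I" "finite H" and ne: "H \<noteq> {}"
    and bij: "\<And>g. g \<in> H \<Longrightarrow> bij_betw (act g) I I"
    and mult: "\<And>g. g \<in> H \<Longrightarrow> bij_betw (\<lambda>h. mul h g) H H"
    and act: "\<And>g h x. g \<in> H \<Longrightarrow> h \<in> H \<Longrightarrow> x \<in> I \<Longrightarrow> act (mul h g) x = act h (act g x)"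
    and orth: "\<And>j k. j \<in> I \<Longrightarrow> k \<in> I \<Longrightarrow> (\<Sum>i\<in>I. X i j * cnj (X i k)) = (if j = k then 1 else 0)"
  shows "(\<Sum>h\<in>H. (norm (\<Sum>i\<in>I. X i (act h i)))\<^sup>2) \<le> (\<Sum>h\<in>H. (real (card {i\<in>I. act h i = i}))\<^sup>2)"
proof -
  define J where "J = I \<times> I"
  define A where "A = (\<lambda>h. map_prod (act h) (act h))"
  define Y where "Y = (\<lambda>(i, i') (j, j'). X i j * cnj (X i' j'))"
  have finJ: "finite J" using fin by (simp add: J_def)
  have bijJ: "bij_betw (A g) J J" if "g \<in> H" for g
    unfolding A_def J_def by (rule bij_betw_map_prod[OF bij[OF that] bij[OF that]])
  have AJ: "A g p \<in> J" if "g \<in> H" "p \<in> J" for g p using bijJ that by (auto simp: bij_betw_def)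
  have actJ: "A (mul h g) p = A h (A g p)" if "g \<in> H" "h \<in> H" "p \<in> J" for g h p
    using that act unfolding A_def J_def by auto
  have orthJ: "(\<Sum>p\<in>J. Y p q * cnj (Y p r)) = (if q = r then 1 else 0)" if "q \<in> J" "r \<in> J" for q r
  proof -
    obtain j j' k k' where qr: "q = (j, j')" "r = (k, k')" by fastforce
    have "(\<Sum>p\<in>J. Y p q * cnj (Y p r)) =
        (\<Sum>i\<in>I. \<Sum>i'\<in>I. (X i j * cnj (X i k)) * cnj (X i' j' * cnj (X i' k')))"
      unfolding J_def sum.cartesian_product by (intro sum.cong refl) (auto simp: Y_def qr)
    also have "\<dots> = (\<Sum>i\<in>I. X i j * cnj (X i k)) * cnj (\<Sum>i'\<in>I. X i' j' * cnj (X i' k'))"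
      by (simp add: sum_product)
    also have "\<dots> = (if j = k then 1 else 0) * cnj (if j' = k' then 1 else 0)"
      using that unfolding qr J_def by (simp only: orth mem_Sigma_iff)
    finally show ?thesis by (simp add: qr)
  qed
  have sq: "complex_of_real ((norm (\<Sum>i\<in>I. X i (act h i)))\<^sup>2) = (\<Sum>p\<in>J. Y p (A h p))" for h
  proof -
    have "complex_of_real ((norm (\<Sum>i\<in>I. X i (act h i)))\<^sup>2) =
        (\<Sum>i\<in>I. \<Sum>j\<in>I. X i (act h i) * cnj (X j (act h j)))"
      by (simp only: complex_norm_square sum_product cnj_sum)
    thus ?thesis unfolding J_def sum.cartesian_product by (simp add: Y_def A_def case_prod_beta)
  qed
  (* w p q counts the group elements that carry p to q; sums over the group become sums over the
     orbit with these weights. *)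
  define w where "w = (\<lambda>p q. \<Sum>g\<in>H. of_bool (A g p = q) :: real)"
  have orbit: "(\<Sum>g\<in>H. F (A g p)) = (\<Sum>q\<in>J. of_real (w p q) * F q)" if "p \<in> J"
    for p and F :: "'i \<times> 'i \<Rightarrow> 'c :: real_algebra_1"
  proof -
    have "(\<Sum>q\<in>J. of_real (w p q) * F q) = (\<Sum>q\<in>J. \<Sum>g\<in>H. if A g p = q then F q else 0)"
      unfolding w_def by (simp add: sum_distrib_right) (intro sum.cong refl, simp)
    also have "\<dots> = (\<Sum>g\<in>H. \<Sum>q\<in>J. if A g p = q then F q else 0)" by (rule sum.swap)
    also have "\<dots> = (\<Sum>g\<in>H. F (A g p))" using finJ AJ that by (intro sum.cong refl) simp
    finally show ?thesis ..
  qed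
  have pt: "norm (\<Sum>g\<in>H. \<Sum>h\<in>H. Y (A g p) (A h p)) \<le> (\<Sum>g\<in>H. \<Sum>h\<in>H. of_bool (A g p = A h p))"
    if p: "p \<in> J" for p
  proof -
    have "(\<Sum>g\<in>H. \<Sum>h\<in>H. Y (A g p) (A h p)) = (\<Sum>g\<in>H. \<Sum>r\<in>J. of_real (w p r) * Y (A g p) r)"
      by (intro sum.cong refl orbit[OF p])
    also have "\<dots> = (\<Sum>q\<in>J. of_real (w p q) * (\<Sum>r\<in>J. of_real (w p r) * Y q r))"
      by (rule orbit[OF p])
    also have "\<dots> = (\<Sum>q\<in>J. \<Sum>r\<in>J. w p q * w p r * Y q r)"
      by (simp add: sum_distrib_left mult.assoc)
    also have "norm \<dots> \<le> (\<Sum>q\<in>J. (w p q)\<^sup>2)"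
      by (rule isometric_kernel_quadratic_form_le[OF finJ orthJ])
    also have "\<dots> = (\<Sum>q\<in>J. of_real (w p q) * (\<Sum>h\<in>H. of_bool (q = A h p)))"
    proof (rule sum.cong[OF refl])
      fix q
      have "(\<Sum>h\<in>H. of_bool (q = A h p)) = w p q"
        unfolding w_def by (rule sum.cong[OF refl]) (simp only: eq_commute)
      thus "(w p q)\<^sup>2 = of_real (w p q) * (\<Sum>h\<in>H. of_bool (q = A h p))"
        by (simp add: power2_eq_square)
    qed
    also have "\<dots> = (\<Sum>g\<in>H. \<Sum>h\<in>H. of_bool (A g p = A h p))"
      by (rule orbit[OF p, symmetric])
    finally show ?thesis .
  qed
  let ?S = "\<Sum>h\<in>H. (norm (\<Sum>i\<in>I. X i (act h i)))\<^sup>2"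
  have "complex_of_real (card H * ?S) = of_nat (card H) * (\<Sum>h\<in>H. \<Sum>p\<in>J. Y p (A h p))"
    using sq by simp
  also have "\<dots> = (\<Sum>p\<in>J. \<Sum>g\<in>H. \<Sum>h\<in>H. Y (A g p) (A h p))"
    by (rule sum_over_orbit_pairs[OF bijJ mult actJ, symmetric])
  finally have "norm (complex_of_real (card H * ?S)) = norm (\<Sum>p\<in>J. \<Sum>g\<in>H. \<Sum>h\<in>H. Y (A g p) (A h p))"
    by (rule arg_cong)
  also have "\<dots> \<le> (\<Sum>p\<in>J. \<Sum>g\<in>H. \<Sum>h\<in>H. of_bool (A g p = A h p))"
    by (rule sum_norm_le) (rule pt)
  also have "\<dots> = of_nat (card H) * (\<Sum>h\<in>H. \<Sum>p\<in>J. of_bool (p = A h p))"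
    by (rule sum_over_orbit_pairs[OF bijJ mult actJ])
  finally have "\<bar>card H * ?S\<bar> \<le> card H * (\<Sum>h\<in>H. \<Sum>p\<in>J. of_bool (p = A h p))"
    by (simp only: norm_of_real) simp
  hence "card H * ?S \<le> card H * (\<Sum>h\<in>H. \<Sum>p\<in>J. of_bool (p = A h p))" by linarith
  hence "?S \<le> (\<Sum>h\<in>H. \<Sum>p\<in>J. of_bool (p = A h p))" using fin(2) ne by (simp add: card_gt_0_iff)
  also have "\<dots> = (\<Sum>h\<in>H. (real (card {i\<in>I. act h i = i}))\<^sup>2)"
  proof (rule sum.cong[OF refl])
    fix h assume "h \<in> H"
    have "(\<Sum>p\<in>J. of_bool (p = A h p)) = real (card (J \<inter> {p. p = A h p}))"
      using finJ by (subst sum_of_bool_eq) auto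
    also have "J \<inter> {p. p = A h p} = {i\<in>I. act h i = i} \<times> {i\<in>I. act h i = i}"
      unfolding J_def A_def by (auto simp: eq_commute[of _ "act h _"])
    also have "card \<dots> = card {i\<in>I. act h i = i} * card {i\<in>I. act h i = i}" by (rule card_cartesian_product)
    finally show "(\<Sum>p\<in>J. of_bool (p = A h p)) = (real (card {i\<in>I. act h i = i}))\<^sup>2"
      by (simp add: power2_eq_square)
  qed
  finally show ?thesis .
qed

lemma sum_PiE_insert:
  assumes "x \<notin> S"
  shows "(\<Sum>i\<in>insert x S \<rightarrow>\<^sub>E B. F i) = (\<Sum>c\<in>B. \<Sum>i\<in>S \<rightarrow>\<^sub>E B. F (i(x := c)))"
proof -
  have "inj_on (\<lambda>(y, g). g(x := y)) (B \<times> (S \<rightarrow>\<^sub>E B))"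
    using inj_combinator[OF assms, of "\<lambda>_. B"] .
  thus ?thesis
    unfolding PiE_insert_eq sum.cartesian_product by (subst sum.reindex) (simp_all add: case_prod_beta)
qed

lemma mat_pow_eq_path_sum:
  fixes A :: "complex mat"
  assumes A: "A \<in> carrier_mat n n" and b: "b < n" and a: "a < n"
  shows "(A ^\<^sub>m Suc k) $$ (a, b) =
     (\<Sum>i\<in>{..<Suc k} \<rightarrow>\<^sub>E {..<n}. of_bool (i 0 = a) * (\<Prod>l<k. A $$ (i l, i (Suc l))) * A $$ (i k, b))"
  using b
proof (induction k arbitrary: b)
  case 0
  have "{..<Suc 0} = insert 0 ({} :: nat set)" by auto
  hence "(\<Sum>i\<in>{..<Suc 0} \<rightarrow>\<^sub>E {..<n}. of_bool (i 0 = a) * A $$ (i 0, b)) =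
    (\<Sum>c<n. if c = a then A $$ (c, b) else 0)"
    by (simp add: sum_PiE_insert of_bool_def if_distrib[where f = "\<lambda>x. x * _"] cong: if_cong)
  also have "\<dots> = A $$ (a, b)" using a by simp
  finally show ?case using A by simp
next
  case (Suc k)
  have Ak: "A ^\<^sub>m Suc k \<in> carrier_mat n n" using A by (rule pow_carrier_mat)
  let ?f = "\<lambda>i. of_bool (i 0 = a) * (\<Prod>l<k. A $$ (i l, i (Suc l)))"
  have ins: "{..<Suc (Suc k)} = insert (Suc k) {..<Suc k}" by auto
  have "(A ^\<^sub>m Suc (Suc k)) $$ (a, b) = (\<Sum>c<n. (A ^\<^sub>m Suc k) $$ (a, c) * A $$ (c, b))"
    unfolding pow_mat.simps(2)[of A "Suc k"] using A Ak Suc.prems a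
    by (auto simp: scalar_prod_def atLeast0LessThan simp del: pow_mat.simps intro!: sum.cong)
  also have "\<dots> = (\<Sum>c<n. \<Sum>i\<in>{..<Suc k} \<rightarrow>\<^sub>E {..<n}. ?f i * A $$ (i k, c) * A $$ (c, b))"
    by (intro sum.cong refl) (simp add: Suc.IH sum_distrib_right del: pow_mat.simps)
  also have "\<dots> = (\<Sum>c<n. \<Sum>i\<in>{..<Suc k} \<rightarrow>\<^sub>E {..<n}.
      (\<lambda>i. of_bool (i 0 = a) * (\<Prod>l<Suc k. A $$ (i l, i (Suc l))) * A $$ (i (Suc k), b)) (i(Suc k := c)))"
    by (rule sum.cong[OF refl], rule sum.cong[OF refl]) (simp add: mult.assoc)
  also have "\<dots> = (\<Sum>i\<in>{..<Suc (Suc k)} \<rightarrow>\<^sub>E {..<n}.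
      of_bool (i 0 = a) * (\<Prod>l<Suc k. A $$ (i l, i (Suc l))) * A $$ (i (Suc k), b))"
    unfolding ins by (rule sum_PiE_insert[symmetric]) simp
  finally show ?case .
qed

text \<open>Expanding the power turns its trace into a sum over closed walks of length \<open>k\<close>;
  \<open>mod\<close> closes the walk.\<close>
lemma trace_pow_eq_cycle_sum:
  fixes A :: "complex mat"
  assumes A: "A \<in> carrier_mat n n" and k: "k \<ge> 1"
  shows "mat_trace (A ^\<^sub>m k) = (\<Sum>i\<in>{..<k} \<rightarrow>\<^sub>E {..<n}. \<Prod>l<k. A $$ (i l, i (Suc l mod k)))"
proof -
  obtain k' where k': "k = Suc k'" using k by (cases k) auto
  have "mat_trace (A ^\<^sub>m k) = (\<Sum>a<n. \<Sum>i\<in>{..<k} \<rightarrow>\<^sub>E {..<n}.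
      of_bool (i 0 = a) * (\<Prod>l<k'. A $$ (i l, i (Suc l))) * A $$ (i k', a))"
    unfolding mat_trace_def using A by (auto simp: mat_pow_eq_path_sum k' simp del: pow_mat.simps intro!: sum.cong)
  also have "\<dots> = (\<Sum>i\<in>{..<k} \<rightarrow>\<^sub>E {..<n}. \<Sum>a<n.
      of_bool (i 0 = a) * (\<Prod>l<k'. A $$ (i l, i (Suc l))) * A $$ (i k', a))" by (rule sum.swap)
  also have "\<dots> = (\<Sum>i\<in>{..<k} \<rightarrow>\<^sub>E {..<n}. (\<Prod>l<k'. A $$ (i l, i (Suc l))) * A $$ (i k', i 0))"
  proof (rule sum.cong[OF refl])
    fix i assume "i \<in> {..<k} \<rightarrow>\<^sub>E {..<n}"
    hence "i 0 < n" using k by (auto simp: PiE_iff)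
    have "(\<Sum>a<n. of_bool (i 0 = a) * (\<Prod>l<k'. A $$ (i l, i (Suc l))) * A $$ (i k', a)) =
      (\<Sum>a<n. if i 0 = a then (\<Prod>l<k'. A $$ (i l, i (Suc l))) * A $$ (i k', a) else 0)"
      by (intro sum.cong) auto
    also have "\<dots> = (\<Prod>l<k'. A $$ (i l, i (Suc l))) * A $$ (i k', i 0)" using \<open>i 0 < n\<close> by simp
    finally show "(\<Sum>a<n. of_bool (i 0 = a) * (\<Prod>l<k'. A $$ (i l, i (Suc l))) * A $$ (i k', a)) =
        (\<Prod>l<k'. A $$ (i l, i (Suc l))) * A $$ (i k', i 0)" .
  qed
  also have "\<dots> = (\<Sum>i\<in>{..<k} \<rightarrow>\<^sub>E {..<n}. \<Prod>l<k. A $$ (i l, i (Suc l mod k)))"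
    by (intro sum.cong refl) (simp add: k')
  finally show ?thesis .
qed

section \<open>Averaging traces of powers over doubled permutations\<close>

definition monomial_mat :: "nat \<Rightarrow> (nat \<Rightarrow> nat) \<Rightarrow> (nat \<Rightarrow> complex) \<Rightarrow> complex mat" where
  "monomial_mat n \<pi> s = mat n n (\<lambda>(a, b). if a = \<pi> b then s b else 0)"

lemma monomial_mat_carrier [simp]: "monomial_mat n \<pi> s \<in> carrier_mat n n"
  and monomial_mat_index [simp]:
    "a < n \<Longrightarrow> b < n \<Longrightarrow> monomial_mat n \<pi> s $$ (a, b) = (if a = \<pi> b then s b else 0)"
  and monomial_mat_dim [simp]: "dim_row (monomial_mat n \<pi> s) = n" "dim_col (monomial_mat n \<pi> s) = n"
  by (simp_all add: monomial_mat_def)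

lemma mult_monomial_mat_index:
  assumes "M \<in> carrier_mat m n" "a < m" "b < n" "\<pi> b < n"
  shows "(M * monomial_mat n \<pi> s) $$ (a, b) = M $$ (a, \<pi> b) * s b"
proof -
  have "(M * monomial_mat n \<pi> s) $$ (a, b) = (\<Sum>c<n. M $$ (a, c) * (if c = \<pi> b then s b else 0))"
    using assms by (auto simp: scalar_prod_def atLeast0LessThan intro!: sum.cong)
  also have "\<dots> = (\<Sum>c<n. if c = \<pi> b then M $$ (a, \<pi> b) * s b else 0)"
    by (intro sum.cong) auto
  also have "\<dots> = M $$ (a, \<pi> b) * s b" using assms by simp
  finally show ?thesis .
qed

lemma monomial_mat_mult:
  assumes "\<And>b. b < n \<Longrightarrow> \<rho> b < n"
  shows "monomial_mat n \<pi> s * monomial_mat n \<rho> t = monomial_mat n (\<lambda>b. \<pi> (\<rho> b)) (\<lambda>b. s (\<rho> b) * t b)"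
proof (rule eq_matI)
  fix i j
  assume "i < dim_row (monomial_mat n (\<lambda>b. \<pi> (\<rho> b)) (\<lambda>b. s (\<rho> b) * t b))"
    and "j < dim_col (monomial_mat n (\<lambda>b. \<pi> (\<rho> b)) (\<lambda>b. s (\<rho> b) * t b))"
  hence ij: "i < n" "j < n" by simp_all
  show "(monomial_mat n \<pi> s * monomial_mat n \<rho> t) $$ (i, j) =
      monomial_mat n (\<lambda>b. \<pi> (\<rho> b)) (\<lambda>b. s (\<rho> b) * t b) $$ (i, j)"
    using mult_monomial_mat_index[of "monomial_mat n \<pi> s" n n i j \<rho> t] ij assms[OF ij(2)] by simp
qed simp_all

lemma trace_pow_mult_monomial_mat:
  assumes M: "M \<in> carrier_mat n n" and \<pi>: "\<And>b. b < n \<Longrightarrow> \<pi> b < n" and k: "k \<ge> 1"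
  shows "mat_trace ((M * monomial_mat n \<pi> (\<lambda>_. 1)) ^\<^sub>m k) =
     (\<Sum>i\<in>{..<k} \<rightarrow>\<^sub>E {..<n}. \<Prod>l<k. M $$ (i l, \<pi> (i (Suc l mod k))))"
proof -
  have "mat_trace ((M * monomial_mat n \<pi> (\<lambda>_. 1)) ^\<^sub>m k) =
    (\<Sum>i\<in>{..<k} \<rightarrow>\<^sub>E {..<n}. \<Prod>l<k. (M * monomial_mat n \<pi> (\<lambda>_. 1)) $$ (i l, i (Suc l mod k)))"
    using M by (intro trace_pow_eq_cycle_sum k) (auto intro: mult_carrier_mat[OF _ monomial_mat_carrier])
  also have "\<dots> = (\<Sum>i\<in>{..<k} \<rightarrow>\<^sub>E {..<n}. \<Prod>l<k. M $$ (i l, \<pi> (i (Suc l mod k))))"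
  proof (rule sum.cong[OF refl], rule prod.cong[OF refl])
    fix i l assume i: "i \<in> {..<k} \<rightarrow>\<^sub>E {..<n}" and l: "l \<in> {..<k}"
    have "i l < n" "i (Suc l mod k) < n" using i l k by (auto simp: PiE_iff)
    thus "(M * monomial_mat n \<pi> (\<lambda>_. 1)) $$ (i l, i (Suc l mod k)) = M $$ (i l, \<pi> (i (Suc l mod k)))"
      using M \<pi> by (subst mult_monomial_mat_index[OF M]) auto
  qed
  finally show ?thesis .
qed

lemma bij_betw_Suc_mod:
  assumes "k \<ge> 1"
  shows "bij_betw (\<lambda>l. Suc l mod k) {..<k} {..<k}"
proof (rule bij_betw_byWitness[where f' = "\<lambda>l. (l + k - 1) mod k"])
  show "\<forall>l\<in>{..<k}. (Suc l mod k + k - 1) mod k = l"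
  proof
    fix l assume "l \<in> {..<k}"
    thus "(Suc l mod k + k - 1) mod k = l" by (cases "Suc l = k") auto
  qed
  show "\<forall>l\<in>{..<k}. Suc ((l + k - 1) mod k) mod k = l"
  proof
    fix l assume "l \<in> {..<k}"
    thus "Suc ((l + k - 1) mod k) mod k = l" using assms by (simp add: mod_Suc_eq)
  qed
qed (use assms in auto)

text \<open>The kernel is the \<open>k\<close>-fold tensor power of \<open>M\<close> followed by a cyclic
  shift of the tensor factors, hence unitary.\<close>
lemma cycle_kernel_orthogonal:
  assumes U: "M \<in> unitary_group n" and k: "k \<ge> 1"
    and j: "j \<in> {..<k} \<rightarrow>\<^sub>E {..<n}" "j' \<in> {..<k} \<rightarrow>\<^sub>E {..<n}"
  defines "X \<equiv> \<lambda>i j. \<Prod>l<k. M $$ (i l, j (Suc l mod k))"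
  shows "(\<Sum>i\<in>{..<k} \<rightarrow>\<^sub>E {..<n}. X i j * cnj (X i j')) = (if j = j' then 1 else 0)"
proof -
  let ?c = "\<lambda>l. Suc l mod k"
  have jn: "j l < n" "j' l < n" if "l < k" for l using j that by (auto simp: PiE_iff)
  have ck: "?c l < k" for l using k by simp
  have "(\<Sum>i\<in>{..<k} \<rightarrow>\<^sub>E {..<n}. X i j * cnj (X i j')) =
      (\<Sum>i\<in>{..<k} \<rightarrow>\<^sub>E {..<n}. \<Prod>l<k. M $$ (i l, j (?c l)) * cnj (M $$ (i l, j' (?c l))))"
    by (simp add: X_def prod.distrib)
  also have "\<dots> = (\<Prod>l<k. \<Sum>a<n. M $$ (a, j (?c l)) * cnj (M $$ (a, j' (?c l))))"
    by (rule prod_sum_PiE[symmetric]) auto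
  also have "\<dots> = (\<Prod>l<k. if j (?c l) = j' (?c l) then 1 else 0)"
    by (intro prod.cong refl unitary_groupD(3)[OF U] jn ck)
  also have "\<dots> = (\<Prod>l<k. if j l = j' l then 1 else 0)"
    by (rule prod.reindex_bij_betw[OF bij_betw_Suc_mod[OF k]])
  also have "\<dots> = (if j = j' then 1 else 0)"
  proof (cases "j = j'")
    case False
    then obtain l where l: "l < k" "j l \<noteq> j' l" using j by (metis PiE_ext lessThan_iff)
    have "(\<Prod>l<k. if j l = j' l then 1 else 0) = (0 :: complex)"
      by (rule prod_zero) (use l in auto)
    thus ?thesis using False by simp
  qed simp
  finally show ?thesis .
qed

text \<open>The permutation acting as \<open>\<sigma>\<close> on each of the two blocks
  \<open>{0..<m}\<close> and \<open>{m..<2m}\<close>. Its matrix has determinant 1 and commutes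
  with the symplectic form, so this one group of permutations lies in all the classical groups.
  For odd \<open>n\<close> the last index stays fixed.\<close>
definition double_perm :: "nat \<Rightarrow> (nat \<Rightarrow> nat) \<Rightarrow> nat \<Rightarrow> nat" where
  "double_perm m \<sigma> a = (if a < m then \<sigma> a else if a < 2 * m then m + \<sigma> (a - m) else a)"

lemma permutes_lessThan_iff: "\<sigma> permutes {..<m} \<Longrightarrow> \<sigma> a < m \<longleftrightarrow> a < (m :: nat)"
  using permutes_in_image[of \<sigma> "{..<m}" a] by simp

lemma double_perm_comp:
  assumes "\<tau> permutes {..<m}"
  shows "double_perm m (\<sigma> \<circ> \<tau>) a = double_perm m \<sigma> (double_perm m \<tau> a)"
proof -
  consider "a < m" | "m \<le> a" "a < 2 * m" | "2 * m \<le> a" by linarith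
  thus ?thesis
  proof cases
    case 1
    thus ?thesis using permutes_lessThan_iff[OF assms, of a] by (simp add: double_perm_def)
  next
    case 2
    hence "a - m < m" by linarith
    thus ?thesis using 2 permutes_lessThan_iff[OF assms, of "a - m"] by (simp add: double_perm_def)
  qed (simp add: double_perm_def)
qed

lemma double_perm_id [simp]: "double_perm m id a = a"
  by (simp add: double_perm_def)

lemma double_perm_less:
  assumes "\<sigma> permutes {..<m}" "2 * m \<le> n" "a < n"
  shows "double_perm m \<sigma> a < n"
proof -
  have lt: "\<sigma> a < m" if "a < m" for a using permutes_lessThan_iff[OF assms(1)] that by simp
  consider "a < m" | "m \<le> a" "a < 2 * m" | "2 * m \<le> a" by linarith
  thus ?thesis
  proof cases
    case 2
    hence "a - m < m" by linarith
    thus ?thesis using 2 lt[of "a - m"] assms(2) by (simp add: double_perm_def)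
  qed (use lt[of a] assms in \<open>auto simp: double_perm_def\<close>)
qed

lemma double_perm_inverse:
  assumes "\<sigma> permutes {..<m}"
  shows "double_perm m (inv_into UNIV \<sigma>) (double_perm m \<sigma> a) = a" "double_perm m \<sigma> (double_perm m (inv_into UNIV \<sigma>) a) = a"
  using double_perm_comp[OF assms, of "inv_into UNIV \<sigma>" a] double_perm_comp[OF permutes_inv[OF assms], of \<sigma> a]
  by (simp_all add: permutes_inv_o[OF assms])

lemma card_fixed_double_perm_le:
  assumes "n \<le> 2 * m + 1"
  shows "card {a. a < n \<and> double_perm m \<sigma> a = a} \<le> 2 * card {a. a < m \<and> \<sigma> a = a} + 1"
proof -
  let ?F = "{a. a < m \<and> \<sigma> a = a}"
  have "{a. a < n \<and> double_perm m \<sigma> a = a} \<subseteq> ?F \<union> ((\<lambda>a. m + a) ` ?F \<union> {2 * m})"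
  proof
    fix a assume a: "a \<in> {a. a < n \<and> double_perm m \<sigma> a = a}"
    consider "a < m" | "m \<le> a" "a < 2 * m" | "a = 2 * m" using a assms by fastforce
    thus "a \<in> ?F \<union> ((\<lambda>a. m + a) ` ?F \<union> {2 * m})"
    proof cases
      case 2
      hence "a - m \<in> ?F" "a = m + (a - m)" using a by (auto simp: double_perm_def)
      thus ?thesis by blast
    qed (use a in \<open>auto simp: double_perm_def\<close>)
  qed
  hence "card {a. a < n \<and> double_perm m \<sigma> a = a} \<le> card (?F \<union> ((\<lambda>a. m + a) ` ?F \<union> {2 * m}))"
    by (intro card_mono) auto
  also have "\<dots> \<le> card ?F + (card ((\<lambda>a. m + a) ` ?F) + card {2 * m})"
    by (intro order_trans[OF card_Un_le] add_left_mono card_Un_le)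
  also have "\<dots> \<le> 2 * card ?F + 1" using card_image_le[of ?F "\<lambda>a. m + a"] by simp
  finally show ?thesis .
qed

text \<open>Write \<open>2\<^bsup>fix\<^esup>\<close> as the number of sets of fixed points; a given set of
  size \<open>s\<close> is fixed by \<open>(m - s)!\<close> permutations, and \<open>\<Sum> (m
  choose s) (m - s)! = m! \<Sum> 1 / s!\<close>.\<close>
lemma sum_two_power_fixed_points_le:
  "(\<Sum>\<sigma> | \<sigma> permutes {..<m}. 2 ^ card {a. a < m \<and> \<sigma> a = a}) \<le> exp 1 * (fact m :: real)"
proof -
  let ?H = "{\<sigma>. \<sigma> permutes {..<m}}" and ?F = "\<lambda>\<sigma>. {a. a < m \<and> \<sigma> a = a}"
  have finH: "finite ?H" by (rule finite_permutations) simp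
  have "(\<Sum>\<sigma>\<in>?H. 2 ^ card (?F \<sigma>)) = (\<Sum>\<sigma>\<in>?H. \<Sum>S\<in>Pow {..<m}. of_bool (S \<subseteq> ?F \<sigma>) :: real)"
  proof (rule sum.cong[OF refl])
    fix \<sigma>
    have "Pow (?F \<sigma>) = Pow {..<m} \<inter> {S. S \<subseteq> ?F \<sigma>}" by auto
    hence "card (Pow (?F \<sigma>)) = card (Pow {..<m} \<inter> {S. S \<subseteq> ?F \<sigma>})" by simp
    thus "2 ^ card (?F \<sigma>) = (\<Sum>S\<in>Pow {..<m}. of_bool (S \<subseteq> ?F \<sigma>) :: real)"
      by (simp add: card_Pow sum_of_bool_eq flip: of_nat_power)
  qed
  also have "\<dots> = (\<Sum>S\<in>Pow {..<m}. \<Sum>\<sigma>\<in>?H. of_bool (S \<subseteq> ?F \<sigma>))" by (rule sum.swap)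
  also have "\<dots> = (\<Sum>S\<in>Pow {..<m}. fact (m - card S))"
  proof (rule sum.cong[OF refl])
    fix S assume S: "S \<in> Pow {..<m}"
    have "?H \<inter> {\<sigma>. S \<subseteq> ?F \<sigma>} = {\<sigma>. \<sigma> permutes ({..<m} - S)}"
      using S by (auto simp: permutes_def)
    moreover have "card {\<sigma>. \<sigma> permutes ({..<m} - S)} = fact (m - card S)"
      using S by (intro card_permutations) (auto simp: card_Diff_subset finite_subset)
    ultimately show "(\<Sum>\<sigma>\<in>?H. of_bool (S \<subseteq> ?F \<sigma>)) = (fact (m - card S) :: real)"
      using finH by (simp add: sum_of_bool_eq)
  qed
  also have "\<dots> = (\<Sum>s\<le>m. \<Sum>S | S \<in> Pow {..<m} \<and> card S = s. fact (m - card S))"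
    by (rule sum.group[symmetric]) (auto intro: card_mono[of "{..<m}", simplified])
  also have "\<dots> = (\<Sum>s\<le>m. real (m choose s) * fact (m - s))"
  proof (rule sum.cong[OF refl])
    fix s
    have "card {S. S \<in> Pow {..<m} \<and> card S = s} = m choose s"
      using n_subsets[of "{..<m}" s] by simp
    thus "(\<Sum>S | S \<in> Pow {..<m} \<and> card S = s. fact (m - card S)) = real (m choose s) * fact (m - s)" by simp
  qed
  also have "\<dots> = (\<Sum>s\<le>m. fact m * (1 / fact s))"
    by (intro sum.cong refl) (simp add: binomial_fact)
  also have "\<dots> = fact m * (\<Sum>s\<le>m. 1 / fact s)" by (simp add: sum_distrib_left)
  also have "(\<Sum>s\<le>m. 1 / fact s) \<le> exp (1 :: real)"
  proof -
    have "(\<lambda>s. 1 / fact s) sums exp (1 :: real)" using exp_converges[of "1 :: real"] by (simp add: divide_inverse)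
    thus ?thesis by (intro sum_le_suminf[of _ "{..m}", THEN order_trans]) (auto simp: sums_iff)
  qed
  finally show ?thesis by (simp add: mult.commute)
qed

lemma odd_power_le_two_power:
  "\<exists>C::real. C > 0 \<and> (\<forall>x::nat. real ((2 * x + 1) ^ r) \<le> C * 2 ^ x)"
proof -
  have "(\<lambda>x::nat. real ((2 * x + 1) ^ r) / 2 ^ x) \<longlonglongrightarrow> 0" by real_asymp
  hence "Bseq (\<lambda>x::nat. real ((2 * x + 1) ^ r) / 2 ^ x)" by (intro convergent_imp_Bseq) (auto simp: convergent_def)
  then obtain C where "C > 0" "\<And>x. norm (real ((2 * x + 1) ^ r) / 2 ^ x) \<le> C" by (auto simp: Bseq_def)
  thus ?thesis by (intro exI[of _ C]) (auto simp: field_simps)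
qed

text \<open>The point is that \<open>C\<close> depends neither on \<open>n\<close> nor on the unitary matrix
  \<open>M\<close>: a doubled permutation fixes at most \<open>2 f + 1\<close> indices if
  \<open>\<sigma>\<close> fixes \<open>f\<close> of them, and all moments of \<open>f\<close>
  are bounded uniformly in \<open>m\<close>.\<close>
lemma averaged_trace_power_bound:
  assumes k: "k \<ge> 1"
  obtains C :: real where "C > 0"
    "\<And>n M. M \<in> unitary_group n \<Longrightarrow>
       (\<Sum>\<sigma> | \<sigma> permutes {..<n div 2}.
          (norm (mat_trace ((M * monomial_mat n (double_perm (n div 2) \<sigma>) (\<lambda>_. 1)) ^\<^sub>m k)))\<^sup>2)
         \<le> C * fact (n div 2)"
proof -
  obtain C where C: "C > 0" "\<And>x::nat. real ((2 * x + 1) ^ (2 * k)) \<le> C * 2 ^ x"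
    using odd_power_le_two_power[of "2 * k"] by blast
  show ?thesis
  proof (rule that[of "C * exp 1"])
    fix n :: nat and M :: "complex mat"
    assume U: "M \<in> unitary_group n"
    define m where "m = n div 2"
    have mn: "2 * m \<le> n" "n \<le> 2 * m + 1" unfolding m_def by auto
    let ?I = "{..<k} \<rightarrow>\<^sub>E {..<n}" and ?H = "{\<sigma>. \<sigma> permutes {..<m}}"
    define act where "act = (\<lambda>\<sigma> i. \<lambda>l\<in>{..<k}. double_perm m \<sigma> (i l))"
    define X where "X = (\<lambda>i j. \<Prod>l<k. M $$ (i l, j (Suc l mod k)))"
    have M: "M \<in> carrier_mat n n" by (rule unitary_groupD(1)[OF U])
    have actI: "act \<sigma> i \<in> ?I" if "\<sigma> \<in> ?H" "i \<in> ?I" for \<sigma> i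
      using that double_perm_less[OF _ mn(1)] unfolding act_def by (auto simp: PiE_iff)
    have tr: "mat_trace ((M * monomial_mat n (double_perm m \<sigma>) (\<lambda>_. 1)) ^\<^sub>m k) = (\<Sum>i\<in>?I. X i (act \<sigma> i))"
      if "\<sigma> \<in> ?H" for \<sigma>
    proof -
      have "mat_trace ((M * monomial_mat n (double_perm m \<sigma>) (\<lambda>_. 1)) ^\<^sub>m k) =
          (\<Sum>i\<in>?I. \<Prod>l<k. M $$ (i l, double_perm m \<sigma> (i (Suc l mod k))))"
        using that by (intro trace_pow_mult_monomial_mat M k double_perm_less[OF _ mn(1)]) auto
      also have "\<dots> = (\<Sum>i\<in>?I. X i (act \<sigma> i))"
        unfolding X_def act_def using k by (intro sum.cong prod.cong refl) auto
      finally show ?thesis .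
    qed
    (* The group acts on closed walks, that is on k-tuples of indices; a tuple is fixed iff all
       its entries are, which produces the k-th power of the number of fixed indices. *)
    have "(\<Sum>\<sigma>\<in>?H. (norm (mat_trace ((M * monomial_mat n (double_perm m \<sigma>) (\<lambda>_. 1)) ^\<^sub>m k)))\<^sup>2) =
        (\<Sum>\<sigma>\<in>?H. (norm (\<Sum>i\<in>?I. X i (act \<sigma> i)))\<^sup>2)"
      by (intro sum.cong refl) (simp add: tr)
    also have "\<dots> \<le> (\<Sum>\<sigma>\<in>?H. (real (card {i\<in>?I. act \<sigma> i = i}))\<^sup>2)"
    proof (rule sum_norm_traces_le_sum_fixed_points[where mul = "\<lambda>\<sigma> \<tau>. \<sigma> \<circ> \<tau>"])
      show "finite ?I" by (intro finite_PiE) auto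
      show "finite ?H" by (rule finite_permutations) simp
      show "?H \<noteq> {}" using permutes_id by blast
      show "bij_betw (act \<sigma>) ?I ?I" if \<sigma>: "\<sigma> \<in> ?H" for \<sigma>
      proof (rule bij_betw_byWitness[where f' = "act (inv_into UNIV \<sigma>)"])
        have inv: "inv_into UNIV \<sigma> \<in> ?H" using \<sigma> by (auto intro: permutes_inv)
        show "act \<sigma> ` ?I \<subseteq> ?I" "act (inv_into UNIV \<sigma>) ` ?I \<subseteq> ?I" using actI \<sigma> inv by auto
        show "\<forall>i\<in>?I. act (inv_into UNIV \<sigma>) (act \<sigma> i) = i" "\<forall>i\<in>?I. act \<sigma> (act (inv_into UNIV \<sigma>) i) = i"
          using \<sigma> by (auto simp: act_def double_perm_inverse PiE_def extensional_def restrict_def fun_eq_iff)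
      qed
      show "bij_betw (\<lambda>\<tau>. \<tau> \<circ> \<sigma>) ?H ?H" if \<sigma>: "\<sigma> \<in> ?H" for \<sigma>
      proof (rule bij_betw_byWitness[where f' = "\<lambda>\<tau>. \<tau> \<circ> inv_into UNIV \<sigma>"])
        show "\<forall>\<tau>\<in>?H. \<tau> \<circ> \<sigma> \<circ> inv_into UNIV \<sigma> = \<tau>" "\<forall>\<tau>\<in>?H. \<tau> \<circ> inv_into UNIV \<sigma> \<circ> \<sigma> = \<tau>"
          using \<sigma> by (simp_all add: comp_assoc permutes_inv_o)
        show "(\<lambda>\<tau>. \<tau> \<circ> \<sigma>) ` ?H \<subseteq> ?H" "(\<lambda>\<tau>. \<tau> \<circ> inv_into UNIV \<sigma>) ` ?H \<subseteq> ?H"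
          using \<sigma> by (auto intro!: permutes_compose permutes_inv)
      qed
      show "act (\<tau> \<circ> \<sigma>) i = act \<tau> (act \<sigma> i)" if "\<sigma> \<in> ?H" for \<sigma> \<tau> i
        using that by (auto simp: act_def double_perm_comp restrict_def fun_eq_iff)
      show "(\<Sum>i\<in>?I. X i j * cnj (X i j')) = (if j = j' then 1 else 0)" if "j \<in> ?I" "j' \<in> ?I" for j j'
        unfolding X_def by (rule cycle_kernel_orthogonal[OF U k that])
    qed
    also have "\<dots> \<le> (\<Sum>\<sigma>\<in>?H. C * 2 ^ card {a. a < m \<and> \<sigma> a = a})"
    proof (rule sum_mono)
      fix \<sigma>
      let ?f = "card {a. a < m \<and> \<sigma> a = a}"
      have "{i\<in>?I. act \<sigma> i = i} \<subseteq> {..<k} \<rightarrow>\<^sub>E {a. a < n \<and> double_perm m \<sigma> a = a}"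
      proof
        fix i assume i: "i \<in> {i\<in>?I. act \<sigma> i = i}"
        hence fix_l: "act \<sigma> i l = i l" for l by simp
        hence "double_perm m \<sigma> (i l) = i l" if "l < k" for l
          using fix_l[of l] that by (simp add: act_def)
        thus "i \<in> {..<k} \<rightarrow>\<^sub>E {a. a < n \<and> double_perm m \<sigma> a = a}" using i by (auto simp: PiE_iff)
      qed
      hence "card {i\<in>?I. act \<sigma> i = i} \<le> card ({..<k} \<rightarrow>\<^sub>E {a. a < n \<and> double_perm m \<sigma> a = a})"
        by (intro card_mono finite_PiE) auto
      also have "\<dots> = card {a. a < n \<and> double_perm m \<sigma> a = a} ^ k" by (simp add: card_PiE)
      also have "\<dots> \<le> (2 * ?f + 1) ^ k" by (intro power_mono card_fixed_double_perm_le mn) auto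
      finally have "(real (card {i\<in>?I. act \<sigma> i = i}))\<^sup>2 \<le> (real ((2 * ?f + 1) ^ k))\<^sup>2"
        by (intro power_mono of_nat_mono) auto
      also have "\<dots> = real ((2 * ?f + 1) ^ (2 * k))" by (simp add: power_mult[symmetric] mult.commute)
      also have "\<dots> \<le> C * 2 ^ ?f" by (rule C(2))
      finally show "(real (card {i\<in>?I. act \<sigma> i = i}))\<^sup>2 \<le> C * 2 ^ ?f" .
    qed
    also have "\<dots> = C * (\<Sum>\<sigma>\<in>?H. 2 ^ card {a. a < m \<and> \<sigma> a = a})" by (simp add: sum_distrib_left)
    also have "\<dots> \<le> C * (exp 1 * fact m)"
      using C(1) by (intro mult_left_mono sum_two_power_fixed_points_le) auto
    finally show "(\<Sum>\<sigma> | \<sigma> permutes {..<n div 2}.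
          (norm (mat_trace ((M * monomial_mat n (double_perm (n div 2) \<sigma>) (\<lambda>_. 1)) ^\<^sub>m k)))\<^sup>2)
         \<le> C * exp 1 * fact (n div 2)"
      unfolding m_def by (simp add: mult.assoc)
  qed (use C in auto)
qed

section \<open>The classical groups\<close>

lemma mat_adjoint_index:
  assumes "A \<in> carrier_mat n n" "i < n" "j < n"
  shows "mat_adjoint A $$ (i, j) = cnj (A $$ (j, i))"
  using assms by (auto simp: mat_adjoint_def mat_of_rows_def conjugate_complex_def)

lemma mat_adjoint_carrier [simp]: "A \<in> carrier_mat n n \<Longrightarrow> mat_adjoint A \<in> carrier_mat n n"
  by (auto simp: mat_adjoint_def mat_of_rows_def)

lemma mat_mult_index:
  fixes A B :: "'a :: semiring_0 mat"
  assumes "A \<in> carrier_mat n m" "B \<in> carrier_mat m p" "i < n" "j < p"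
  shows "(A * B) $$ (i, j) = (\<Sum>k<m. A $$ (i, k) * B $$ (k, j))"
  using assms by (auto simp: scalar_prod_def atLeast0LessThan intro!: sum.cong)

lemma mat_assoc4:
  fixes A B C D :: "'a :: semiring_0 mat"
  assumes "A \<in> carrier_mat n n" "B \<in> carrier_mat n n" "C \<in> carrier_mat n n" "D \<in> carrier_mat n n"
  shows "A * B * (C * D) = A * (B * C) * D"
proof -
  have "A * B * (C * D) = A * (B * (C * D))" using assms by (intro assoc_mult_mat) auto
  also have "B * (C * D) = B * C * D" using assms by (intro assoc_mult_mat[symmetric]) auto
  also have "A * (B * C * D) = A * (B * C) * D" using assms by (intro assoc_mult_mat[symmetric]) auto
  finally show ?thesis .
qed

lemma unitaryI:
  assumes A: "A \<in> carrier_mat n n"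
    and col: "\<And>i j. i < n \<Longrightarrow> j < n \<Longrightarrow> (\<Sum>k<n. cnj (A $$ (k, i)) * A $$ (k, j)) = (if i = j then 1 else 0)"
  shows "A \<in> unitary_group n"
proof -
  have A': "mat_adjoint A \<in> carrier_mat n n" using A by simp
  have 1: "mat_adjoint A * A = 1\<^sub>m n"
  proof (rule eq_matI)
    fix i j assume "i < dim_row (1\<^sub>m n :: complex mat)" "j < dim_col (1\<^sub>m n :: complex mat)"
    thus "(mat_adjoint A * A) $$ (i, j) = 1\<^sub>m n $$ (i, j)"
      using col by (simp add: mat_mult_index[OF A' A] mat_adjoint_index[OF A])
  qed (use carrier_matD[OF A] carrier_matD[OF A'] in simp_all)
  hence "A * mat_adjoint A = 1\<^sub>m n" by (rule mat_mult_left_right_inverse[OF A' A])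
  with 1 A show ?thesis by (simp add: unitary_group_def)
qed

lemma unitary_group_mult:
  assumes "A \<in> unitary_group n" "B \<in> unitary_group n"
  shows "A * B \<in> unitary_group n"
proof (rule unitaryI)
  have A: "A \<in> carrier_mat n n" and B: "B \<in> carrier_mat n n" using assms unitary_groupD(1) by auto
  thus "A * B \<in> carrier_mat n n" by simp
  fix i j assume ij: "i < n" "j < n"
  have "(\<Sum>k<n. cnj ((A * B) $$ (k, i)) * (A * B) $$ (k, j)) =
    (\<Sum>k<n. \<Sum>l<n. \<Sum>l'<n. cnj (B $$ (l, i)) * B $$ (l', j) * (A $$ (k, l') * cnj (A $$ (k, l))))"
    by (rule sum.cong[OF refl]) (simp add: mat_mult_index[OF A B] ij sum_product, simp add: mult_ac)
  also have "\<dots> = (\<Sum>l<n. \<Sum>l'<n. cnj (B $$ (l, i)) * B $$ (l', j) * (\<Sum>k<n. A $$ (k, l') * cnj (A $$ (k, l))))"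
    by (subst sum.swap, rule sum.cong[OF refl], subst sum.swap) (simp add: sum_distrib_left)
  also have "\<dots> = (\<Sum>l<n. \<Sum>l'<n. if l' = l then cnj (B $$ (l, i)) * B $$ (l, j) else 0)"
    by (rule sum.cong[OF refl], rule sum.cong[OF refl]) (simp add: unitary_groupD(3)[OF assms(1)])
  also have "\<dots> = (\<Sum>l<n. B $$ (l, j) * cnj (B $$ (l, i)))" by (simp add: mult.commute)
  also have "\<dots> = (if i = j then 1 else 0)"
    using unitary_groupD(3)[OF assms(2) ij(2,1)] by auto
  finally show "(\<Sum>k<n. cnj ((A * B) $$ (k, i)) * (A * B) $$ (k, j)) = (if i = j then 1 else 0)" .
qed

lemma symplectic_form_carrier: "even n \<Longrightarrow> symplectic_form n \<in> carrier_mat n n"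
  by (auto simp: symplectic_form_def Let_def elim!: evenE)

lemma symplectic_group_mult:
  assumes n: "even n" and AB: "A \<in> symplectic_group n" "B \<in> symplectic_group n"
  shows "A * B \<in> symplectic_group n"
proof -
  let ?\<Omega> = "symplectic_form n"
  have c [simp]: "A \<in> carrier_mat n n" "B \<in> carrier_mat n n" "?\<Omega> \<in> carrier_mat n n"
      "A\<^sup>T \<in> carrier_mat n n" "B\<^sup>T \<in> carrier_mat n n"
    using AB symplectic_form_carrier[OF n] by (auto simp: symplectic_group_def unitary_group_def)
  have A: "A * ?\<Omega> * A\<^sup>T = ?\<Omega>" "A\<^sup>T * ?\<Omega> * A = ?\<Omega>" and B: "B * ?\<Omega> * B\<^sup>T = ?\<Omega>" "B\<^sup>T * ?\<Omega> * B = ?\<Omega>"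
    using AB by (auto simp: symplectic_group_def)
  have T: "(A * B)\<^sup>T = B\<^sup>T * A\<^sup>T" by (rule transpose_mult[of _ n n _ n]) auto
  have "A * B * ?\<Omega> * (B\<^sup>T * A\<^sup>T) = A * (B * ?\<Omega> * B\<^sup>T) * A\<^sup>T"
    using mat_assoc4[OF c(1) mult_carrier_mat[OF c(2,3)] c(5,4)] assoc_mult_mat[OF c(1,2,3)] by simp
  moreover have "B\<^sup>T * A\<^sup>T * ?\<Omega> * (A * B) = B\<^sup>T * (A\<^sup>T * ?\<Omega> * A) * B"
    using mat_assoc4[OF c(5) mult_carrier_mat[OF c(4,3)] c(1,2)] assoc_mult_mat[OF c(5,4,3)] by simp
  moreover have "A * B \<in> unitary_group n"
    using AB by (intro unitary_group_mult) (auto simp: symplectic_group_def)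
  ultimately show ?thesis by (simp add: symplectic_group_def T A B)
qed

lemma real_orthogonal_mult:
  assumes "A \<in> real_orthogonal n" "B \<in> real_orthogonal n"
  shows "A * B \<in> real_orthogonal n"
proof -
  have c [simp]: "A \<in> carrier_mat n n" "B \<in> carrier_mat n n" "A\<^sup>T \<in> carrier_mat n n" "B\<^sup>T \<in> carrier_mat n n"
    using assms by (auto simp: real_orthogonal_def)
  have A: "A * A\<^sup>T = 1\<^sub>m n" "A\<^sup>T * A = 1\<^sub>m n" and B: "B * B\<^sup>T = 1\<^sub>m n" "B\<^sup>T * B = 1\<^sub>m n"
    using assms by (auto simp: real_orthogonal_def)
  have T: "(A * B)\<^sup>T = B\<^sup>T * A\<^sup>T" by (rule transpose_mult[of _ n n _ n]) auto
  have "A * B * (B\<^sup>T * A\<^sup>T) = A * (B * B\<^sup>T) * A\<^sup>T"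
    by (rule mat_assoc4[of _ n]) auto
  moreover have "B\<^sup>T * A\<^sup>T * (A * B) = B\<^sup>T * (A\<^sup>T * A) * B"
    by (rule mat_assoc4[of _ n]) auto
  ultimately show ?thesis
    using mult_carrier_mat[OF c(1,2)]
    by (simp add: real_orthogonal_def T A B right_mult_one_mat[of _ n n])
qed

lemma map_mat_of_real_mult:
  assumes "A \<in> carrier_mat n n" "B \<in> carrier_mat n n"
  shows "map_mat complex_of_real A * map_mat complex_of_real B = map_mat complex_of_real (A * B)"
  by (rule of_real_hom.mat_hom_mult[OF assms, symmetric])

lemma classical_group_mult:
  assumes "G \<in> classical_groups n" "A \<in> G" "B \<in> G"
  shows "A * B \<in> G"
proof -
  have O: "\<exists>C\<in>real_orthogonal n. Determinant.det C = Determinant.det A' * Determinant.det B' \<and> 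
      map_mat complex_of_real A' * map_mat complex_of_real B' = map_mat complex_of_real C"
    if "A' \<in> real_orthogonal n" "B' \<in> real_orthogonal n" for A' B'
  proof (rule bexI[of _ "A' * B'"])
    have "A' \<in> carrier_mat n n" "B' \<in> carrier_mat n n" using that by (auto simp: real_orthogonal_def)
    thus "Determinant.det (A' * B') = Determinant.det A' * Determinant.det B' \<and> 
      map_mat complex_of_real A' * map_mat complex_of_real B' = map_mat complex_of_real (A' * B')"
      by (simp add: det_mult map_mat_of_real_mult)
  qed (rule real_orthogonal_mult[OF that])
  consider "G = orthogonal_group n" | "G = special_orthogonal_group n" | "G = unitary_group n"
    | "G = symplectic_group n" "even n"
    using assms(1) by (auto simp: classical_groups_def split: if_splits)
  thus ?thesis
  proof cases
    case 1
    then obtain A' B' where "A' \<in> real_orthogonal n" "B' \<in> real_orthogonal n"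
      "A = map_mat complex_of_real A'" "B = map_mat complex_of_real B'"
      using assms by (auto simp: orthogonal_group_def)
    thus ?thesis using O[of A' B'] 1 by (auto simp: orthogonal_group_def)
  next
    case 2
    then obtain A' B' where "A' \<in> real_orthogonal n" "B' \<in> real_orthogonal n"
      "Determinant.det A' = 1" "Determinant.det B' = 1"
      "A = map_mat complex_of_real A'" "B = map_mat complex_of_real B'"
      using assms by (auto simp: special_orthogonal_group_def)
    thus ?thesis using O[of A' B'] 2 by (auto simp: special_orthogonal_group_def)
  qed (use assms unitary_group_mult symplectic_group_mult in auto)
qed

lemma orthogonal_subset_unitary: "orthogonal_group n \<subseteq> unitary_group n"
proof
  fix A assume "A \<in> orthogonal_group n"
  then obtain B where B: "B \<in> carrier_mat n n" "B * B\<^sup>T = 1\<^sub>m n" "B\<^sup>T * B = 1\<^sub>m n"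
    and A: "A = map_mat complex_of_real B" by (auto simp: orthogonal_group_def real_orthogonal_def)
  have Ac: "A \<in> carrier_mat n n" and BT: "B\<^sup>T \<in> carrier_mat n n" using B A by auto
  have adj: "mat_adjoint A = map_mat complex_of_real B\<^sup>T"
  proof (rule eq_matI)
    fix i j assume "i < dim_row (map_mat complex_of_real B\<^sup>T)" "j < dim_col (map_mat complex_of_real B\<^sup>T)"
    hence "i < n" "j < n" using B(1) by auto
    thus "mat_adjoint A $$ (i, j) = map_mat complex_of_real B\<^sup>T $$ (i, j)"
      unfolding mat_adjoint_index[OF Ac \<open>i < n\<close> \<open>j < n\<close>] using B(1) by (simp add: A)
  qed (use mat_adjoint_carrier[OF Ac] B(1) in auto)
  show "A \<in> unitary_group n"
    unfolding unitary_group_def using Ac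
    by (simp add: adj) (simp add: A map_mat_of_real_mult[OF B(1) BT] map_mat_of_real_mult[OF BT B(1)] B of_real_hom.mat_hom_one)
qed

lemma special_orthogonal_subset_orthogonal: "special_orthogonal_group n \<subseteq> orthogonal_group n"
  by (auto simp: special_orthogonal_group_def orthogonal_group_def)

lemma classical_group_subset_unitary: "G \<in> classical_groups n \<Longrightarrow> G \<subseteq> unitary_group n"
  using orthogonal_subset_unitary special_orthogonal_subset_orthogonal[of n]
  by (auto simp: classical_groups_def symplectic_group_def split: if_splits)

text \<open>What matters about the orthogonal and unitary groups is only that they contain
  \<open>SO(n)\<close>; the symplectic group is the one separate case.\<close>
lemma classical_group_cases:
  assumes "G \<in> classical_groups n"
  obtains (orthogonal) "special_orthogonal_group n \<subseteq> G" | (symplectic) "even n" "G = symplectic_group n"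
  using assms orthogonal_subset_unitary special_orthogonal_subset_orthogonal[of n]
  by (auto simp: classical_groups_def split: if_splits)

lemma special_orthogonalI:
  assumes U: "A \<in> unitary_group n" and real: "\<And>i j. i < n \<Longrightarrow> j < n \<Longrightarrow> A $$ (i, j) \<in> \<real>"
    and det: "Determinant.det A = 1"
  shows "A \<in> special_orthogonal_group n"
proof -
  define B where "B = map_mat Re A"
  have A: "A \<in> carrier_mat n n" by (rule unitary_groupD(1)[OF U])
  hence B: "B \<in> carrier_mat n n" by (simp add: B_def)
  have AB: "A = map_mat complex_of_real B"
    using A real by (intro eq_matI) (auto simp: B_def)
  have ReA: "A $$ (i, j) = complex_of_real (B $$ (i, j))" if "i < n" "j < n" for i j
    using that B by (simp add: AB)
  have "(\<Sum>k<n. complex_of_real (B $$ (i, k) * B $$ (j, k))) = (if i = j then 1 else 0)"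
    "(\<Sum>k<n. complex_of_real (B $$ (k, i) * B $$ (k, j))) = (if i = j then 1 else 0)"
    if "i < n" "j < n" for i j
    using unitary_groupD(2,3)[OF U that] that by (simp_all add: ReA)
  note c = this
  have *: "(\<Sum>k<n. B $$ (i, k) * B $$ (j, k)) = (if i = j then 1 else 0)"
    "(\<Sum>k<n. B $$ (k, i) * B $$ (k, j)) = (if i = j then 1 else 0)"
    if "i < n" "j < n" for i j
  proof -
    have "complex_of_real (\<Sum>k<n. B $$ (i, k) * B $$ (j, k)) = complex_of_real (if i = j then 1 else 0)"
      "complex_of_real (\<Sum>k<n. B $$ (k, i) * B $$ (k, j)) = complex_of_real (if i = j then 1 else 0)"
      using c[OF that] by simp_all
    thus "(\<Sum>k<n. B $$ (i, k) * B $$ (j, k)) = (if i = j then 1 else 0)"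
      "(\<Sum>k<n. B $$ (k, i) * B $$ (k, j)) = (if i = j then 1 else 0)"
      unfolding of_real_eq_iff .
  qed
  have "B * B\<^sup>T = 1\<^sub>m n" "B\<^sup>T * B = 1\<^sub>m n"
    using B * by (auto intro!: eq_matI simp: scalar_prod_def atLeast0LessThan)
  hence "B \<in> real_orthogonal n" using B by (simp add: real_orthogonal_def)
  moreover have "complex_of_real (Determinant.det B) = 1"
    using det unfolding AB by simp
  ultimately show ?thesis unfolding special_orthogonal_group_def AB by (auto simp del: of_real_eq_1_iff simp: of_real_eq_1_iff)
qed

text \<open>Column \<open>b\<close> of the symplectic form has a single nonzero entry, \<open>half_sign m
  b\<close> in row \<open>half_shift m b\<close>.\<close>
definition half_shift :: "nat \<Rightarrow> nat \<Rightarrow> nat" where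
  "half_shift m b = (if b < m then b + m else b - m)"

definition half_sign :: "nat \<Rightarrow> nat \<Rightarrow> complex" where
  "half_sign m b = (if b < m then - 1 else 1)"

lemma half_shift_less: "b < 2 * m \<Longrightarrow> half_shift m b < 2 * m"
  and half_shift_shift: "b < 2 * m \<Longrightarrow> half_shift m (half_shift m b) = b"
  and half_sign_shift: "b < 2 * m \<Longrightarrow> half_sign m (half_shift m b) = - half_sign m b"
  and half_sign_square: "half_sign m b * half_sign m b = 1"
  and cnj_half_sign: "cnj (half_sign m b) = half_sign m b"
  by (auto simp: half_shift_def half_sign_def)

lemma half_shift_eq_iff: "a < 2 * m \<Longrightarrow> b < 2 * m \<Longrightarrow> half_shift m a = half_shift m b \<longleftrightarrow> a = b"
  by (metis half_shift_shift)

lemma symplectic_form_eq: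
  assumes "n = 2 * m"
  shows "symplectic_form n = monomial_mat n (half_shift m) (half_sign m)"
  using assms by (intro eq_matI) (auto simp: symplectic_form_def Let_def half_shift_def half_sign_def)

text \<open>For unitary \<open>A\<close> both symplectic conditions say that conjugation by the form
  \<open>\<Omega>\<close> turns \<open>A\<close> into its entrywise conjugate, that is
  \<open>\<Omega> A = cnj A \<Omega>\<close>.\<close>
lemma symplecticI:
  assumes n: "n = 2 * m" and U: "A \<in> unitary_group n"
    and sym: "\<And>a b. a < n \<Longrightarrow> b < n \<Longrightarrow>
      half_sign m a * A $$ (a, b) = half_sign m b * cnj (A $$ (half_shift m a, half_shift m b))"
  shows "A \<in> symplectic_group n"
proof -
  let ?\<Omega> = "symplectic_form n"
  define B where "B = map_mat cnj A"
  have A: "A \<in> carrier_mat n n" by (rule unitary_groupD(1)[OF U])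
  hence B: "B \<in> carrier_mat n n" by (simp add: B_def)
  have \<Omega>: "?\<Omega> \<in> carrier_mat n n" using n by (intro symplectic_form_carrier) simp
  have T: "A\<^sup>T \<in> carrier_mat n n" using A by simp
  have left: "(?\<Omega> * C) $$ (a, b) = - half_sign m a * C $$ (half_shift m a, b)"
    if "C \<in> carrier_mat n n" "a < n" "b < n" for C a b
  proof -
    have "(?\<Omega> * C) $$ (a, b) = (\<Sum>k<n. (if a = half_shift m k then half_sign m k else 0) * C $$ (k, b))"
      using that by (simp add: symplectic_form_eq[OF n] scalar_prod_def atLeast0LessThan)
    also have "\<dots> = (\<Sum>k<n. if k = half_shift m a then half_sign m (half_shift m a) * C $$ (half_shift m a, b) else 0)"
      using that(2) n by (intro sum.cong) (auto simp: half_shift_shift)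
    also have "\<dots> = - half_sign m a * C $$ (half_shift m a, b)"
      using that(2) n by (simp add: half_shift_less half_sign_shift)
    finally show ?thesis .
  qed
  have right: "(C * ?\<Omega>) $$ (a, b) = C $$ (a, half_shift m b) * half_sign m b"
    if "C \<in> carrier_mat n n" "a < n" "b < n" for C a b
    unfolding symplectic_form_eq[OF n] using that n by (intro mult_monomial_mat_index) (auto intro: half_shift_less)
  have 1: "?\<Omega> * A = B * ?\<Omega>"
  proof (rule eq_matI)
    fix a b assume "a < dim_row (B * ?\<Omega>)" "b < dim_col (B * ?\<Omega>)"
    hence ab: "a < n" "b < n" using B \<Omega> by auto
    have a': "half_shift m a < n" and b': "half_shift m b < n" using ab n by (auto intro: half_shift_less)
    show "(?\<Omega> * A) $$ (a, b) = (B * ?\<Omega>) $$ (a, b)"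
    proof -
      have "- half_sign m a * A $$ (half_shift m a, b) = half_sign m b * cnj (A $$ (a, half_shift m b))"
        using sym[OF a' ab(2)] ab n by (simp add: half_sign_shift half_shift_shift)
      thus ?thesis using ab b' A by (simp only: left[OF A ab] right[OF B ab]) (simp add: B_def)
    qed
  qed (use A B \<Omega> in auto)
  have 2: "A * ?\<Omega> = ?\<Omega> * B"
  proof (rule eq_matI)
    fix a b assume "a < dim_row (?\<Omega> * B)" "b < dim_col (?\<Omega> * B)"
    hence ab: "a < n" "b < n" using B \<Omega> by auto
    have a': "half_shift m a < n" and b': "half_shift m b < n" using ab n by (auto intro: half_shift_less)
    let ?x = "A $$ (a, half_shift m b)" and ?c = "cnj (A $$ (half_shift m a, b))"
    have e: "half_sign m a * ?x = - half_sign m b * ?c"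
      using sym[OF ab(1) b'] ab n by (simp add: half_sign_shift half_shift_shift)
    have "?x * half_sign m b = (half_sign m a * half_sign m a) * ?x * half_sign m b"
      by (simp add: half_sign_square)
    also have "\<dots> = half_sign m a * (half_sign m a * ?x) * half_sign m b" by (simp only: mult.assoc)
    also have "\<dots> = - half_sign m a * ?c * (half_sign m b * half_sign m b)" unfolding e by simp
    finally have "?x * half_sign m b = - half_sign m a * ?c" by (simp add: half_sign_square)
    thus "(A * ?\<Omega>) $$ (a, b) = (?\<Omega> * B) $$ (a, b)"
      using ab a' A by (simp only: left[OF B ab] right[OF A ab]) (simp add: B_def)
  qed (use A B \<Omega> in auto)
  have "A\<^sup>T * B = 1\<^sub>m n"
    using A B unitary_groupD(3)[OF U] by (intro eq_matI) (auto simp: B_def scalar_prod_def atLeast0LessThan)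
  hence "A\<^sup>T * ?\<Omega> * A = ?\<Omega>"
    using assoc_mult_mat[OF T \<Omega> A] assoc_mult_mat[OF T B \<Omega>] \<Omega> 1 by simp
  moreover have "B * A\<^sup>T = 1\<^sub>m n"
  proof (rule eq_matI)
    fix i j assume "i < dim_row (1\<^sub>m n)" "j < dim_col (1\<^sub>m n)"
    thus "(B * A\<^sup>T) $$ (i, j) = 1\<^sub>m n $$ (i, j)"
      using A unitary_groupD(2)[OF U, of j i] by (auto simp: B_def scalar_prod_def atLeast0LessThan mult.commute)
  qed (use A B in auto)
  hence "A * ?\<Omega> * A\<^sup>T = ?\<Omega>"
    using assoc_mult_mat[OF \<Omega> B T] \<Omega> 2 by simp
  ultimately show ?thesis using U by (simp add: symplectic_group_def)
qed

section \<open>Doubled permutations in the classical groups\<close>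

lemma real_unitary_det_square:
  assumes U: "A \<in> unitary_group n" and real: "\<And>i j. i < n \<Longrightarrow> j < n \<Longrightarrow> A $$ (i, j) \<in> \<real>"
  shows "Determinant.det A * Determinant.det A = 1"
proof -
  have A: "A \<in> carrier_mat n n" by (rule unitary_groupD(1)[OF U])
  have "mat_adjoint A = A\<^sup>T"
    using A carrier_matD[OF mat_adjoint_carrier[OF A]] real
    by (intro eq_matI) (auto simp: mat_adjoint_index[OF A] Reals_cnj_iff)
  hence "A\<^sup>T * A = 1\<^sub>m n" using U by (simp add: unitary_group_def)
  hence "Determinant.det (A\<^sup>T * A) = 1" by simp
  thus ?thesis using A by (simp add: det_mult[of _ n] det_transpose)
qed

lemma monomial_mat_unitary:
  assumes "\<And>b. b < n \<Longrightarrow> \<pi> b < n" "inj_on \<pi> {..<n}"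
  shows "monomial_mat n \<pi> (\<lambda>_. 1) \<in> unitary_group n"
proof (rule unitaryI)
  fix i j assume ij: "i < n" "j < n"
  have "(\<Sum>k<n. cnj (monomial_mat n \<pi> (\<lambda>_. 1) $$ (k, i)) * monomial_mat n \<pi> (\<lambda>_. 1) $$ (k, j)) =
      (\<Sum>k<n. if k = \<pi> i then if \<pi> i = \<pi> j then 1 else 0 else 0)"
    by (rule sum.cong[OF refl]) (simp add: ij)
  also have "\<dots> = (if i = j then 1 else 0)"
    using assms(1)[OF ij(1)] inj_on_eq_iff[OF assms(2), of i j] ij by simp
  finally show "(\<Sum>k<n. cnj (monomial_mat n \<pi> (\<lambda>_. 1) $$ (k, i)) * monomial_mat n \<pi> (\<lambda>_. 1) $$ (k, j)) =
    (if i = j then 1 else 0)" .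
qed simp

lemma det_monomial_mat_square:
  assumes "\<And>b. b < n \<Longrightarrow> \<pi> b < n" "inj_on \<pi> {..<n}"
  shows "Determinant.det (monomial_mat n \<pi> (\<lambda>_. 1)) * Determinant.det (monomial_mat n \<pi> (\<lambda>_. 1)) = 1"
  by (rule real_unitary_det_square[OF monomial_mat_unitary[OF assms]]) auto

lemma monomial_mat_cong:
  "(\<And>b. b < n \<Longrightarrow> \<pi> b = \<rho> b) \<Longrightarrow> monomial_mat n \<pi> s = monomial_mat n \<rho> s"
  by (intro eq_matI) auto

lemma inj_on_double_perm:
  "\<sigma> permutes {..<m} \<Longrightarrow> inj_on (double_perm m \<sigma>) A"
  by (rule inj_on_inverseI[of _ "double_perm m (inv_into UNIV \<sigma>)"]) (rule double_perm_inverse(1))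

text \<open>The two blocks are conjugate by the block swap \<open>w\<close>, so the matrix is
  \<open>\<alpha> w \<alpha> w\<close> with \<open>\<alpha>\<close> acting on the first block
  only. Every factor occurs twice and has determinant \<open>\<plusminus>1\<close>.\<close>
lemma det_double_perm:
  assumes \<sigma>: "\<sigma> permutes {..<m}" and n: "2 * m \<le> n"
  shows "Determinant.det (monomial_mat n (double_perm m \<sigma>) (\<lambda>_. 1)) = 1"
proof -
  (* \<alpha> is \<sigma> on the first block, w swaps the two blocks. *)
  define \<alpha> where "\<alpha> = (\<lambda>a. if a < m then \<sigma> a else a)"
  define w where "w = (\<lambda>a. if a < m then a + m else if a < 2 * m then a - m else a)"
  let ?P = "\<lambda>\<pi>. monomial_mat n \<pi> (\<lambda>_. 1)"
  have \<sigma>m: "\<sigma> a < m \<longleftrightarrow> a < m" for a by (rule permutes_lessThan_iff[OF \<sigma>])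
  have \<alpha>n: "\<alpha> a < n" if "a < n" for a using that \<sigma>m[of a] n by (auto simp: \<alpha>_def)
  have wn: "w a < n" if "a < n" for a using that n by (auto simp: w_def)
  have \<alpha>inj: "inj_on \<alpha> {..<n}"
  proof (rule inj_onI)
    fix a b assume "\<alpha> a = \<alpha> b"
    thus "a = b" using \<sigma>m[of a] \<sigma>m[of b] permutes_inj[OF \<sigma>]
      by (auto simp: \<alpha>_def inj_eq split: if_splits)
  qed
  have ww: "w (w a) = a" for a by (auto simp: w_def)
  have "inj_on w {..<n}" by (rule inj_on_inverseI[of _ w]) (rule ww)
  note det2 = det_monomial_mat_square[OF \<alpha>n \<alpha>inj] det_monomial_mat_square[OF wn this]
  have eq: "double_perm m \<sigma> a = \<alpha> (w (\<alpha> (w a)))" for a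
  proof -
    consider "a < m" | "m \<le> a" "a < 2 * m" | "2 * m \<le> a" by linarith
    thus ?thesis
    proof cases
      case 1
      thus ?thesis using \<sigma>m[of a] by (simp add: double_perm_def \<alpha>_def w_def)
    next
      case 2
      hence "a - m < m" by linarith
      thus ?thesis using 2 \<sigma>m[of "a - m"] by (simp add: double_perm_def \<alpha>_def w_def)
    qed (simp add: double_perm_def \<alpha>_def w_def)
  qed
  have "?P \<alpha> * (?P w * (?P \<alpha> * ?P w)) = ?P (\<lambda>a. \<alpha> (w (\<alpha> (w a))))"
    using \<alpha>n wn by (simp add: monomial_mat_mult)
  also have "\<dots> = ?P (double_perm m \<sigma>)" by (rule monomial_mat_cong) (simp only: eq)
  finally have prod: "?P (double_perm m \<sigma>) = ?P \<alpha> * (?P w * (?P \<alpha> * ?P w))" by (rule sym)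
  have det4: "Determinant.det (A * (B * (A * B))) = (Determinant.det A * Determinant.det A) * (Determinant.det B * Determinant.det B)"
    if "A \<in> carrier_mat n n" "B \<in> carrier_mat n n" for A B :: "complex mat"
  proof -
    have "A * B \<in> carrier_mat n n" "B * (A * B) \<in> carrier_mat n n" using that by auto
    thus ?thesis using that by (simp add: det_mult[of _ n])
  qed
  show ?thesis
    unfolding prod det4[OF monomial_mat_carrier monomial_mat_carrier] using det2 by simp
qed

lemma double_perm_in_classical_group:
  assumes G: "G \<in> classical_groups n" and \<sigma>: "\<sigma> permutes {..<n div 2}"
  shows "monomial_mat n (double_perm (n div 2) \<sigma>) (\<lambda>_. 1) \<in> G"
proof -
  define m where "m = n div 2"
  let ?\<pi> = "double_perm m \<sigma>"
  have mn: "2 * m \<le> n" and \<sigma>: "\<sigma> permutes {..<m}" using \<sigma> by (auto simp: m_def)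
  have U: "monomial_mat n ?\<pi> (\<lambda>_. 1) \<in> unitary_group n"
    by (intro monomial_mat_unitary inj_on_double_perm[OF \<sigma>] double_perm_less[OF \<sigma> mn])
  from G show ?thesis unfolding m_def[symmetric]
  proof (cases rule: classical_group_cases)
    case orthogonal
    moreover have "monomial_mat n ?\<pi> (\<lambda>_. 1) \<in> special_orthogonal_group n"
      by (rule special_orthogonalI[OF U]) (auto simp: det_double_perm[OF \<sigma> mn])
    ultimately show "monomial_mat n ?\<pi> (\<lambda>_. 1) \<in> G" by blast
  next
    case symplectic
    hence n: "n = 2 * m" by (auto simp: m_def)
    have \<sigma>m: "\<sigma> a < m \<longleftrightarrow> a < m" for a by (rule permutes_lessThan_iff[OF \<sigma>])
    have comm: "?\<pi> (half_shift m b) = half_shift m (?\<pi> b)" "half_sign m (?\<pi> b) = half_sign m b" if "b < n" for b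
    proof -
      have "b < m \<or> m \<le> b \<and> b - m < m" using that n by auto
      thus "?\<pi> (half_shift m b) = half_shift m (?\<pi> b)" "half_sign m (?\<pi> b) = half_sign m b"
        using \<sigma>m[of b] \<sigma>m[of "b - m"] by (auto simp: double_perm_def half_shift_def half_sign_def)
    qed
    have "monomial_mat n ?\<pi> (\<lambda>_. 1) \<in> symplectic_group n"
    proof (rule symplecticI[OF n U])
      fix a b assume ab: "a < n" "b < n"
      have "?\<pi> b < n" using double_perm_less[OF \<sigma> mn ab(2)] .
      hence iff: "half_shift m a = half_shift m (?\<pi> b) \<longleftrightarrow> a = ?\<pi> b" using ab n half_shift_eq_iff by simp
      show "half_sign m a * monomial_mat n ?\<pi> (\<lambda>_. 1) $$ (a, b) =
        half_sign m b * cnj (monomial_mat n ?\<pi> (\<lambda>_. 1) $$ (half_shift m a, half_shift m b))"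
      proof -
        have "half_shift m a < n" "half_shift m b < n" using ab half_shift_less n by simp_all
        hence "monomial_mat n ?\<pi> (\<lambda>_. 1) $$ (half_shift m a, half_shift m b) = (if a = ?\<pi> b then 1 else 0)"
          by (simp only: monomial_mat_index comm(1)[OF ab(2)] iff)
        moreover have "monomial_mat n ?\<pi> (\<lambda>_. 1) $$ (a, b) = (if a = ?\<pi> b then 1 else 0)"
          by (simp only: monomial_mat_index ab)
        ultimately show ?thesis using comm(2)[OF ab(2)] by auto
      qed
    qed
    thus "monomial_mat n ?\<pi> (\<lambda>_. 1) \<in> G" by (simp only: symplectic(2))
  qed
qed

section \<open>Rotations in the classical groups\<close>

text \<open>The data of a skew-Hermitian matrix \<open>J\<close> with one entry \<open>s b\<close> at most
  in each column \<open>b\<close>, in row \<open>\<pi> b\<close>, that satisfies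
  \<open>J\<^sup>3 = - J\<close>: on every index it is either zero or squares to
  \<open>-1\<close>.\<close>
definition skew_pairing :: "nat \<Rightarrow> (nat \<Rightarrow> nat) \<Rightarrow> (nat \<Rightarrow> complex) \<Rightarrow> bool" where
  "skew_pairing n \<pi> s \<longleftrightarrow> (\<forall>b<n. \<pi> b < n \<and> \<pi> (\<pi> b) = b \<and> s (\<pi> b) = - cnj (s b) \<and>
      (s b = 0 \<or> s (\<pi> b) * s b = - 1))"

lemma skew_pairingD:
  assumes "skew_pairing n \<pi> s" "b < n"
  shows "\<pi> b < n" "\<pi> (\<pi> b) = b" "s (\<pi> b) = - cnj (s b)" "s b = 0 \<or> s (\<pi> b) * s b = - 1"
proof -
  note c = assms(1)[unfolded skew_pairing_def, rule_format, OF assms(2)]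
  show "\<pi> b < n" by (rule conjunct1[OF c])
  show "\<pi> (\<pi> b) = b" by (rule conjunct1[OF conjunct2[OF c]])
  show "s (\<pi> b) = - cnj (s b)" by (rule conjunct1[OF conjunct2[OF conjunct2[OF c]]])
  show "s b = 0 \<or> s (\<pi> b) * s b = - 1" by (rule conjunct2[OF conjunct2[OF conjunct2[OF c]]])
qed

text \<open>The one-parameter group \<open>exp (\<phi> J) = 1 + sin \<phi> J + (1 - cos \<phi>)
  J\<^sup>2\<close> of the matrix \<open>J\<close> given by \<open>\<pi>\<close> and
  \<open>s\<close>.\<close>
definition rotation :: "nat \<Rightarrow> (nat \<Rightarrow> nat) \<Rightarrow> (nat \<Rightarrow> complex) \<Rightarrow> real \<Rightarrow> complex mat" where
  "rotation n \<pi> s \<phi> = mat n n (\<lambda>(a, b).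
     (if a = b then if s b = 0 then 1 else of_real (cos \<phi>) else 0) + (if a = \<pi> b then of_real (sin \<phi>) * s b else 0))"

lemma rotation_carrier [simp]: "rotation n \<pi> s \<phi> \<in> carrier_mat n n"
  by (simp add: rotation_def)

lemma mult_rotation_index:
  assumes sk: "skew_pairing n \<pi> s" and M: "M \<in> carrier_mat m n" and ab: "a < m" "b < n"
  shows "(M * rotation n \<pi> s \<phi>) $$ (a, b) =
    M $$ (a, b) * (if s b = 0 then 1 else of_real (cos \<phi>)) + of_real (sin \<phi>) * s b * M $$ (a, \<pi> b)"
proof -
  have \<pi>: "\<pi> b < n" by (rule skew_pairingD(1)[OF sk ab(2)])
  have "(M * rotation n \<pi> s \<phi>) $$ (a, b) = (\<Sum>k<n. M $$ (a, k) * rotation n \<pi> s \<phi> $$ (k, b))"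
    by (rule mat_mult_index[OF M rotation_carrier ab])
  also have "\<dots> = (\<Sum>k<n. (if k = b then M $$ (a, b) * (if s b = 0 then 1 else of_real (cos \<phi>)) else 0) +
      (if k = \<pi> b then of_real (sin \<phi>) * s b * M $$ (a, \<pi> b) else 0))"
  proof (rule sum.cong[OF refl])
    fix k assume "k \<in> {..<n}"
    hence "M $$ (a, k) * rotation n \<pi> s \<phi> $$ (k, b) =
        M $$ (a, k) * (if k = b then if s b = 0 then 1 else of_real (cos \<phi>) else 0) +
        M $$ (a, k) * (if k = \<pi> b then of_real (sin \<phi>) * s b else 0)"
      using ab by (simp only: rotation_def index_mat lessThan_iff prod.case distrib_left)
    also have "\<dots> = (if k = b then M $$ (a, b) * (if s b = 0 then 1 else of_real (cos \<phi>)) else 0) +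
      (if k = \<pi> b then of_real (sin \<phi>) * s b * M $$ (a, \<pi> b) else 0)"
      by (intro arg_cong2[where f = "(+)"]) simp_all
    finally show "M $$ (a, k) * rotation n \<pi> s \<phi> $$ (k, b) =
      (if k = b then M $$ (a, b) * (if s b = 0 then 1 else of_real (cos \<phi>)) else 0) +
      (if k = \<pi> b then of_real (sin \<phi>) * s b * M $$ (a, \<pi> b) else 0)" .
  qed
  also have "\<dots> = M $$ (a, b) * (if s b = 0 then 1 else of_real (cos \<phi>)) + of_real (sin \<phi>) * s b * M $$ (a, \<pi> b)"
    using ab \<pi> by (simp add: sum.distrib)
  finally show ?thesis .
qed

lemma skew_pairing_zero_iff:
  assumes "skew_pairing n \<pi> s" "b < n"
  shows "s (\<pi> b) = 0 \<longleftrightarrow> s b = 0"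
  using skew_pairingD(3)[OF assms] by simp

lemma rotation_mult:
  assumes sk: "skew_pairing n \<pi> s"
  shows "rotation n \<pi> s \<phi> * rotation n \<pi> s \<psi> = rotation n \<pi> s (\<phi> + \<psi>)"
proof (rule eq_matI)
  fix a b assume "a < dim_row (rotation n \<pi> s (\<phi> + \<psi>))" "b < dim_col (rotation n \<pi> s (\<phi> + \<psi>))"
  hence ab: "a < n" "b < n" by (auto simp: rotation_def)
  note \<pi> = skew_pairingD(1,2,4)[OF sk ab(2)]
  note z = skew_pairing_zero_iff[OF sk ab(2)]
  show "(rotation n \<pi> s \<phi> * rotation n \<pi> s \<psi>) $$ (a, b) = rotation n \<pi> s (\<phi> + \<psi>) $$ (a, b)"
  proof (cases "s b = 0")
    case True
    thus ?thesis unfolding mult_rotation_index[OF sk rotation_carrier ab] using ab by (simp add: rotation_def)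
  next
    case False
    hence ss: "s (\<pi> b) * s b = - 1" using \<pi>(3) by simp
    let ?c = "\<lambda>x. complex_of_real (cos x)" and ?s = "\<lambda>x. complex_of_real (sin x)"
    let ?A = "if a = b then 1 else (0 :: complex)" and ?B = "if a = \<pi> b then 1 else (0 :: complex)"
    have r1: "rotation n \<pi> s x $$ (a, b) = ?c x * ?A + ?s x * s b * ?B" for x
      unfolding rotation_def index_mat(1)[OF ab] prod.case using False
      by (intro arg_cong2[where f = "(+)"]) simp_all
    have r2: "rotation n \<pi> s x $$ (a, \<pi> b) = ?c x * ?B + ?s x * s (\<pi> b) * ?A" for x
      unfolding rotation_def index_mat(1)[OF ab(1) \<pi>(1)] prod.case \<pi>(2) using False z
      by (intro arg_cong2[where f = "(+)"]) simp_all
    have "(rotation n \<pi> s \<phi> * rotation n \<pi> s \<psi>) $$ (a, b) =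
        (?c \<phi> * ?A + ?s \<phi> * s b * ?B) * ?c \<psi> + ?s \<psi> * s b * (?c \<phi> * ?B + ?s \<phi> * s (\<pi> b) * ?A)"
      unfolding mult_rotation_index[OF sk rotation_carrier ab] r1 r2 using False by simp
    also have "\<dots> = (?c \<phi> * ?c \<psi> + ?s \<phi> * ?s \<psi> * (s (\<pi> b) * s b)) * ?A +
        (?s \<phi> * ?c \<psi> + ?c \<phi> * ?s \<psi>) * s b * ?B"
      by (simp only: ring_distribs mult_ac add_ac)
    also have "\<dots> = rotation n \<pi> s (\<phi> + \<psi>) $$ (a, b)"
      unfolding r1 ss by (simp only: cos_add sin_add of_real_add of_real_diff of_real_mult) simp
    finally show ?thesis .
  qed
qed (auto simp: rotation_def)

lemma rotation_0: "rotation n \<pi> s 0 = 1\<^sub>m n"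
  by (intro eq_matI) (auto simp: rotation_def)

lemma rotation_adjoint:
  assumes sk: "skew_pairing n \<pi> s"
  shows "mat_adjoint (rotation n \<pi> s \<phi>) = rotation n \<pi> s (- \<phi>)"
proof (rule eq_matI)
  fix a b assume "a < dim_row (rotation n \<pi> s (- \<phi>))" "b < dim_col (rotation n \<pi> s (- \<phi>))"
  hence ab: "a < n" "b < n" by (auto simp: rotation_def)
  have iff: "b = \<pi> a \<longleftrightarrow> a = \<pi> b"
    using skew_pairingD(2)[OF sk ab(1)] skew_pairingD(2)[OF sk ab(2)] by metis
  have "cnj (if b = a then if s a = 0 then 1 else complex_of_real (cos \<phi>) else 0) =
      (if a = b then if s b = 0 then 1 else complex_of_real (cos (- \<phi>)) else 0)"
    by simp
  moreover have "cnj (if b = \<pi> a then complex_of_real (sin \<phi>) * s a else 0) =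
      (if a = \<pi> b then complex_of_real (sin (- \<phi>)) * s b else 0)"
  proof (cases "a = \<pi> b")
    case True
    have "s a = - cnj (s b)" using skew_pairingD(3)[OF sk ab(2)] by (simp only: True)
    thus ?thesis unfolding iff if_P[OF True] by simp
  next
    case False
    show ?thesis unfolding iff if_not_P[OF False] by simp
  qed
  ultimately show "mat_adjoint (rotation n \<pi> s \<phi>) $$ (a, b) = rotation n \<pi> s (- \<phi>) $$ (a, b)"
    unfolding mat_adjoint_index[OF rotation_carrier ab] unfolding rotation_def index_mat(1)[OF ab]
      index_mat(1)[OF ab(2,1)] prod.case complex_cnj_add by (rule arg_cong2)
qed (use carrier_matD[OF mat_adjoint_carrier[OF rotation_carrier[of n \<pi> s \<phi>]]] in \<open>simp_all add: rotation_def\<close>)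

lemma rotation_unitary:
  assumes sk: "skew_pairing n \<pi> s"
  shows "rotation n \<pi> s \<phi> \<in> unitary_group n"
  using rotation_mult[OF sk, of \<phi> "- \<phi>"] rotation_mult[OF sk, of "- \<phi>" \<phi>]
  by (simp add: unitary_group_def rotation_adjoint[OF sk] rotation_0)

text \<open>A rotation is the square of the rotation by half the angle, and a real unitary matrix has
  determinant \<open>\<plusminus>1\<close>.\<close>
lemma rotation_special_orthogonal:
  assumes sk: "skew_pairing n \<pi> s" and real: "\<And>b. b < n \<Longrightarrow> s b \<in> \<real>"
  shows "rotation n \<pi> s \<phi> \<in> special_orthogonal_group n"
proof (rule special_orthogonalI[OF rotation_unitary[OF sk]])
  have re: "rotation n \<pi> s \<psi> $$ (i, j) \<in> \<real>" if "i < n" "j < n" for i j \<psi>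
    unfolding rotation_def index_mat(1)[OF that] prod.case
    by (intro Reals_add) (simp_all add: real[OF that(2)])
  show "rotation n \<pi> s \<phi> $$ (i, j) \<in> \<real>" if "i < n" "j < n" for i j using re that .
  have "rotation n \<pi> s \<phi> = rotation n \<pi> s (\<phi> / 2) * rotation n \<pi> s (\<phi> / 2)"
    by (simp add: rotation_mult[OF sk])
  hence "Determinant.det (rotation n \<pi> s \<phi>) = Determinant.det (rotation n \<pi> s (\<phi> / 2)) * Determinant.det (rotation n \<pi> s (\<phi> / 2))"
    by (simp add: det_mult[of _ n])
  also have "\<dots> = 1" by (rule real_unitary_det_square[OF rotation_unitary[OF sk] re])
  finally show "Determinant.det (rotation n \<pi> s \<phi>) = 1" .
qed

lemma rotation_symplectic:
  assumes n: "n = 2 * m" and sk: "skew_pairing n \<pi> s"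
    and shift: "\<And>b. b < n \<Longrightarrow> \<pi> (half_shift m b) = half_shift m (\<pi> b)"
    and sign: "\<And>b. b < n \<Longrightarrow> half_sign m (\<pi> b) * s b = half_sign m b * cnj (s (half_shift m b))"
  shows "rotation n \<pi> s \<phi> \<in> symplectic_group n"
proof (rule symplecticI[OF n rotation_unitary[OF sk]])
  fix a b assume ab: "a < n" "b < n"
  have \<pi>: "\<pi> b < n" by (rule skew_pairingD(1)[OF sk ab(2)])
  have ab': "half_shift m a < n" "half_shift m b < n" using ab n half_shift_less by auto
  have 1: "half_shift m a = half_shift m b \<longleftrightarrow> a = b" using ab n by (simp add: half_shift_eq_iff)
  have 2: "half_shift m a = half_shift m (\<pi> b) \<longleftrightarrow> a = \<pi> b" using ab \<pi> n by (simp add: half_shift_eq_iff)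
  have "s (half_shift m b) = 0 \<longleftrightarrow> half_sign m b * cnj (s (half_shift m b)) = 0" by (simp add: half_sign_def)
  also have "\<dots> \<longleftrightarrow> s b = 0" unfolding sign[OF ab(2), symmetric] by (simp add: half_sign_def)
  finally have 3: "s (half_shift m b) = 0 \<longleftrightarrow> s b = 0" .
  let ?C = "if a = b then if s b = 0 then 1 else complex_of_real (cos \<phi>) else 0"
  let ?S = "complex_of_real (sin \<phi>)"
  have "half_sign m a * rotation n \<pi> s \<phi> $$ (a, b) =
      half_sign m a * ?C + (if a = \<pi> b then ?S * (half_sign m a * s b) else 0)"
    unfolding rotation_def index_mat(1)[OF ab] prod.case distrib_left
    by (intro arg_cong2[where f = "(+)"] refl) simp
  also have "half_sign m a * ?C = half_sign m b * ?C" by simp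
  also have "(if a = \<pi> b then ?S * (half_sign m a * s b) else 0) =
      (if a = \<pi> b then ?S * (half_sign m b * cnj (s (half_shift m b))) else 0)"
    using sign[OF ab(2)] by simp
  also have "half_sign m b * ?C + \<dots> =
      half_sign m b * cnj (rotation n \<pi> s \<phi> $$ (half_shift m a, half_shift m b))"
    unfolding rotation_def index_mat(1)[OF ab'] prod.case distrib_left complex_cnj_add shift[OF ab(2)] 1 2 3
    by (intro arg_cong2[where f = "(+)"]) simp_all
  finally show "half_sign m a * rotation n \<pi> s \<phi> $$ (a, b) =
     half_sign m b * cnj (rotation n \<pi> s \<phi> $$ (half_shift m a, half_shift m b))" .
qed

text \<open>The planes of a rotation, the same ones in every block of length \<open>m\<close> so that a
  symplectic rotation can treat both blocks alike. With \<open>c = 1\<close> there is a single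
  plane \<open>(0, d)\<close> in each block; with \<open>c = d\<close> the first
  \<open>d\<close> coordinates are mixed with the next \<open>d\<close>.\<close>
definition pair_perm :: "nat \<Rightarrow> nat \<Rightarrow> nat \<Rightarrow> nat \<Rightarrow> nat" where
  "pair_perm m c d b =
     (if b mod m < c \<and> b mod m + d < m then b + d
      else if d \<le> b mod m \<and> b mod m < d + c then b - d else b)"

definition pair_sign :: "nat \<Rightarrow> nat \<Rightarrow> nat \<Rightarrow> nat \<Rightarrow> complex" where
  "pair_sign m c d b =
     (if b mod m < c \<and> b mod m + d < m then 1
      else if d \<le> b mod m \<and> b mod m < d + c then - 1 else 0)"

lemma skew_pairing_pair:
  assumes cd: "1 \<le> c" "c \<le> d" and n: "n = m \<or> n = 2 * m"
  shows "skew_pairing n (pair_perm m c d) (pair_sign m c d)"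
  unfolding skew_pairing_def
proof (intro allI impI)
  fix b assume b: "b < n"
  obtain h r where hr: "h = 0 \<or> h = m" "b = h + r" "r < m"
  proof (cases "b < m")
    case True
    show ?thesis by (rule that[of 0 b]) (use True in simp_all)
  next
    case False
    show ?thesis by (rule that[of m "b - m"]) (use False b n in auto)
  qed
  have md: "(h + x) mod m = x" if "x < m" for x using hr(1) that by auto
  have hn: "h + x < n" if "x < m" for x using that b hr n by auto
  consider (low) "r < c" "r + d < m" | (high) "\<not> (r < c \<and> r + d < m)" "d \<le> r" "r < d + c"
    | (none) "\<not> (r < c \<and> r + d < m)" "\<not> (d \<le> r \<and> r < d + c)" by blast
  thus "pair_perm m c d b < n \<and> pair_perm m c d (pair_perm m c d b) = b \<and>
      pair_sign m c d (pair_perm m c d b) = - cnj (pair_sign m c d b) \<and>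
      (pair_sign m c d b = 0 \<or> pair_sign m c d (pair_perm m c d b) * pair_sign m c d b = - 1)"
  proof cases
    case low
    have p: "pair_perm m c d b = h + (r + d)" "pair_sign m c d b = 1"
      using low md[OF hr(3)] unfolding hr(2) by (auto simp: pair_perm_def pair_sign_def)
    have "pair_perm m c d (h + (r + d)) = h + r" "pair_sign m c d (h + (r + d)) = - 1"
      using low md[OF low(2)] cd by (auto simp: pair_perm_def pair_sign_def)
    thus ?thesis using p hn[OF low(2)] hr(2) by simp
  next
    case high
    have p: "pair_perm m c d b = h + (r - d)" "pair_sign m c d b = - 1"
      using high md[OF hr(3)] unfolding hr(2) by (auto simp: pair_perm_def pair_sign_def)
    have r': "r - d < m" "r - d < c" "r - d + d < m" using high hr by auto
    have "pair_perm m c d (h + (r - d)) = h + r" "pair_sign m c d (h + (r - d)) = 1"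
      using high r' md[OF r'(1)] by (auto simp: pair_perm_def pair_sign_def)
    thus ?thesis using p hn[OF r'(1)] hr(2) by simp
  next
    case none
    hence p: "pair_perm m c d b = b" "pair_sign m c d b = 0"
      using md[OF hr(3)] unfolding hr(2) by (auto simp: pair_perm_def pair_sign_def)
    thus ?thesis using b by simp
  qed
qed

lemma pair_rotation_special_orthogonal:
  assumes "1 \<le> c" "c \<le> d"
  shows "rotation n (pair_perm n c d) (pair_sign n c d) \<phi> \<in> special_orthogonal_group n"
  by (rule rotation_special_orthogonal[OF skew_pairing_pair[OF assms]]) (auto simp: pair_sign_def)

lemma pair_rotation_symplectic:
  assumes cd: "1 \<le> c" "c \<le> d" and n: "n = 2 * m"
  shows "rotation n (pair_perm m c d) (pair_sign m c d) \<phi> \<in> symplectic_group n"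
proof (rule rotation_symplectic[OF n skew_pairing_pair[OF cd]])
  fix b assume b: "b < n"
  have mod_shift: "half_shift m b mod m = b mod m"
    using mod_add_self1[of m "b - m"] by (cases "b < m") (simp_all add: half_shift_def)
  have s: "pair_sign m c d (half_shift m b) = pair_sign m c d b"
    by (simp add: pair_sign_def mod_shift)
  have p: "pair_perm m c d (half_shift m b) = half_shift m (pair_perm m c d b) \<and>
      half_sign m (pair_perm m c d b) = half_sign m b"
  proof (cases "b < m")
    case True
    thus ?thesis by (auto simp: pair_perm_def mod_shift half_sign_def) (auto simp: half_shift_def)
  next
    case False
    define r where "r = b - m"
    have bm: "b = m + r" using False by (simp add: r_def)
    have r: "r < m" using False b n by (simp add: bm)
    thus ?thesis
      unfolding bm by (auto simp: pair_perm_def mod_shift[unfolded bm] half_sign_def) (auto simp: half_shift_def)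
  qed
  show "pair_perm m c d (half_shift m b) = half_shift m (pair_perm m c d b)" by (rule conjunct1[OF p])
  show "half_sign m (pair_perm m c d b) * pair_sign m c d b =
      half_sign m b * cnj (pair_sign m c d (half_shift m b))"
    unfolding s conjunct2[OF p] by (simp add: pair_sign_def)
qed (use n in simp)

lemma form_rotation_symplectic:
  assumes n: "n = 2 * m"
  shows "skew_pairing n (half_shift m) (half_sign m)"
    and "rotation n (half_shift m) (half_sign m) \<phi> \<in> symplectic_group n"
proof -
  show sk: "skew_pairing n (half_shift m) (half_sign m)"
    unfolding skew_pairing_def
    using n by (simp add: half_shift_less half_shift_shift half_sign_shift cnj_half_sign half_sign_square)
  show "rotation n (half_shift m) (half_sign m) \<phi> \<in> symplectic_group n"
    by (rule rotation_symplectic[OF n sk]) (auto simp: n half_sign_shift cnj_half_sign)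
qed

text \<open>The generator of the torus \<open>diag(e\<^bsup>i\<phi>\<^esup>, 1, \<dots>;
  e\<^bsup>-i\<phi>\<^esup>, 1, \<dots>)\<close>.\<close>
definition phase_sign :: "nat \<Rightarrow> nat \<Rightarrow> complex" where
  "phase_sign m b = (if b = 0 then \<i> else if b = m then - \<i> else 0)"

lemma phase_rotation_symplectic:
  assumes n: "n = 2 * m" and m: "m \<ge> 1"
  shows "skew_pairing n (\<lambda>b. b) (phase_sign m)"
    and "rotation n (\<lambda>b. b) (phase_sign m) \<phi> \<in> symplectic_group n"
proof -
  show sk: "skew_pairing n (\<lambda>b. b) (phase_sign m)" by (auto simp: skew_pairing_def phase_sign_def)
  show "rotation n (\<lambda>b. b) (phase_sign m) \<phi> \<in> symplectic_group n"
    by (rule rotation_symplectic[OF n sk]) (use m n in \<open>auto simp: phase_sign_def half_shift_def\<close>)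
qed

section \<open>Small values along a rotation\<close>

lemma half_le_sin:
  assumes "0 \<le> x" "x \<le> (1 :: real)"
  shows "x / 2 \<le> sin x"
proof (cases "x = 0")
  case False
  have "\<exists>z>0. z < x \<and> sin x - sin 0 = (x - 0) * cos z"
    using assms False by (intro MVT2) (auto intro: derivative_eq_intros)
  then obtain z where z: "0 < z" "z < x" "sin x = x * cos z" by auto
  have "cos (pi / 3) \<le> cos z"
    using z assms pi_gt3 by (intro cos_monotone_0_pi_le) auto
  hence "1 / 2 \<le> cos z" by (simp add: cos_60)
  hence "x * (1 / 2) \<le> x * cos z" using assms(1) by (rule mult_left_mono)
  thus ?thesis using z by simp
qed simp

lemma half_abs_le_abs_sin:
  assumes "\<bar>x\<bar> \<le> (1 :: real)"
  shows "\<bar>x\<bar> / 2 \<le> \<bar>sin x\<bar>"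
  using half_le_sin[of x] half_le_sin[of "- x"] assms by (cases "x \<ge> 0") auto

text \<open>A function \<open>C + A cos + B sin\<close> that is small at three separated angles has small
  coefficients. Differences of two values eliminate \<open>C\<close> and leave \<open>A sin s -
  B cos s\<close> at the mean of the two angles; two such equations determine \<open>A\<close>
  and \<open>B\<close>. The angles \<open>k / q\<close> are radians in \<open>[0, 1)\<close>, so
  all the sines that occur in denominators are at least \<open>1 / (4 q)\<close>.\<close>
lemma three_small_values_bound_coefficients:
  fixes A B C :: complex and \<epsilon> :: real and q :: nat
  assumes q: "q \<ge> 1" and \<epsilon>: "\<epsilon> \<ge> 0"
    and card: "card {k. k < q \<and> 
      norm (C + complex_of_real (cos (real k / real q)) * A + complex_of_real (sin (real k / real q)) * B) \<le> \<epsilon>} > 2"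
  shows "norm A \<le> 100 * (real q)\<^sup>2 * \<epsilon>" "norm B \<le> 100 * (real q)\<^sup>2 * \<epsilon>" "norm (C + A) \<le> 100 * (real q)\<^sup>2 * \<epsilon>"
proof -
  define v where "v = (\<lambda>x. C + complex_of_real (cos x) * A + complex_of_real (sin x) * B)"
  let ?K = "{k. k < q \<and> norm (v (real k / real q)) \<le> \<epsilon>}"
  have "3 \<le> card ?K" using card by (simp add: v_def)
  then obtain T where T: "T \<subseteq> ?K" "card T = 3" by (rule obtain_subset_with_card_n)
  obtain k1 k2 k3 where T3: "T = {k1, k2, k3}" and ne: "k1 \<noteq> k2" "k2 \<noteq> k3" "k1 \<noteq> k3"
    using T(2) unfolding card_3_iff by blast
  define x y z where "x = real k1 / q" and "y = real k2 / q" and "z = real k3 / q"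
  have q0: "real q > 0" using q by simp
  have vs: "norm (v x) \<le> \<epsilon>" "norm (v y) \<le> \<epsilon>" "norm (v z) \<le> \<epsilon>"
    and kq: "k1 < q" "k2 < q" "k3 < q" using T T3 by (auto simp: x_def y_def z_def)
  have range: "0 \<le> x" "x \<le> 1" "0 \<le> y" "y \<le> 1" "0 \<le> z" "z \<le> 1"
    using kq q0 by (simp_all add: x_def y_def z_def)
  have sep: "1 / q \<le> \<bar>real i / q - real j / q\<bar>" if "i \<noteq> j" for i j :: nat
  proof -
    have "\<bar>real i / q - real j / q\<bar> = \<bar>real i - real j\<bar> / q" using q0 by (simp add: diff_divide_distrib[symmetric])
    moreover have "1 \<le> \<bar>real i - real j\<bar>" using that by linarith
    ultimately show ?thesis using q0 by (simp add: divide_right_mono)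
  qed
  have pair: "norm (complex_of_real (sin ((u + w) / 2)) * A - complex_of_real (cos ((u + w) / 2)) * B) \<le> 4 * q * \<epsilon>"
    if "norm (v u) \<le> \<epsilon>" "norm (v w) \<le> \<epsilon>" "1 / q \<le> \<bar>u - w\<bar>" "\<bar>u - w\<bar> \<le> 1" for u w :: real
  proof -
    let ?D = "complex_of_real (sin ((u + w) / 2)) * A - complex_of_real (cos ((u + w) / 2)) * B"
    have "v u - v w = complex_of_real (cos u - cos w) * A + complex_of_real (sin u - sin w) * B"
      by (simp add: v_def algebra_simps)
    also have "cos u - cos w = - 2 * sin ((u - w) / 2) * sin ((u + w) / 2)"
    proof -
      have "(w - u) / 2 = - ((u - w) / 2)" by (simp add: field_simps)
      hence "sin ((w - u) / 2) = - sin ((u - w) / 2)" by (simp only: sin_minus)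
      thus ?thesis by (subst cos_diff_cos) simp
    qed
    also have "sin u - sin w = 2 * sin ((u - w) / 2) * cos ((u + w) / 2)"
      by (rule sin_diff_sin)
    finally have "v u - v w = - 2 * complex_of_real (sin ((u - w) / 2)) * ?D" by (simp add: algebra_simps)
    hence "norm (v u - v w) = 2 * \<bar>sin ((u - w) / 2)\<bar> * norm ?D" by (simp add: norm_mult)
    moreover have "norm (v u - v w) \<le> 2 * \<epsilon>" using norm_triangle_ineq4[of "v u" "v w"] that by linarith
    moreover have "1 / (4 * q) \<le> \<bar>sin ((u - w) / 2)\<bar>"
      using half_abs_le_abs_sin[of "(u - w) / 2"] that(3,4) by (simp add: abs_divide)
    ultimately have "1 / (4 * q) * norm ?D \<le> \<epsilon>"
      using mult_right_mono[of "1 / (4 * real q)" "\<bar>sin ((u - w) / 2)\<bar>" "norm ?D"] by simp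
    hence "norm ?D / (4 * real q) \<le> \<epsilon>" by simp
    thus ?thesis using q0 by (simp only: pos_divide_le_eq) (simp add: mult_ac)
  qed
  define s t where "s = (x + y) / 2" and "t = (x + z) / 2"
  define D where "D = (\<lambda>s. complex_of_real (sin s) * A - complex_of_real (cos s) * B)"
  have Ds: "norm (D s) \<le> 4 * q * \<epsilon>" unfolding D_def s_def
    using pair[OF vs(1,2)] sep[OF ne(1)] range unfolding x_def[symmetric] y_def[symmetric] by auto
  have Dt: "norm (D t) \<le> 4 * q * \<epsilon>" unfolding D_def t_def
    using pair[OF vs(1,3)] sep[OF ne(3)] range unfolding x_def[symmetric] z_def[symmetric] by auto
  have "1 / q \<le> \<bar>y - z\<bar>" unfolding y_def z_def by (rule sep[OF ne(2)])
  moreover have "\<bar>y - z\<bar> \<le> 1" using range by linarith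
  moreover have st: "s - t = (y - z) / 2" by (simp add: s_def t_def field_simps)
  ultimately have sst: "1 / (4 * q) \<le> \<bar>sin (s - t)\<bar>"
    using half_abs_le_abs_sin[of "s - t"] \<open>\<bar>y - z\<bar> \<le> 1\<close> by (simp add: st abs_divide)
  have solve: "norm E \<le> 32 * (real q)\<^sup>2 * \<epsilon>"
    if "complex_of_real (sin (s - t)) * E = complex_of_real a * D s - complex_of_real b * D t" "\<bar>a\<bar> \<le> 1" "\<bar>b\<bar> \<le> 1" for E a b
  proof -
    have "\<bar>sin (s - t)\<bar> * norm E = norm (complex_of_real a * D s - complex_of_real b * D t)"
      unfolding that(1)[symmetric] by (simp add: norm_mult)
    also have "\<dots> \<le> \<bar>a\<bar> * norm (D s) + \<bar>b\<bar> * norm (D t)"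
      by (rule order_trans[OF norm_triangle_ineq4]) (simp add: norm_mult)
    also have "\<dots> \<le> 1 * (4 * q * \<epsilon>) + 1 * (4 * q * \<epsilon>)"
      using that(2,3) Ds Dt by (intro add_mono mult_mono) simp_all
    finally have "\<bar>sin (s - t)\<bar> * norm E \<le> 8 * q * \<epsilon>" by (simp add: mult_ac)
    hence "1 / (4 * q) * norm E \<le> 8 * q * \<epsilon>"
      by (rule order_trans[OF mult_right_mono[OF sst norm_ge_zero]])
    hence "norm E / (4 * real q) \<le> 8 * q * \<epsilon>" by simp
    thus ?thesis using q0 by (simp only: pos_divide_le_eq) (simp add: power2_eq_square mult_ac)
  qed
  have A: "norm A \<le> 32 * (real q)\<^sup>2 * \<epsilon>"
    by (rule solve[of _ "cos t" "cos s"]) (simp_all add: D_def sin_diff right_diff_distrib left_diff_distrib mult_ac)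
  have B: "norm B \<le> 32 * (real q)\<^sup>2 * \<epsilon>"
    by (rule solve[of _ "sin t" "sin s"]) (simp_all add: D_def sin_diff right_diff_distrib left_diff_distrib mult_ac)
  have "1 \<le> (real q)\<^sup>2" using q by simp
  hence q2: "\<epsilon> \<le> (real q)\<^sup>2 * \<epsilon>" using mult_right_mono[of 1 "(real q)\<^sup>2" \<epsilon>] \<epsilon> by simp
  have "C + A = v x + complex_of_real (1 - cos x) * A - complex_of_real (sin x) * B" by (simp add: v_def algebra_simps)
  hence "norm (C + A) \<le> norm (v x) + norm (complex_of_real (1 - cos x) * A) + norm (complex_of_real (sin x) * B)"
    using norm_triangle_ineq4[of "v x + complex_of_real (1 - cos x) * A" "complex_of_real (sin x) * B"]
      norm_triangle_ineq[of "v x" "complex_of_real (1 - cos x) * A"] by simp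
  also have "norm (complex_of_real (1 - cos x) * A) \<le> 1 * norm A"
  proof -
    have "0 \<le> cos x" using range pi_gt3 by (intro cos_ge_zero) linarith+
    hence "\<bar>1 - cos x\<bar> \<le> 1" using cos_le_one[of x] by linarith
    thus ?thesis unfolding norm_mult norm_of_real by (intro mult_right_mono) simp_all
  qed
  also have "norm (complex_of_real (sin x) * B) \<le> 1 * norm B"
    unfolding norm_mult norm_of_real by (intro mult_right_mono) auto
  finally show "norm (C + A) \<le> 100 * (real q)\<^sup>2 * \<epsilon>" using vs(1) A B q2 \<epsilon> by (simp add: algebra_simps)
  show "norm A \<le> 100 * (real q)\<^sup>2 * \<epsilon>" "norm B \<le> 100 * (real q)\<^sup>2 * \<epsilon>" using A B \<epsilon> q2 by (simp_all add: algebra_simps)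
qed

text \<open>Along a rotation any sum of entries at most one per column is a trigonometric polynomial of
  degree one in the angle.\<close>
lemma partial_trace_mult_rotation:
  assumes sk: "skew_pairing n \<pi> s" and X: "X \<in> carrier_mat n n" and S: "S \<subseteq> {..<n}" and r: "r ` S \<subseteq> {..<n}"
  shows "(\<Sum>i\<in>S. (X * rotation n \<pi> s \<phi>) $$ (r i, i)) =
    (\<Sum>i\<in>S. if s i = 0 then X $$ (r i, i) else 0) +
    complex_of_real (cos \<phi>) * (\<Sum>i\<in>S. if s i = 0 then 0 else X $$ (r i, i)) +
    complex_of_real (sin \<phi>) * (\<Sum>i\<in>S. s i * X $$ (r i, \<pi> i))"
proof -
  have "(\<Sum>i\<in>S. (X * rotation n \<pi> s \<phi>) $$ (r i, i)) =
      (\<Sum>i\<in>S. (if s i = 0 then X $$ (r i, i) else 0) +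
        complex_of_real (cos \<phi>) * (if s i = 0 then 0 else X $$ (r i, i)) + complex_of_real (sin \<phi>) * (s i * X $$ (r i, \<pi> i)))"
  proof (rule sum.cong[OF refl])
    fix i assume "i \<in> S"
    hence i: "r i < n" "i < n" using S r by auto
    show "(X * rotation n \<pi> s \<phi>) $$ (r i, i) = (if s i = 0 then X $$ (r i, i) else 0) +
        complex_of_real (cos \<phi>) * (if s i = 0 then 0 else X $$ (r i, i)) + complex_of_real (sin \<phi>) * (s i * X $$ (r i, \<pi> i))"
      unfolding mult_rotation_index[OF sk X i] by (cases "s i = 0") (simp_all add: mult_ac)
  qed
  thus ?thesis by (simp add: sum.distrib sum_distrib_left)
qed

section \<open>Measurability of matrix entries\<close>

lemma entry_measurable:
  assumes "i < n" "j < n"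
  shows "(\<lambda>A. A $$ (i, j)) \<in> borel_measurable (mat_borel n G)"
proof -
  let ?I = "{..<n} \<times> {..<n}"
  have "(\<lambda>A. \<lambda>ij\<in>?I. A $$ ij) \<in> mat_borel n G \<rightarrow>\<^sub>M (\<Pi>\<^sub>M ij\<in>?I. (borel :: complex measure))"
    unfolding mat_borel_def by (rule measurable_vimage_algebra1) (auto simp: space_PiM)
  from measurable_compose[OF this measurable_component_singleton[of "(i, j)" ?I]] assms
  show ?thesis by simp
qed

lemma space_mat_borel [simp]: "space (mat_borel n G) = G"
  by (simp add: mat_borel_def)

lemma into_mat_borel_measurable:
  assumes "\<And>x. x \<in> space M \<Longrightarrow> f x \<in> G"
    and "\<And>i j. i < n \<Longrightarrow> j < n \<Longrightarrow> (\<lambda>x. f x $$ (i, j)) \<in> borel_measurable M"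
  shows "f \<in> M \<rightarrow>\<^sub>M mat_borel n G"
  unfolding mat_borel_def
proof (rule measurable_vimage_algebra2)
  show "f \<in> space M \<rightarrow> G" using assms(1) by auto
  show "(\<lambda>x. \<lambda>ij\<in>{..<n} \<times> {..<n}. f x $$ ij) \<in> M \<rightarrow>\<^sub>M (\<Pi>\<^sub>M ij\<in>{..<n} \<times> {..<n}. (borel :: complex measure))"
    by (rule measurable_restrict) (use assms(2) in auto)
qed

lemma mult_right_measurable:
  assumes G: "G \<in> classical_groups n" and h: "h \<in> G"
  shows "(\<lambda>X. X * h) \<in> mat_borel n G \<rightarrow>\<^sub>M mat_borel n G"
proof (rule into_mat_borel_measurable)
  show "X * h \<in> G" if "X \<in> space (mat_borel n G)" for X
    using classical_group_mult[OF G _ h] that by simp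
  have car: "X \<in> carrier_mat n n" if "X \<in> G" for X
    using classical_group_subset_unitary[OF G] that unitary_groupD(1) by blast
  fix i j assume ij: "i < n" "j < n"
  have "(\<lambda>X. \<Sum>k<n. X $$ (i, k) * h $$ (k, j)) \<in> borel_measurable (mat_borel n G)"
    by (intro borel_measurable_sum borel_measurable_times entry_measurable ij borel_measurable_const) simp
  moreover have "(X * h) $$ (i, j) = (\<Sum>k<n. X $$ (i, k) * h $$ (k, j))" if "X \<in> space (mat_borel n G)" for X
    using that car h ij by (intro mat_mult_index) auto
  ultimately show "(\<lambda>X. (X * h) $$ (i, j)) \<in> borel_measurable (mat_borel n G)"
    by (subst measurable_cong) auto
qed

lemma pow_entry_measurable:
  assumes car: "G \<subseteq> carrier_mat n n" and ij: "i < n" "j < n"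
  shows "(\<lambda>X. (X ^\<^sub>m k) $$ (i, j)) \<in> borel_measurable (mat_borel n G)"
  using ij
proof (induction k arbitrary: i j)
  case 0
  have "(X ^\<^sub>m 0) $$ (i, j) = (if i = j then 1 else 0)" if "X \<in> space (mat_borel n G)" for X
  proof -
    have "X \<in> carrier_mat n n" using that car by (simp add: subset_iff)
    thus ?thesis using 0 by simp
  qed
  thus ?case by (subst measurable_cong) auto
next
  case (Suc k)
  have "(\<lambda>X. \<Sum>l<n. (X ^\<^sub>m k) $$ (i, l) * X $$ (l, j)) \<in> borel_measurable (mat_borel n G)"
    by (intro borel_measurable_sum borel_measurable_times entry_measurable Suc) simp_all
  moreover have "(X ^\<^sub>m Suc k) $$ (i, j) = (\<Sum>l<n. (X ^\<^sub>m k) $$ (i, l) * X $$ (l, j))" if "X \<in> space (mat_borel n G)" for X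
  proof -
    have "X \<in> carrier_mat n n" using that car by auto
    thus ?thesis unfolding pow_mat.simps using Suc.prems by (intro mat_mult_index pow_carrier_mat) auto
  qed
  ultimately show ?case by (subst measurable_cong) auto
qed

lemma trace_pow_measurable:
  assumes car: "G \<subseteq> carrier_mat n n"
  shows "(\<lambda>X. mat_trace (X ^\<^sub>m k)) \<in> borel_measurable (mat_borel n G)"
proof -
  have "(\<lambda>X. \<Sum>i<n. (X ^\<^sub>m k) $$ (i, i)) \<in> borel_measurable (mat_borel n G)"
    by (intro borel_measurable_sum pow_entry_measurable[OF car]) simp_all
  moreover have "mat_trace (X ^\<^sub>m k) = (\<Sum>i<n. (X ^\<^sub>m k) $$ (i, i))" if "X \<in> space (mat_borel n G)" for X
    using that car by (auto simp: mat_trace_def)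
  ultimately show ?thesis by (subst measurable_cong) auto
qed

section \<open>Haar measure: the trace is rarely small\<close>

definition partial_trace :: "nat set \<Rightarrow> (nat \<Rightarrow> nat) \<Rightarrow> complex mat \<Rightarrow> complex" where
  "partial_trace S r X = (\<Sum>i\<in>S. X $$ (r i, i))"

definition top_row_entries :: "nat \<Rightarrow> (nat set \<times> (nat \<Rightarrow> nat)) set" where
  "top_row_entries k = (\<lambda>i. ({i}, \<lambda>_. 0)) ` {..<k}"

locale haar_classical = prob_space \<nu> for \<nu> :: "complex mat measure" +
  fixes n :: nat and G :: "complex mat set"
  assumes classical: "G \<in> classical_groups n" and haar: "haar_prob_measure n G \<nu>"
begin

lemma space_nu [simp]: "space \<nu> = G"
  and sets_nu: "sets \<nu> = sets (mat_borel n G)"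
  using haar by (simp_all add: haar_prob_measure_def)

lemma borel_measurable_nu: "borel_measurable \<nu> = borel_measurable (mat_borel n G)"
  by (rule measurable_cong_sets[OF sets_nu refl])

lemma group_unitary: "X \<in> G \<Longrightarrow> X \<in> unitary_group n"
  using classical_group_subset_unitary[OF classical] by blast

lemma group_carrier: "X \<in> G \<Longrightarrow> X \<in> carrier_mat n n"
  using group_unitary unitary_groupD(1) by blast

lemma mult_right_measurable_nu: "h \<in> G \<Longrightarrow> (\<lambda>X. X * h) \<in> \<nu> \<rightarrow>\<^sub>M \<nu>"
  using mult_right_measurable[OF classical] measurable_cong_sets[OF sets_nu sets_nu] by simp

lemma distr_mult_right: "h \<in> G \<Longrightarrow> distr \<nu> \<nu> (\<lambda>X. X * h) = \<nu>"
  using haar by (simp add: haar_prob_measure_def)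

lemma prob_mult_right:
  assumes h: "h \<in> G" and B: "B \<in> sets \<nu>"
  shows "prob {X \<in> G. X * h \<in> B} = prob B"
proof -
  have "prob B = measure (distr \<nu> \<nu> (\<lambda>X. X * h)) B" by (simp only: distr_mult_right[OF h])
  also have "\<dots> = prob ((\<lambda>X. X * h) -` B \<inter> space \<nu>)"
    by (rule measure_distr[OF mult_right_measurable_nu[OF h] B])
  also have "(\<lambda>X. X * h) -` B \<inter> space \<nu> = {X \<in> G. X * h \<in> B}" by auto
  finally show ?thesis ..
qed

lemma mult_right_preimage_sets:
  assumes h: "h \<in> G" and B: "B \<in> sets \<nu>"
  shows "{X \<in> G. X * h \<in> B} \<in> sets \<nu>"
proof -
  have "(\<lambda>X. X * h) -` B \<inter> space \<nu> = {X \<in> G. X * h \<in> B}" by auto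
  thus ?thesis using measurable_sets[OF mult_right_measurable_nu[OF h] B] by simp
qed

text \<open>By invariance \<open>q\<close> times the probability of \<open>A\<close> is the expected number
  of the \<open>q\<close> translates of a random matrix that fall into \<open>A\<close>. Off
  \<open>A'\<close> there are at most two.\<close>
lemma prob_le_of_few_translates:
  fixes q :: nat
  assumes A: "A \<in> sets \<nu>" and A': "A' \<in> sets \<nu>" and q: "q \<ge> 1" and h: "\<And>k. k < q \<Longrightarrow> h k \<in> G"
    and few: "\<And>X. X \<in> G \<Longrightarrow> X \<notin> A' \<Longrightarrow> card {k. k < q \<and> X * h k \<in> A} \<le> 2"
  shows "prob A \<le> prob A' + 2 / q"
proof -
  let ?B = "\<lambda>k. {X \<in> G. X * h k \<in> A}"
  have B: "?B k \<in> sets \<nu>" if "k < q" for k by (rule mult_right_preimage_sets[OF h[OF that] A])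
  have intB: "integrable \<nu> (indicator (?B k) :: _ \<Rightarrow> real)" if "k < q" for k
    using B[OF that] by (simp add: emeasure_eq_measure)
  have intA': "integrable \<nu> (indicator A' :: _ \<Rightarrow> real)" using A' by (simp add: emeasure_eq_measure)
  have "q * prob A = (\<Sum>k<q. prob (?B k))" by (simp add: prob_mult_right[OF h A])
  also have "\<dots> = (\<Sum>k<q. \<integral>X. indicator (?B k) X \<partial>\<nu>)"
  proof (rule sum.cong[OF refl])
    fix k assume "k \<in> {..<q}"
    have "?B k \<inter> G = ?B k" by blast
    thus "prob (?B k) = (\<integral>X. indicator (?B k) X \<partial>\<nu>)" by simp
  qed
  also have "\<dots> = (\<integral>X. (\<Sum>k<q. indicator (?B k) X) \<partial>\<nu>)"
    using intB by (intro Bochner_Integration.integral_sum[symmetric]) simp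
  also have "\<dots> \<le> (\<integral>X. real q * indicator A' X + 2 \<partial>\<nu>)"
  proof (rule integral_mono)
    show "integrable \<nu> (\<lambda>X. \<Sum>k<q. indicator (?B k) X :: real)"
      using intB by (intro Bochner_Integration.integrable_sum) simp
    show "integrable \<nu> (\<lambda>X. real q * indicator A' X + 2)"
      using intA' by (intro Bochner_Integration.integrable_add integrable_mult_right) simp_all
    fix X assume X: "X \<in> space \<nu>"
    have "(\<Sum>k<q. indicator (?B k) X :: real) = (\<Sum>k<q. of_bool (X * h k \<in> A))"
      using X by (intro sum.cong refl) (simp add: indicator_def)
    also have "\<dots> = card ({..<q} \<inter> {k. X * h k \<in> A})" by (simp add: sum_of_bool_eq)
    also have "{..<q} \<inter> {k. X * h k \<in> A} = {k. k < q \<and> X * h k \<in> A}" by auto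
    also have "real (card {k. k < q \<and> X * h k \<in> A}) \<le> real q * indicator A' X + 2"
    proof (cases "X \<in> A'")
      case True
      have "card {k. k < q \<and> X * h k \<in> A} \<le> card {..<q}" by (intro card_mono) auto
      thus ?thesis using True by simp
    next
      case False
      thus ?thesis using few[of X] X by simp
    qed
    finally show "(\<Sum>k<q. indicator (?B k) X :: real) \<le> real q * indicator A' X + 2" .
  qed
  also have "\<dots> = q * prob A' + 2"
  proof -
    have "A' \<inter> G = A'" using sets.sets_into_space[OF A'] by auto
    thus ?thesis using intA' prob_space by (subst Bochner_Integration.integral_add) simp_all
  qed
  finally have "q * prob A \<le> q * (prob A' + 2 / q)" using q by (simp add: distrib_left)
  thus ?thesis using q by simp
qed

definition small :: "(nat set \<times> (nat \<Rightarrow> nat)) set \<Rightarrow> real \<Rightarrow> complex mat set" where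
  "small F \<epsilon> = {X \<in> G. \<forall>(S, r)\<in>F. norm (partial_trace S r X) \<le> \<epsilon>}"

lemma small_sets:
  assumes fin: "finite F" and F: "\<And>S r. (S, r) \<in> F \<Longrightarrow> S \<subseteq> {..<n} \<and> r ` S \<subseteq> {..<n}"
  shows "small F \<epsilon> \<in> sets \<nu>"
proof -
  have "{X \<in> space \<nu>. norm (partial_trace (fst p) (snd p) X) \<le> \<epsilon>} \<in> sets \<nu>" if "p \<in> F" for p
  proof -
    have "fst p \<subseteq> {..<n} \<and> snd p ` fst p \<subseteq> {..<n}" using F[of "fst p" "snd p"] that by simp
    hence "(\<lambda>X. partial_trace (fst p) (snd p) X) \<in> borel_measurable \<nu>"
      unfolding partial_trace_def borel_measurable_nu by (intro borel_measurable_sum entry_measurable) blast+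
    hence "(\<lambda>X. norm (partial_trace (fst p) (snd p) X)) \<in> borel_measurable \<nu>" by measurable
    thus ?thesis by (intro borel_measurable_le borel_measurable_const)
  qed
  hence "{X \<in> space \<nu>. \<forall>p\<in>F. norm (partial_trace (fst p) (snd p) X) \<le> \<epsilon>} \<in> sets \<nu>"
    using fin by (intro sets.sets_Collect_finite_All)
  also have "{X \<in> space \<nu>. \<forall>p\<in>F. norm (partial_trace (fst p) (snd p) X) \<le> \<epsilon>} = small F \<epsilon>"
    by (simp add: small_def case_prod_beta)
  finally show ?thesis .
qed

text \<open>The step that is iterated below: at the cost of a probability \<open>2 / q\<close> and a factor
  \<open>100 q\<^sup>2\<close>, smallness of some sums of entries passes to the coefficients of
  these sums along a rotation.\<close>
lemma prob_small_rotation: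
  fixes q :: nat and \<epsilon> \<epsilon>' :: real
  assumes sk: "skew_pairing n \<pi> s" and rot: "\<And>\<phi>. rotation n \<pi> s \<phi> \<in> G"
    and F: "finite F" "\<And>S r. (S, r) \<in> F \<Longrightarrow> S \<subseteq> {..<n} \<and> r ` S \<subseteq> {..<n}"
    and F': "finite F'" "\<And>S r. (S, r) \<in> F' \<Longrightarrow> S \<subseteq> {..<n} \<and> r ` S \<subseteq> {..<n}"
    and q: "q \<ge> 1" and \<epsilon>: "\<epsilon> \<ge> 0"
    and imp: "\<And>X. X \<in> G \<Longrightarrow> (\<And>S r. (S, r) \<in> F \<Longrightarrow> norm (partial_trace S r X) \<le> 100 * (real q)\<^sup>2 * \<epsilon>) \<Longrightarrow>
        (\<And>S r. (S, r) \<in> F \<Longrightarrow> norm (\<Sum>i\<in>S. if s i = 0 then 0 else X $$ (r i, i)) \<le> 100 * (real q)\<^sup>2 * \<epsilon>) \<Longrightarrow>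
        (\<And>S r. (S, r) \<in> F \<Longrightarrow> norm (\<Sum>i\<in>S. s i * X $$ (r i, \<pi> i)) \<le> 100 * (real q)\<^sup>2 * \<epsilon>) \<Longrightarrow>
        X \<in> small F' \<epsilon>'"
  shows "prob (small F \<epsilon>) \<le> prob (small F' \<epsilon>') + 2 / q"
proof (rule prob_le_of_few_translates[where h = "\<lambda>k. rotation n \<pi> s (real k / real q)"])
  show "small F \<epsilon> \<in> sets \<nu>" by (rule small_sets[OF F])
  show "small F' \<epsilon>' \<in> sets \<nu>" by (rule small_sets[OF F'])
  show "q \<ge> 1" by (rule q)
  show "rotation n \<pi> s (real k / real q) \<in> G" for k by (rule rot)
  fix X assume X: "X \<in> G" and notin: "X \<notin> small F' \<epsilon>'"
  let ?K = "{k. k < q \<and> X * rotation n \<pi> s (real k / real q) \<in> small F \<epsilon>}"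
  show "card ?K \<le> 2"
  proof (rule ccontr)
    assume "\<not> card ?K \<le> 2"
    hence K: "card ?K > 2" by simp
    have bounds: "norm (\<Sum>i\<in>S. if s i = 0 then 0 else X $$ (r i, i)) \<le> 100 * (real q)\<^sup>2 * \<epsilon> \<and>
        norm (\<Sum>i\<in>S. s i * X $$ (r i, \<pi> i)) \<le> 100 * (real q)\<^sup>2 * \<epsilon> \<and> norm (partial_trace S r X) \<le> 100 * (real q)\<^sup>2 * \<epsilon>"
      if Sr: "(S, r) \<in> F" for S r
    proof -
      define A where "A = (\<Sum>i\<in>S. if s i = 0 then 0 else X $$ (r i, i))"
      define B where "B = (\<Sum>i\<in>S. s i * X $$ (r i, \<pi> i))"
      define C where "C = (\<Sum>i\<in>S. if s i = 0 then X $$ (r i, i) else 0)"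
      have S: "S \<subseteq> {..<n}" "r ` S \<subseteq> {..<n}" using F(2)[OF Sr] by auto
      have eq: "partial_trace S r (X * rotation n \<pi> s \<phi>) =
          C + complex_of_real (cos \<phi>) * A + complex_of_real (sin \<phi>) * B" for \<phi>
        unfolding partial_trace_def A_def B_def C_def
        by (rule partial_trace_mult_rotation[OF sk group_carrier[OF X] S])
      have "?K \<subseteq> {k. k < q \<and> norm (C + complex_of_real (cos (real k / real q)) * A + complex_of_real (sin (real k / real q)) * B) \<le> \<epsilon>}"
        using Sr unfolding small_def by (auto simp: eq[symmetric])
      hence "card ?K \<le> card {k. k < q \<and> norm (C + complex_of_real (cos (real k / real q)) * A + complex_of_real (sin (real k / real q)) * B) \<le> \<epsilon>}"
        by (intro card_mono) simp_all
      with K have "card {k. k < q \<and> norm (C + complex_of_real (cos (real k / real q)) * A + complex_of_real (sin (real k / real q)) * B) \<le> \<epsilon>} > 2"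
        by linarith
      note b = three_small_values_bound_coefficients[OF q \<epsilon> this]
      have "partial_trace S r X = C + A"
        unfolding partial_trace_def A_def C_def sum.distrib[symmetric] by (rule sum.cong[OF refl]) simp
      thus ?thesis using b by (simp add: A_def B_def)
    qed
    have "X \<in> small F' \<epsilon>'" by (rule imp[OF X]) (blast dest: bounds)+
    with notin show False by simp
  qed
qed

lemma finite_top_row_entries: "finite (top_row_entries k)"
  by (simp add: top_row_entries_def)

lemma top_row_entries_range:
  assumes "k \<le> n" "(S, r) \<in> top_row_entries k"
  shows "S \<subseteq> {..<n} \<and> r ` S \<subseteq> {..<n}"
  using assms by (auto simp: top_row_entries_def)

lemma small_top_row_iff: "X \<in> small (top_row_entries k) \<epsilon> \<longleftrightarrow> X \<in> G \<and> (\<forall>i<k. norm (X $$ (0, i)) \<le> \<epsilon>)"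
  by (auto simp: small_def top_row_entries_def partial_trace_def)

lemma top_row_entries_partial_trace:
  "(S, r) \<in> top_row_entries k \<longleftrightarrow> (\<exists>i<k. S = {i} \<and> r = (\<lambda>_. 0))"
  by (auto simp: top_row_entries_def)

text \<open>Rotating the first \<open>d\<close> columns into the next \<open>d\<close> doubles the number of
  small entries in the top row. Since the number of small entries doubles, about \<open>log
  n\<close> steps reach the whole row, and the factors lost on the way multiply to far less than
  an exponential in \<open>n\<close>.\<close>
lemma prob_small_top_row_double:
  fixes q :: nat and \<epsilon> :: real
  assumes N: "n = N \<or> n = 2 * N" and d: "d \<ge> 1" and q: "q \<ge> 1" and \<epsilon>: "\<epsilon> \<ge> 0"
    and rot: "\<And>\<phi>. rotation n (pair_perm N d d) (pair_sign N d d) \<phi> \<in> G"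
  shows "prob (small (top_row_entries (min d N)) \<epsilon>) \<le>
    prob (small (top_row_entries (min (2 * d) N)) (100 * (real q)\<^sup>2 * \<epsilon>)) + 2 / q"
proof (rule prob_small_rotation[OF skew_pairing_pair[OF d order.refl N] rot finite_top_row_entries _ finite_top_row_entries _ q \<epsilon>])
  have "N \<le> n" using N by auto
  thus "S \<subseteq> {..<n} \<and> r ` S \<subseteq> {..<n}" if "(S, r) \<in> top_row_entries (min d N)" for S r
    using top_row_entries_range[OF _ that] by simp
  show "S \<subseteq> {..<n} \<and> r ` S \<subseteq> {..<n}" if "(S, r) \<in> top_row_entries (min (2 * d) N)" for S r
    using top_row_entries_range[OF _ that] \<open>N \<le> n\<close> by simp
  fix X assume X: "X \<in> G"
    and old: "\<And>S r. (S, r) \<in> top_row_entries (min d N) \<Longrightarrow> norm (partial_trace S r X) \<le> 100 * (real q)\<^sup>2 * \<epsilon>"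
    and new: "\<And>S r. (S, r) \<in> top_row_entries (min d N) \<Longrightarrow>
      norm (\<Sum>i\<in>S. pair_sign N d d i * X $$ (r i, pair_perm N d d i)) \<le> 100 * (real q)\<^sup>2 * \<epsilon>"
  have "norm (X $$ (0, i)) \<le> 100 * (real q)\<^sup>2 * \<epsilon>" if i: "i < min (2 * d) N" for i
  proof (cases "i < d")
    case True
    hence "({i}, \<lambda>_. 0) \<in> top_row_entries (min d N)" using i by (simp add: top_row_entries_partial_trace)
    from old[OF this] show ?thesis by (simp add: partial_trace_def)
  next
    case False
    define j where "j = i - d"
    have j: "j < d" "j + d < N" "i = j + d" using False i by (auto simp: j_def)
    hence "({j}, \<lambda>_. 0) \<in> top_row_entries (min d N)" by (simp add: top_row_entries_partial_trace)
    moreover have "pair_sign N d d j = 1" "pair_perm N d d j = j + d" using j by (simp_all add: pair_sign_def pair_perm_def)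
    ultimately show ?thesis using new[of "{j}" "\<lambda>_. 0"] j(3) by simp
  qed
  thus "X \<in> small (top_row_entries (min (2 * d) N)) (100 * (real q)\<^sup>2 * \<epsilon>)" using X by (simp add: small_top_row_iff)
qed

lemma prob_small_top_row_power:
  fixes q :: nat and \<epsilon> :: real
  assumes N: "n = N \<or> n = 2 * N" and q: "q \<ge> 1" and \<epsilon>: "\<epsilon> \<ge> 0"
    and rot: "\<And>d \<phi>. d \<ge> 1 \<Longrightarrow> rotation n (pair_perm N d d) (pair_sign N d d) \<phi> \<in> G"
  shows "prob (small (top_row_entries (min 1 N)) \<epsilon>) \<le>
    prob (small (top_row_entries (min (2 ^ L) N)) ((100 * (real q)\<^sup>2) ^ L * \<epsilon>)) + L * (2 / q)"
proof (induction L)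
  case (Suc L)
  have "prob (small (top_row_entries (min (2 ^ L) N)) ((100 * (real q)\<^sup>2) ^ L * \<epsilon>)) \<le>
      prob (small (top_row_entries (min (2 * 2 ^ L) N)) (100 * (real q)\<^sup>2 * ((100 * (real q)\<^sup>2) ^ L * \<epsilon>))) + 2 / q"
    by (rule prob_small_top_row_double[OF N _ q _ rot]) (use \<epsilon> in simp_all)
  with Suc.IH have "prob (small (top_row_entries (min 1 N)) \<epsilon>) \<le>
      prob (small (top_row_entries (min (2 * 2 ^ L) N)) (100 * (real q)\<^sup>2 * ((100 * (real q)\<^sup>2) ^ L * \<epsilon>))) + (L * (2 / q) + 2 / q)"
    by linarith
  also have "real L * (2 / q) + 2 / q = real (Suc L) * (2 / q)"
    by (simp only: of_nat_Suc distrib_right mult_1 add.commute)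
  finally show ?case by (simp only: power_Suc mult.assoc)
qed simp

text \<open>A row of a unitary matrix has norm 1.\<close>
lemma small_top_row_empty:
  fixes \<epsilon> :: real
  assumes n: "n \<ge> 1" and \<epsilon>: "\<epsilon> \<ge> 0" "n * \<epsilon> < 1"
  shows "small (top_row_entries n) \<epsilon> = {}"
proof (rule ccontr)
  assume "small (top_row_entries n) \<epsilon> \<noteq> {}"
  then obtain X where X: "X \<in> G" and le: "\<And>i. i < n \<Longrightarrow> norm (X $$ (0, i)) \<le> \<epsilon>"
    unfolding small_top_row_iff[symmetric] by (metis ex_in_conv small_top_row_iff)
  have "\<epsilon> \<le> 1"
  proof -
    have "1 * \<epsilon> \<le> n * \<epsilon>" using n \<epsilon>(1) by (intro mult_right_mono) simp_all
    thus ?thesis using \<epsilon>(2) by linarith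
  qed
  have "(\<Sum>k<n. X $$ (0, k) * cnj (X $$ (0, k))) = 1"
    using unitary_groupD(2)[OF group_unitary[OF X], of 0 0] n by simp
  hence "complex_of_real (\<Sum>k<n. (norm (X $$ (0, k)))\<^sup>2) = 1"
    by (simp only: complex_norm_square of_real_sum)
  hence "1 = (\<Sum>k<n. (norm (X $$ (0, k)))\<^sup>2)" by (simp only: of_real_eq_1_iff)
  also have "\<dots> \<le> (\<Sum>k<n. \<epsilon>)"
  proof (rule sum_mono)
    fix k assume "k \<in> {..<n}"
    hence "(norm (X $$ (0, k)))\<^sup>2 \<le> \<epsilon>\<^sup>2" using le[of k] by (intro power_mono) simp_all
    also have "\<dots> \<le> \<epsilon>" using \<epsilon>(1) \<open>\<epsilon> \<le> 1\<close> by (simp add: power2_eq_square mult_left_le)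
    finally show "(norm (X $$ (0, k)))\<^sup>2 \<le> \<epsilon>" .
  qed
  also have "\<dots> = n * \<epsilon>" by simp
  finally show False using \<epsilon>(2) by simp
qed

lemma small_trace_eq: "small {({..<n}, \<lambda>i. i)} \<epsilon> = {X \<in> G. norm (mat_trace X) \<le> \<epsilon>}"
  using group_carrier by (auto simp: small_def partial_trace_def mat_trace_def)

text \<open>In the orthogonal case the rotations in the planes \<open>(0, 1)\<close> and \<open>(0,
  2)\<close> lead from the trace to \<open>X\<^sub>0\<^sub>0 + X\<^sub>1\<^sub>1\<close> and
  then to \<open>X\<^sub>0\<^sub>0\<close>; in the symplectic case a torus reaches
  \<open>X\<^sub>0\<^sub>0\<close> at once. Doubling then exhausts the top row, or in the
  symplectic case its first half, and the rotations generated by the symplectic form itself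
  carry this over to the second half.\<close>
lemma prob_small_trace_le:
  fixes q L :: nat and \<epsilon> :: real
  assumes n: "n \<ge> 3" and L: "n \<le> 2 ^ L" and q: "q \<ge> 1" and \<epsilon>: "\<epsilon> \<ge> 0"
    and tiny: "n * ((100 * (real q)\<^sup>2) ^ (L + 2) * \<epsilon>) < 1"
  shows "prob {X \<in> G. norm (mat_trace X) \<le> \<epsilon>} \<le> (L + 2) * (2 / q)"
proof -
  let ?Q = "100 * (real q)\<^sup>2" and ?T = "{({..<n}, \<lambda>i. i)} :: (nat set \<times> (nat \<Rightarrow> nat)) set"
  have T: "finite ?T" "\<And>S r. (S, r) \<in> ?T \<Longrightarrow> S \<subseteq> {..<n} \<and> r ` S \<subseteq> {..<n}" by auto
  have rows: "(S, r) \<in> top_row_entries k \<Longrightarrow> S \<subseteq> {..<n} \<and> r ` S \<subseteq> {..<n}" if "k \<le> n" for S r k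
    using top_row_entries_range[OF that] .
  have Q\<epsilon>: "?Q ^ j * \<epsilon> \<ge> 0" for j using \<epsilon> by simp
  from classical have "prob (small ?T \<epsilon>) \<le> (L + 2) * (2 / q)"
  proof (cases rule: classical_group_cases)
    case orthogonal
    have rot: "rotation n (pair_perm n c d) (pair_sign n c d) \<phi> \<in> G" if "1 \<le> c" "c \<le> d" for c d \<phi>
      using pair_rotation_special_orthogonal[OF that] orthogonal by blast
    let ?E = "{({0, 1}, \<lambda>i. i)} :: (nat set \<times> (nat \<Rightarrow> nat)) set"
    have E: "finite ?E" "\<And>S r. (S, r) \<in> ?E \<Longrightarrow> S \<subseteq> {..<n} \<and> r ` S \<subseteq> {..<n}" using n by auto
    have "prob (small ?T \<epsilon>) \<le> prob (small ?E (?Q * \<epsilon>)) + 2 / q"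
    proof (rule prob_small_rotation[OF skew_pairing_pair[of 1 1] rot T E q \<epsilon>])
      fix X assume X: "X \<in> G" and b: "\<And>S r. (S, r) \<in> ?T \<Longrightarrow>
        norm (\<Sum>i\<in>S. if pair_sign n 1 1 i = 0 then 0 else X $$ (r i, i)) \<le> ?Q * \<epsilon>"
      have "(\<Sum>i<n. if pair_sign n 1 1 i = 0 then 0 else X $$ (i, i)) = (\<Sum>i\<in>{0, 1}. X $$ (i, i))"
        using n by (intro sum.mono_neutral_cong_right) (auto simp: pair_sign_def)
      thus "X \<in> small ?E (?Q * \<epsilon>)" using X b[of "{..<n}" "\<lambda>i. i"] by (simp add: small_def partial_trace_def)
    qed simp_all
    also have "prob (small ?E (?Q * \<epsilon>)) \<le> prob (small (top_row_entries (min 1 n)) (?Q * (?Q * \<epsilon>))) + 2 / q"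
    proof (rule prob_small_rotation[OF skew_pairing_pair[of 1 2] rot E finite_top_row_entries _ q])
      show "S \<subseteq> {..<n} \<and> r ` S \<subseteq> {..<n}" if "(S, r) \<in> top_row_entries (min 1 n)" for S r
        using rows[OF _ that] n by simp
      fix X assume X: "X \<in> G" and b: "\<And>S r. (S, r) \<in> ?E \<Longrightarrow>
        norm (\<Sum>i\<in>S. if pair_sign n 1 2 i = 0 then 0 else X $$ (r i, i)) \<le> ?Q * (?Q * \<epsilon>)"
      have "pair_sign n 1 2 0 \<noteq> 0" "pair_sign n 1 2 1 = 0" using n by (simp_all add: pair_sign_def)
      hence "norm (X $$ (0, 0)) \<le> ?Q * (?Q * \<epsilon>)" using b[of "{0, 1}" "\<lambda>i. i"] by simp
      thus "X \<in> small (top_row_entries (min 1 n)) (?Q * (?Q * \<epsilon>))"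
        using X n by (simp add: small_top_row_iff)
    qed (use \<epsilon> in simp_all)
    also have "prob (small (top_row_entries (min 1 n)) (?Q * (?Q * \<epsilon>))) \<le>
        prob (small (top_row_entries (min (2 ^ L) n)) (?Q ^ L * (?Q * (?Q * \<epsilon>)))) + L * (2 / q)"
      by (rule prob_small_top_row_power[OF _ q _ rot]) (use \<epsilon> in simp_all)
    also have "?Q ^ L * (?Q * (?Q * \<epsilon>)) = ?Q ^ (L + 2) * \<epsilon>" by (simp add: power_add power2_eq_square)
    also have "min (2 ^ L) n = n" using L by simp
    also have "small (top_row_entries n) (?Q ^ (L + 2) * \<epsilon>) = {}"
      by (rule small_top_row_empty[OF _ Q\<epsilon> tiny]) (use n in simp)
    finally show ?thesis by (simp add: algebra_simps add_divide_distrib)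
  next
    case symplectic
    define m where "m = n div 2"
    have nm: "n = 2 * m" using symplectic(1) by (simp add: m_def)
    have m: "m \<ge> 1" using n nm by simp
    have "prob (small ?T \<epsilon>) \<le> prob (small (top_row_entries (min 1 m)) (?Q * \<epsilon>)) + 2 / q"
    proof (rule prob_small_rotation[OF phase_rotation_symplectic(1)[OF nm m] _ T finite_top_row_entries _ q \<epsilon>])
      show "rotation n (\<lambda>b. b) (phase_sign m) \<phi> \<in> G" for \<phi>
        unfolding symplectic(2) by (rule phase_rotation_symplectic(2)[OF nm m])
      show "S \<subseteq> {..<n} \<and> r ` S \<subseteq> {..<n}" if "(S, r) \<in> top_row_entries (min 1 m)" for S r
        using rows[OF _ that] n by simp
      fix X assume X: "X \<in> G"
        and b1: "\<And>S r. (S, r) \<in> ?T \<Longrightarrow> norm (\<Sum>i\<in>S. if phase_sign m i = 0 then 0 else X $$ (r i, i)) \<le> ?Q * \<epsilon>"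
        and b2: "\<And>S r. (S, r) \<in> ?T \<Longrightarrow> norm (\<Sum>i\<in>S. phase_sign m i * X $$ (r i, i)) \<le> ?Q * \<epsilon>"
      let ?x = "X $$ (0, 0)" and ?y = "X $$ (m, m)"
      have sub: "{0, m} \<subseteq> {..<n}" using nm m by auto
      have "(\<Sum>i<n. if phase_sign m i = 0 then 0 else X $$ (i, i)) = (\<Sum>i\<in>{0, m}. X $$ (i, i))"
        by (rule sum.mono_neutral_cong_right) (use sub in \<open>auto simp: phase_sign_def\<close>)
      hence x1: "norm (?x + ?y) \<le> ?Q * \<epsilon>" using b1[of "{..<n}" "\<lambda>i. i"] m by simp
      have "(\<Sum>i<n. phase_sign m i * X $$ (i, i)) = (\<Sum>i\<in>{0, m}. phase_sign m i * X $$ (i, i))"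
        by (rule sum.mono_neutral_right) (use sub in \<open>auto simp: phase_sign_def\<close>)
      also have "\<dots> = \<i> * (?x - ?y)" using m by (simp add: phase_sign_def algebra_simps)
      finally have x2: "norm (?x - ?y) \<le> ?Q * \<epsilon>" using b2[of "{..<n}" "\<lambda>i. i"] by (simp add: norm_mult)
      have "?x = ((?x + ?y) + (?x - ?y)) / 2" by simp
      hence "norm ?x = norm ((?x + ?y) + (?x - ?y)) / 2" by (metis norm_divide norm_numeral)
      also have "\<dots> \<le> (?Q * \<epsilon> + ?Q * \<epsilon>) / 2"
        by (intro divide_right_mono order_trans[OF norm_triangle_ineq] add_mono x1 x2) simp
      finally have "norm ?x \<le> ?Q * \<epsilon>" by (simp add: mult_ac)
      thus "X \<in> small (top_row_entries (min 1 m)) (?Q * \<epsilon>)" using X m by (simp add: small_top_row_iff)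
    qed
    also have "prob (small (top_row_entries (min 1 m)) (?Q * \<epsilon>)) \<le>
        prob (small (top_row_entries (min (2 ^ L) m)) (?Q ^ L * (?Q * \<epsilon>))) + L * (2 / q)"
      by (rule prob_small_top_row_power[OF _ q])
        (use \<epsilon> nm symplectic(2) pair_rotation_symplectic[OF _ order.refl nm] in simp_all)
    also have "min (2 ^ L) m = m" using L nm by simp
    also have "?Q ^ L * (?Q * \<epsilon>) = ?Q ^ (L + 1) * \<epsilon>" by simp
    also have "prob (small (top_row_entries m) (?Q ^ (L + 1) * \<epsilon>)) \<le>
        prob (small (top_row_entries n) (?Q * (?Q ^ (L + 1) * \<epsilon>))) + 2 / q"
    proof (rule prob_small_rotation[OF form_rotation_symplectic(1)[OF nm] _ finite_top_row_entries _ finite_top_row_entries _ q Q\<epsilon>])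
      show "rotation n (half_shift m) (half_sign m) \<phi> \<in> G" for \<phi>
        unfolding symplectic(2) by (rule form_rotation_symplectic(2)[OF nm])
      show "S \<subseteq> {..<n} \<and> r ` S \<subseteq> {..<n}" if "(S, r) \<in> top_row_entries m" for S r
        using rows[OF _ that] nm by simp
      show "S \<subseteq> {..<n} \<and> r ` S \<subseteq> {..<n}" if "(S, r) \<in> top_row_entries n" for S r
        using rows[OF _ that] by simp
      fix X assume X: "X \<in> G"
        and old: "\<And>S r. (S, r) \<in> top_row_entries m \<Longrightarrow> norm (partial_trace S r X) \<le> ?Q * (?Q ^ (L + 1) * \<epsilon>)"
        and new: "\<And>S r. (S, r) \<in> top_row_entries m \<Longrightarrow>
          norm (\<Sum>i\<in>S. half_sign m i * X $$ (r i, half_shift m i)) \<le> ?Q * (?Q ^ (L + 1) * \<epsilon>)"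
      have "norm (X $$ (0, i)) \<le> ?Q * (?Q ^ (L + 1) * \<epsilon>)" if i: "i < n" for i
      proof (cases "i < m")
        case True
        hence "({i}, \<lambda>_. 0) \<in> top_row_entries m" by (simp add: top_row_entries_partial_trace)
        from old[OF this] show ?thesis by (simp add: partial_trace_def)
      next
        case False
        define j where "j = i - m"
        have j: "j < m" "i = j + m" using False i nm by (simp_all add: j_def)
        hence "({j}, \<lambda>_. 0) \<in> top_row_entries m" by (simp add: top_row_entries_partial_trace)
        moreover have "half_sign m j = - 1" "half_shift m j = j + m" using j(1) by (simp_all add: half_sign_def half_shift_def)
        ultimately show ?thesis using new[of "{j}" "\<lambda>_. 0"] j(2) by simp
      qed
      thus "X \<in> small (top_row_entries n) (?Q * (?Q ^ (L + 1) * \<epsilon>))" using X by (simp add: small_top_row_iff)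
    qed
    also have "?Q * (?Q ^ (L + 1) * \<epsilon>) = ?Q ^ (L + 2) * \<epsilon>" by simp
    also have "small (top_row_entries n) (?Q ^ (L + 2) * \<epsilon>) = {}"
      by (rule small_top_row_empty[OF _ Q\<epsilon> tiny]) (use n in simp)
    finally show ?thesis by (simp add: algebra_simps add_divide_distrib)
  qed
  thus ?thesis by (simp only: small_trace_eq)
qed

section \<open>Haar measure: traces of powers are rarely large\<close>

lemma integral_mult_right:
  fixes g :: "complex mat \<Rightarrow> real"
  assumes h: "h \<in> G" and g: "g \<in> borel_measurable \<nu>"
  shows "(\<integral>X. g (X * h) \<partial>\<nu>) = (\<integral>X. g X \<partial>\<nu>)"
proof -
  have "(\<integral>X. g X \<partial>\<nu>) = (\<integral>X. g X \<partial>(distr \<nu> \<nu> (\<lambda>X. X * h)))" by (simp only: distr_mult_right[OF h])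
  also have "\<dots> = (\<integral>X. g (X * h) \<partial>\<nu>)" by (rule integral_distr[OF mult_right_measurable_nu[OF h] g])
  finally show ?thesis ..
qed

text \<open>Invariance allows replacing \<open>\<bar>tr X\<^sup>k\<bar>\<^sup>2\<close> by its mean over the
  doubled permutations, which is bounded for each matrix separately; then Markov's inequality.\<close>
lemma prob_large_trace_power_le:
  fixes t C :: real
  assumes t: "t > 0"
    and C: "\<And>M. M \<in> unitary_group n \<Longrightarrow>
       (\<Sum>\<sigma> | \<sigma> permutes {..<n div 2}.
          (norm (mat_trace ((M * monomial_mat n (double_perm (n div 2) \<sigma>) (\<lambda>_. 1)) ^\<^sub>m k)))\<^sup>2)
         \<le> C * fact (n div 2)"
  shows "prob {X \<in> G. t \<le> norm (mat_trace (X ^\<^sub>m k))} \<le> C / t\<^sup>2"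
proof -
  define m where "m = n div 2"
  define g where "g = (\<lambda>X. (norm (mat_trace (X ^\<^sub>m k)))\<^sup>2)"
  let ?H = "{\<sigma>. \<sigma> permutes {..<m}}" and ?h = "\<lambda>\<sigma>. monomial_mat n (double_perm m \<sigma>) (\<lambda>_. 1)"
  have h: "?h \<sigma> \<in> G" if "\<sigma> \<in> ?H" for \<sigma>
    using double_perm_in_classical_group[OF classical] that by (simp add: m_def)
  have "G \<subseteq> carrier_mat n n" using group_carrier by blast
  hence "(\<lambda>X. mat_trace (X ^\<^sub>m k)) \<in> borel_measurable \<nu>"
    unfolding borel_measurable_nu by (rule trace_pow_measurable)
  hence meas: "g \<in> borel_measurable \<nu>"
    unfolding g_def by measurable
  have bound: "norm (g X) \<le> (real n)\<^sup>2" if X: "X \<in> G" for X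
  proof -
    have "norm (mat_trace (X ^\<^sub>m k)) \<le> size (proots (char_poly X))"
      unfolding trace_pow_eq_power_sum[OF group_carrier[OF X]]
      by (rule norm_power_sum_le) (use unitary_eigenvalue_norm[OF group_unitary[OF X]] in simp)
    also have "\<dots> = n" using degree_monic_char_poly[OF group_carrier[OF X]] by (simp add: size_proots_complex)
    finally have "(norm (mat_trace (X ^\<^sub>m k)))\<^sup>2 \<le> (real n)\<^sup>2" by (intro power_mono) simp_all
    thus ?thesis by (simp add: g_def)
  qed
  have int: "integrable \<nu> g"
    by (rule integrable_const_bound[OF AE_I2 meas]) (rule bound, simp)
  have inth: "integrable \<nu> (\<lambda>X. g (X * ?h \<sigma>))" if "\<sigma> \<in> ?H" for \<sigma>
  proof (rule integrable_const_bound)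
    show "AE X in \<nu>. norm (g (X * ?h \<sigma>)) \<le> (real n)\<^sup>2"
      by (rule AE_I2) (simp only: space_nu bound classical_group_mult[OF classical _ h[OF that]])
    show "(\<lambda>X. g (X * ?h \<sigma>)) \<in> borel_measurable \<nu>"
      by (rule measurable_compose[OF mult_right_measurable_nu[OF h[OF that]] meas])
  qed
  have card: "card ?H = fact m" using card_permutations[of "{..<m}" m] by simp
  have "fact m * (\<integral>X. g X \<partial>\<nu>) = (\<Sum>\<sigma>\<in>?H. \<integral>X. g (X * ?h \<sigma>) \<partial>\<nu>)"
    by (simp add: integral_mult_right[OF h meas] card)
  also have "\<dots> = (\<integral>X. (\<Sum>\<sigma>\<in>?H. g (X * ?h \<sigma>)) \<partial>\<nu>)"
    using inth by (intro Bochner_Integration.integral_sum[symmetric])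
  also have "\<dots> \<le> (\<integral>X. C * fact m \<partial>\<nu>)"
  proof (rule integral_mono)
    show "integrable \<nu> (\<lambda>X. \<Sum>\<sigma>\<in>?H. g (X * ?h \<sigma>))" using inth by (intro Bochner_Integration.integrable_sum)
    show "(\<Sum>\<sigma>\<in>?H. g (X * ?h \<sigma>)) \<le> C * fact m" if "X \<in> space \<nu>" for X
      unfolding g_def m_def by (rule C[OF group_unitary]) (use that in simp)
  qed simp
  also have "\<dots> = fact m * C" using prob_space by simp
  finally have le: "(\<integral>X. g X \<partial>\<nu>) \<le> C" by simp
  have "{X \<in> G. t \<le> norm (mat_trace (X ^\<^sub>m k))} = {X \<in> space \<nu>. t\<^sup>2 \<le> g X}"
    using t by (simp add: g_def)
  also have "prob \<dots> \<le> (\<integral>X. g X \<partial>\<nu>) / t\<^sup>2"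
    by (rule integral_Markov_inequality_measure[OF int sets.empty_sets]) (use t in \<open>simp_all add: g_def\<close>)
  also have "\<dots> \<le> C / t\<^sup>2" using le t by (intro divide_right_mono) simp_all
  finally show ?thesis .
qed

end

section \<open>Convergence in probability\<close>

lemma haar_classicalI:
  assumes "G \<in> classical_groups n" "haar_prob_measure n G \<nu>"
  shows "haar_classical \<nu> n G"
  using assms by (simp add: haar_classical_def haar_classical_axioms_def haar_prob_measure_def)

lemma derivative_root_measure_close:
  fixes f :: "complex \<Rightarrow> real"
  assumes cont: "continuous_on UNIV f" and e: "e > 0"
  shows "\<exists>(K :: nat) (\<delta> :: real). \<delta> > 0 \<and>
    (\<forall>n A. n \<ge> 2 \<longrightarrow> A \<in> unitary_group n \<longrightarrow> n * exp (- \<delta> * n) < norm (mat_trace A) \<longrightarrow>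
       (\<forall>k\<in>{1..K}. norm (mat_trace (A ^\<^sub>m k)) < \<delta> * n) \<longrightarrow> 2 ^ K \<le> \<delta> * n \<longrightarrow>
       \<bar>integral\<^sup>L (derivative_root_measure A) f - integral\<^sup>L uniform_circle f\<bar> \<le> e)"
proof -
  obtain K :: nat and \<delta> :: real where \<delta>: "\<delta> > 0" and close:
    "\<forall>p. degree p \<ge> 2 \<longrightarrow> lead_coeff p = 1 \<longrightarrow> (\<forall>x\<in>#proots p. norm x = 1) \<longrightarrow>
       power_sum (proots p) 1 \<noteq> 0 \<longrightarrow>
       ln (degree p / norm (power_sum (proots p) 1)) \<le> \<delta> * degree p \<longrightarrow>
       (\<forall>k\<in>{1..K}. norm (power_sum (proots p) k) \<le> \<delta> * degree p) \<longrightarrow>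
       2 ^ K \<le> \<delta> * degree p \<longrightarrow>
       \<bar>integral\<^sup>L (root_measure (pderiv p)) f - integral\<^sup>L uniform_circle f\<bar> \<le> e"
    using critical_points_equidistribute[OF cont e] by (elim exE conjE)
  show ?thesis
  proof (rule exI[of _ K], rule exI[of _ \<delta>], intro conjI allI impI)
    show "\<delta> > 0" by (rule \<delta>)
    fix n :: nat and A :: "complex mat"
    assume n: "n \<ge> 2" and U: "A \<in> unitary_group n" and tr: "n * exp (- \<delta> * n) < norm (mat_trace A)"
      and pow: "\<forall>k\<in>{1..K}. norm (mat_trace (A ^\<^sub>m k)) < \<delta> * n" and big: "2 ^ K \<le> \<delta> * n"
    have A: "A \<in> carrier_mat n n" by (rule unitary_groupD(1)[OF U])
    have deg: "degree (char_poly A) = n" and monic: "lead_coeff (char_poly A) = 1"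
      using degree_monic_char_poly[OF A] by simp_all
    have T: "mat_trace (A ^\<^sub>m k) = power_sum (proots (char_poly A)) k" for k
      by (rule trace_pow_eq_power_sum[OF A])
    have "A ^\<^sub>m 1 = A" using A by simp
    hence T1: "mat_trace A = power_sum (proots (char_poly A)) 1" using T[of 1] by simp
    have pos: "0 < n * exp (- \<delta> * n)" using n by simp
    hence tr0: "0 < norm (mat_trace A)" using tr by linarith
    have "n / norm (mat_trace A) \<le> exp (\<delta> * n)"
    proof -
      have "real n = n * exp (- \<delta> * n) * exp (\<delta> * n)" by (simp add: mult.assoc exp_minus_inverse flip: exp_add)
      also have "\<dots> \<le> norm (mat_trace A) * exp (\<delta> * n)" using tr by (intro mult_right_mono) simp_all
      finally show ?thesis using tr0 by (simp add: pos_divide_le_eq mult.commute)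
    qed
    hence "ln (n / norm (mat_trace A)) \<le> ln (exp (\<delta> * n))"
      using tr0 n by (subst ln_le_cancel_iff) simp_all
    hence ln: "ln (n / norm (mat_trace A)) \<le> \<delta> * n" by simp
    have circ: "norm x = 1" if "x \<in># proots (char_poly A)" for x by (rule unitary_eigenvalue_norm[OF U that])
    have "\<bar>integral\<^sup>L (root_measure (pderiv (char_poly A))) f - integral\<^sup>L uniform_circle f\<bar> \<le> e"
    proof (rule close[rule_format])
      show "degree (char_poly A) \<ge> 2" using n deg by simp
      show "lead_coeff (char_poly A) = 1" by (rule monic)
      show "norm x = 1" if "x \<in># proots (char_poly A)" for x by (rule circ[OF that])
      show "power_sum (proots (char_poly A)) 1 \<noteq> 0" using tr0 T1 by simp
      show "ln (degree (char_poly A) / norm (power_sum (proots (char_poly A)) 1)) \<le> \<delta> * degree (char_poly A)"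
        using ln by (simp only: T1 deg)
      show "norm (power_sum (proots (char_poly A)) k) \<le> \<delta> * degree (char_poly A)" if "k \<in> {1..K}" for k
        using less_imp_le[OF bspec[OF pow that]] by (simp only: T deg)
      show "2 ^ K \<le> \<delta> * degree (char_poly A)" using big by (simp only: deg)
    qed
    thus "\<bar>integral\<^sup>L (derivative_root_measure A) f - integral\<^sup>L uniform_circle f\<bar> \<le> e"
      by (simp only: derivative_root_measure_def)
  qed
qed

text \<open>With \<open>q = n\<close> angles and \<open>L \<approx> log n\<close> steps the total factor
  \<open>(100 n\<^sup>2)\<^bsup>L+2\<^esup>\<close> is \<open>exp (O(log\<^sup>2 n))\<close>,
  which loses against \<open>exp (- \<delta> n)\<close>, while the exceptional probability is
  \<open>O(log n / n)\<close>.\<close>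
lemma eventually_small_trace_unlikely:
  assumes \<delta>: "\<delta> > (0 :: real)"
  shows "\<exists>(u :: nat \<Rightarrow> real) N. u \<longlonglongrightarrow> 0 \<and> (\<forall>n G \<nu>. n \<ge> N \<longrightarrow> haar_classical \<nu> n G \<longrightarrow>
       measure \<nu> {X \<in> G. norm (mat_trace X) \<le> n * exp (- \<delta> * n)} \<le> u n)"
proof -
  define u where "u = (\<lambda>n::nat. (log 2 n + 3) * (2 / n))"
  have lim: "u \<longlonglongrightarrow> 0" unfolding u_def by real_asymp
  have "eventually (\<lambda>n::nat. 2 * ln n + (log 2 n + 3) * ln (100 * (real n)\<^sup>2) < \<delta> * n) sequentially"
    using \<delta> by real_asymp
  then obtain N0 where N0: "\<And>n. n \<ge> N0 \<Longrightarrow> 2 * ln (real n) + (log 2 n + 3) * ln (100 * (real n)\<^sup>2) < \<delta> * n"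
    unfolding eventually_sequentially by blast
  show ?thesis
  proof (rule exI[of _ u], rule exI[of _ "max 3 N0"], intro conjI allI impI)
    show "u \<longlonglongrightarrow> 0" by (rule lim)
    fix n :: nat and G \<nu>
    assume n: "n \<ge> max 3 N0" and "haar_classical \<nu> n G"
    then interpret haar_classical \<nu> n G by simp
    have n3: "n \<ge> 3" using n by simp
    define L where "L = nat \<lceil>log 2 n\<rceil>"
    have log0: "0 \<le> log 2 (real n)" using n3 by simp
    have L: "real L = of_int \<lceil>log 2 n\<rceil>" using log0 by (simp add: L_def)
    have Lge: "log 2 n \<le> L" and Lle: "L \<le> log 2 n + 1" unfolding L by linarith+
    have "real n = 2 powr log 2 n" using n3 by simp
    also have "\<dots> \<le> 2 powr L" using Lge by (intro powr_mono) simp_all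
    also have "\<dots> = real (2 ^ L)" by (simp add: powr_realpow)
    finally have nL: "n \<le> 2 ^ L" by (simp only: of_nat_le_iff)
    let ?Q = "100 * (real n)\<^sup>2"
    have Q1: "?Q \<ge> 1"
    proof -
      have "1 \<le> (real n)\<^sup>2" using n3 by simp
      thus ?thesis by simp
    qed
    have lnQ: "ln ?Q \<ge> 0" using Q1 by (rule ln_ge_zero)
    have Qpow: "?Q ^ (L + 2) = exp (real (L + 2) * ln ?Q)"
    proof -
      have "exp (ln ?Q) = ?Q" using n3 by simp
      thus ?thesis by (simp only: exp_of_nat_mult)
    qed
    have "n * (?Q ^ (L + 2) * (n * exp (- \<delta> * n))) =
        exp (ln n) * (exp (real (L + 2) * ln ?Q) * (exp (ln n) * exp (- \<delta> * n)))"
      unfolding Qpow using n3 by simp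
    also have "\<dots> = exp (ln n + real (L + 2) * ln ?Q + ln n - \<delta> * n)"
      unfolding exp_add[symmetric] by (rule arg_cong[where f = exp]) simp
    also have "\<dots> < exp 0"
    proof (subst exp_less_cancel_iff)
      have "(real L + 2) * ln ?Q \<le> (log 2 n + 3) * ln ?Q" using Lle lnQ by (intro mult_right_mono) linarith+
      moreover have "2 * ln (real n) + (log 2 n + 3) * ln ?Q < \<delta> * n" using n by (intro N0) simp
      moreover have "real (L + 2) = real L + 2" by simp
      ultimately show "ln n + real (L + 2) * ln ?Q + ln n - \<delta> * n < 0" by (simp only:)
    qed
    finally have tiny: "n * (?Q ^ (L + 2) * (n * exp (- \<delta> * n))) < 1" by simp
    have "prob {X \<in> G. norm (mat_trace X) \<le> n * exp (- \<delta> * n)} \<le> (L + 2) * (2 / n)"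
      by (rule prob_small_trace_le[OF n3 nL _ _ tiny]) (use n3 in simp_all)
    also have "\<dots> \<le> u n"
      unfolding u_def using Lle by (intro mult_right_mono) simp_all
    finally show "prob {X \<in> G. norm (mat_trace X) \<le> n * exp (- \<delta> * n)} \<le> u n" .
  qed
qed

lemma eventually_large_trace_powers_unlikely:
  assumes \<delta>: "\<delta> > (0 :: real)"
  shows "\<exists>u :: nat \<Rightarrow> real. u \<longlonglongrightarrow> 0 \<and> (\<forall>n G \<nu>. n \<ge> 1 \<longrightarrow> haar_classical \<nu> n G \<longrightarrow>
       (\<Sum>k=1..K. measure \<nu> {X \<in> G. \<delta> * n \<le> norm (mat_trace (X ^\<^sub>m k))}) \<le> u n)"
proof -
  have "\<exists>C>0. \<forall>n M. M \<in> unitary_group n \<longrightarrow>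
       (\<Sum>\<sigma> | \<sigma> permutes {..<n div 2}.
          (norm (mat_trace ((M * monomial_mat n (double_perm (n div 2) \<sigma>) (\<lambda>_. 1)) ^\<^sub>m k)))\<^sup>2)
         \<le> C * fact (n div 2)" if "k \<ge> 1" for k
    using averaged_trace_power_bound[OF that] by metis
  then obtain C :: "nat \<Rightarrow> real" where C: "\<And>k n M. k \<ge> 1 \<Longrightarrow> M \<in> unitary_group n \<Longrightarrow>
       (\<Sum>\<sigma> | \<sigma> permutes {..<n div 2}.
          (norm (mat_trace ((M * monomial_mat n (double_perm (n div 2) \<sigma>) (\<lambda>_. 1)) ^\<^sub>m k)))\<^sup>2)
         \<le> C k * fact (n div 2)" by metis
  define D where "D = (\<Sum>k=1..K. C k)"
  have "(\<lambda>n. D / (\<delta> * real n)\<^sup>2) = (\<lambda>n. D / \<delta>\<^sup>2 * (1 / (real n)\<^sup>2))"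
    by (simp add: power_mult_distrib)
  moreover have "(\<lambda>n::nat. D / \<delta>\<^sup>2 * (1 / (real n)\<^sup>2)) \<longlonglongrightarrow> D / \<delta>\<^sup>2 * 0"
    by (intro tendsto_mult tendsto_const) real_asymp
  ultimately have lim: "(\<lambda>n. D / (\<delta> * real n)\<^sup>2) \<longlonglongrightarrow> 0" by simp
  show ?thesis
  proof (rule exI[of _ "\<lambda>n. D / (\<delta> * real n)\<^sup>2"], intro conjI allI impI)
    show "(\<lambda>n. D / (\<delta> * real n)\<^sup>2) \<longlonglongrightarrow> 0" by (rule lim)
    fix n :: nat and G \<nu>
    assume n: "n \<ge> 1" and "haar_classical \<nu> n G"
    then interpret haar_classical \<nu> n G by simp
    have pos: "\<delta> * n > 0" using \<delta> n by simp
    have "(\<Sum>k=1..K. prob {X \<in> G. \<delta> * n \<le> norm (mat_trace (X ^\<^sub>m k))}) \<le> (\<Sum>k=1..K. C k / (\<delta> * n)\<^sup>2)"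
      by (intro sum_mono prob_large_trace_power_le[OF pos] C) simp_all
    also have "\<dots> = D / (\<delta> * n)\<^sup>2" by (simp add: D_def sum_divide_distrib)
    finally show "(\<Sum>k=1..K. prob {X \<in> G. \<delta> * n \<le> norm (mat_trace (X ^\<^sub>m k))}) \<le> D / (\<delta> * n)\<^sup>2" .
  qed
qed

lemma (in haar_classical) trace_event_sets:
  "{X \<in> G. norm (mat_trace X) \<le> t} \<in> sets \<nu>"
  "{X \<in> G. t \<le> norm (mat_trace (X ^\<^sub>m k))} \<in> sets \<nu>"
proof -
  have car: "G \<subseteq> carrier_mat n n" using group_carrier by blast
  have m: "(\<lambda>X. mat_trace (X ^\<^sub>m k)) \<in> borel_measurable \<nu>" for k
    unfolding borel_measurable_nu by (rule trace_pow_measurable[OF car])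
  have "{X \<in> space \<nu>. t \<le> norm (mat_trace (X ^\<^sub>m k))} \<in> sets \<nu>" for k t
    using m[of k] by measurable
  thus "{X \<in> G. t \<le> norm (mat_trace (X ^\<^sub>m k))} \<in> sets \<nu>" by simp
  have "{X \<in> space \<nu>. norm (mat_trace (X ^\<^sub>m 1)) \<le> t} \<in> sets \<nu>"
    using m[of 1] by measurable
  also have "{X \<in> space \<nu>. norm (mat_trace (X ^\<^sub>m 1)) \<le> t} = {X \<in> G. norm (mat_trace X) \<le> t}"
  proof -
    have "X ^\<^sub>m 1 = X" if "X \<in> G" for X using group_carrier[OF that] by simp
    thus ?thesis by auto
  qed
  finally show "{X \<in> G. norm (mat_trace X) \<le> t} \<in> sets \<nu>" .
qed

theorem theorem9:
  fixes P :: "nat \<Rightarrow> 'w measure"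
    and G :: "nat \<Rightarrow> complex mat set"
    and M :: "nat \<Rightarrow> 'w \<Rightarrow> complex mat"
  assumes "\<And>n. n \<ge> 1 \<Longrightarrow> prob_space (P n)"
    and "\<And>n. n \<ge> 1 \<Longrightarrow> G n \<in> classical_groups n"
    and "\<And>n. n \<ge> 1 \<Longrightarrow> haar_distributed n (G n) (P n) (M n)"
  shows "converges_weakly_in_prob P (\<lambda>n \<omega>. derivative_root_measure (M n \<omega>)) uniform_circle"
  unfolding converges_weakly_in_prob_def
proof (intro allI impI)
  fix f :: "complex \<Rightarrow> real" and \<epsilon> :: real
  assume cont: "continuous_on UNIV f" and \<epsilon>: "\<epsilon> > 0"
  define Dev where "Dev = (\<lambda>n. {\<omega> \<in> space (P n).
    \<bar>integral\<^sup>L (derivative_root_measure (M n \<omega>)) f - integral\<^sup>L uniform_circle f\<bar> > \<epsilon>})"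
  obtain K :: nat and \<delta> :: real where \<delta>: "\<delta> > 0" and close:
    "\<forall>n A. n \<ge> 2 \<longrightarrow> A \<in> unitary_group n \<longrightarrow> n * exp (- \<delta> * n) < norm (mat_trace A) \<longrightarrow>
       (\<forall>k\<in>{1..K}. norm (mat_trace (A ^\<^sub>m k)) < \<delta> * n) \<longrightarrow> 2 ^ K \<le> \<delta> * n \<longrightarrow>
       \<bar>integral\<^sup>L (derivative_root_measure A) f - integral\<^sup>L uniform_circle f\<bar> \<le> \<epsilon>"
    using derivative_root_measure_close[OF cont \<epsilon>] by (elim exE conjE)
  obtain u N where u: "u \<longlonglongrightarrow> 0" and small: "\<forall>n G \<nu>. n \<ge> N \<longrightarrow> haar_classical \<nu> n G \<longrightarrow>
       measure \<nu> {X \<in> G. norm (mat_trace X) \<le> n * exp (- \<delta> * n)} \<le> u n"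
    using eventually_small_trace_unlikely[OF \<delta>] by (elim exE conjE)
  obtain v where v: "v \<longlonglongrightarrow> 0" and large: "\<forall>n G \<nu>. n \<ge> 1 \<longrightarrow> haar_classical \<nu> n G \<longrightarrow>
       (\<Sum>k=1..K. measure \<nu> {X \<in> G. \<delta> * n \<le> norm (mat_trace (X ^\<^sub>m k))}) \<le> v n"
    using eventually_large_trace_powers_unlikely[OF \<delta>, of K] by (elim exE conjE)
  obtain N' :: nat where N': "2 ^ K / \<delta> \<le> N'" using real_arch_simple by blast
  have bound: "measure (P n) (Dev n) \<le> u n + v n" if n: "n \<ge> max 2 (max N N')" for n
  proof -
    have n1: "n \<ge> 1" and n2: "n \<ge> 2" using n by simp_all
    define \<nu> where "\<nu> = distr (P n) (mat_borel n (G n)) (M n)"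
    have meas: "M n \<in> P n \<rightarrow>\<^sub>M mat_borel n (G n)" and haar: "haar_prob_measure n (G n) \<nu>"
      using assms(3)[OF n1] by (simp_all add: haar_distributed_def \<nu>_def)
    interpret P: prob_space "P n" by (rule assms(1)[OF n1])
    have hc: "haar_classical \<nu> n (G n)" by (rule haar_classicalI[OF assms(2)[OF n1] haar])
    interpret H: haar_classical \<nu> n "G n" by (rule hc)
    define S where "S = {X \<in> G n. norm (mat_trace X) \<le> n * exp (- \<delta> * n)}"
    define T where "T = (\<lambda>k. {X \<in> G n. \<delta> * n \<le> norm (mat_trace (X ^\<^sub>m k))})"
    define B where "B = S \<union> (\<Union>k\<in>{1..K}. T k)"
    have sets: "S \<in> sets \<nu>" "T k \<in> sets \<nu>" for k
      unfolding S_def T_def by (rule H.trace_event_sets)+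
    have Bsets: "B \<in> sets \<nu>" unfolding B_def using sets by auto
    have "2 ^ K \<le> \<delta> * n"
    proof -
      have "real N' \<le> n" using n by simp
      hence "2 ^ K / \<delta> \<le> n" using N' by (rule order.trans[rotated])
      thus ?thesis using \<delta> by (simp add: pos_divide_le_eq mult.commute)
    qed
    have sub: "Dev n \<subseteq> M n -` B \<inter> space (P n)"
    proof
      fix \<omega> assume \<omega>: "\<omega> \<in> Dev n"
      have MG: "M n \<omega> \<in> G n" using measurable_space[OF meas] \<omega> by (simp add: Dev_def)
      have "M n \<omega> \<in> B"
      proof (rule ccontr)
        assume notB: "M n \<omega> \<notin> B"
        have "\<bar>integral\<^sup>L (derivative_root_measure (M n \<omega>)) f - integral\<^sup>L uniform_circle f\<bar> \<le> \<epsilon>"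
        proof (rule close[rule_format, OF n2 H.group_unitary[OF MG]])
          show "n * exp (- \<delta> * n) < norm (mat_trace (M n \<omega>))"
            using notB MG unfolding B_def S_def by (simp add: not_le)
          show "norm (mat_trace (M n \<omega> ^\<^sub>m k)) < \<delta> * n" if "k \<in> {1..K}" for k
          proof -
            have "M n \<omega> \<notin> T k" using notB that unfolding B_def by blast
            thus ?thesis using MG by (simp add: T_def not_le)
          qed
        qed fact
        thus False using \<omega> by (simp add: Dev_def)
      qed
      thus "\<omega> \<in> M n -` B \<inter> space (P n)" using \<omega> by (simp add: Dev_def)
    qed
    have Bpre: "M n -` B \<inter> space (P n) \<in> sets (P n)"
      using Bsets unfolding H.sets_nu by (rule measurable_sets[OF meas])
    (* A set that is not measurable has measure 0 by convention. *)
    have "measure (P n) (Dev n) \<le> measure (P n) (M n -` B \<inter> space (P n))"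
    proof (cases "Dev n \<in> sets (P n)")
      case True
      show ?thesis by (rule P.finite_measure_mono[OF sub Bpre])
    next
      case False
      thus ?thesis by (simp add: measure_notin_sets)
    qed
    also have "\<dots> = measure \<nu> B"
      unfolding \<nu>_def using Bsets unfolding H.sets_nu by (intro measure_distr[OF meas, symmetric])
    also have "\<dots> \<le> measure \<nu> S + measure \<nu> (\<Union>k\<in>{1..K}. T k)"
      unfolding B_def by (intro measure_Un_le) (use sets in auto)
    also have "measure \<nu> (\<Union>k\<in>{1..K}. T k) \<le> (\<Sum>k=1..K. measure \<nu> (T k))"
      by (intro measure_UNION_le) (use sets in auto)
    also have "measure \<nu> S \<le> u n" unfolding S_def using small[rule_format, OF _ hc] n by simp
    also have "(\<Sum>k=1..K. measure \<nu> (T k)) \<le> v n" unfolding T_def by (rule large[rule_format, OF n1 hc])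
    finally show ?thesis by simp
  qed
  have lim: "(\<lambda>n. u n + v n) \<longlonglongrightarrow> 0" using tendsto_add[OF u v] by simp
  have "(\<lambda>n. measure (P n) (Dev n)) \<longlonglongrightarrow> 0"
  proof (rule tendsto_sandwich[OF _ _ tendsto_const lim])
    show "eventually (\<lambda>n. 0 \<le> measure (P n) (Dev n)) sequentially" by simp
    show "eventually (\<lambda>n. measure (P n) (Dev n) \<le> u n + v n) sequentially"
      by (rule eventually_sequentiallyI[of "max 2 (max N N')"]) (rule bound)
  qed
  thus "(\<lambda>n. measure (P n) {\<omega> \<in> space (P n).
      \<bar>integral\<^sup>L (derivative_root_measure (M n \<omega>)) f - integral\<^sup>L uniform_circle f\<bar> > \<epsilon>}) \<longlonglongrightarrow> 0"
    unfolding Dev_def .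
qed

end
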